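(* If $R\in\{1,\dots,p\}$ divides $p$, $\frac{p}{R}\leq s\leq p$ (with $p,s$ natural numbers), and $\gamma\in[0,1)$, then $$\varepsilon^*(p,s,\gamma,R)^2\asymp\begin{cases}\psi_1^2+\left(1-\gamma+\gamma\frac{p}{R}\right)\frac{Rs}{p}\log\left(1+\frac{p^2}{Rs^2}\right)&\text{if }\frac{p}{R}\leq s<\frac{p}{\sqrt{R}},\\(1-\gamma)\sqrt{p}+\left(1-\gamma+\gamma\frac{p}{R}\right)\sqrt{R}&\text{if }s\geq\frac{p}{\sqrt{R}},\end{cases}$$ where $$\psi_1^2:=\begin{cases}(1-\gamma)s\log\left(1+\frac{p}{s^2}\right)&\text{if }s<\sqrt{p},\\(1-\gamma)\sqrt{p}&\text{if }s\geq\sqrt{p}.\end{cases}$$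
   Context: Notation: $\|\cdot\|$ is the Euclidean norm; $\|\theta\|_0$ is the number of nonzero coordinates. Let $R$ divide $p$ and let $B_1,\dots,B_R$ be a partition of $[p]=\{1,\dots,p\}$ into $R$ known groups of size $p/R$ each. $\mathbf{1}_{B_k}\in\mathbb{R}^p$ is the indicator vector of $B_k$. For $\theta\in\mathbb{R}^p$, $P_{\theta,\gamma,R}$ denotes the distribution $N\big(\theta,(1-\gamma)I_p+\gamma\sum_{k=1}^R\mathbf{1}_{B_k}\mathbf{1}_{B_k}^\intercal\big)$ of the observation $X$. For $\varepsilon>0$ let $\Theta(p,s,\varepsilon)=\{\theta\in\mathbb{R}^p:\|\theta\|\geq\varepsilon,\ \|\theta\|_0\leq s\}$. The minimax testing risk for $H_0:\theta=0$ against $H_1:\theta\in\Theta(p,s,\varepsilon)$ is $$\mathcal{R}(\varepsilon)=\inf_{\varphi}\Big\{P_{0,\gamma,R}\{\varphi=1\}+\sup_{\theta\in\Theta(p,s,\varepsilon)}P_{\theta,\gamma,R}\{\varphi=0\}\Big\},$$ the infimum being over all measurable $\varphi:\mathbb{R}^p\to\{0,1\}$ (this does not depend on the choice of the groups, only on $R$). Definition: $\varepsilon^*=\varepsilon^*(p,s,\gamma,R)$ is the minimax separation rate if (i) for every $\eta\in(0,1)$ there is $C_\eta>0$ depending only on $\eta$ such that $C>C_\eta$ implies $\mathcal{R}(C\varepsilon^* )\leq\eta$; and (ii) for every $\eta\in(0,1)$ there is $c_\eta>0$ depending only on $\eta$ such that $0<c<c_\eta$ implies $\mathcal{R}(c\varepsilon^*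 )\geq1-\eta$. The constants do not depend on $(p,s,\gamma,R)$. The rate is unique only up to multiplication by universal constants, and $a\asymp b$ means equality up to universal positive multiplicative constants; thus $(\varepsilon^* )^2\asymp\psi^2$ means that $\psi$ satisfies (i) and (ii) in place of $\varepsilon^*$. *)

theory Defs
  imports "HOL-Probability.Probability" "Jordan_Normal_Form.Gauss_Jordan_Elimination"
    "Jordan_Normal_Form.Determinant"
begin

text \<open>
  The dimension is quantified inside the asymptotic notions below, so it cannot be a type.
  The space of real \<open>p\<close>-vectors is the extensional function space \<open>{..<p} \<rightarrow>\<^sub>E UNIV\<close>, with the
  product Borel sigma-algebra; coordinates and groups are numbered from \<open>0\<close>.
\<close>

text \<open>
  The density and the measure below are only meaningful for positive definite \<open>\<Sigma>\<close>; this is the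
  case for the covariance matrices used here, since \<open>0 \<le> \<gamma> < 1\<close>. Names are qualified because
  \<open>HOL-Analysis\<close> also has matrices, of type-indexed dimension.
\<close>

definition mvn_density :: "nat \<Rightarrow> (nat \<Rightarrow> real) \<Rightarrow> real Matrix.mat \<Rightarrow> (nat \<Rightarrow> real) \<Rightarrow> real" where
  "mvn_density p \<mu> \<Sigma> x =
     (let d = Matrix.vec p (\<lambda>i. x i - \<mu> i); Q = the (mat_inverse \<Sigma>)
      in exp (- scalar_prod d (mult_mat_vec Q d) / 2) / sqrt ((2 * pi) ^ p * Determinant.det \<Sigma>))"

definition mvn :: "nat \<Rightarrow> (nat \<Rightarrow> real) \<Rightarrow> real Matrix.mat \<Rightarrow> (nat \<Rightarrow> real) measure" where
  "mvn p \<mu> \<Sigma> = density (Pi\<^sub>M {..<p} (\<lambda>_. lborel)) (\<lambda>x. ennreal (mvn_density p \<mu> \<Sigma> x))"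

definition equal_groups :: "nat \<Rightarrow> nat \<Rightarrow> (nat \<Rightarrow> nat set) \<Rightarrow> bool" where
  "equal_groups p R B \<longleftrightarrow>
     disjoint_family_on B {..<R} \<and> (\<Union>k<R. B k) = {..<p} \<and> (\<forall>k<R. card (B k) = p div R)"

definition group_cov :: "nat \<Rightarrow> real \<Rightarrow> nat \<Rightarrow> (nat \<Rightarrow> nat set) \<Rightarrow> real Matrix.mat" where
  "group_cov p \<gamma> R B = Matrix.mat p p (\<lambda>(i, j).
     (1 - \<gamma>) * of_bool (i = j) + \<gamma> * (\<Sum>k<R. indicator (B k) i * indicator (B k) j))"

definition obs_law ::
    "nat \<Rightarrow> real \<Rightarrow> nat \<Rightarrow> (nat \<Rightarrow> nat set) \<Rightarrow> (nat \<Rightarrow> real) \<Rightarrow> (nat \<Rightarrow> real) measure" where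
  "obs_law p \<gamma> R B \<theta> = mvn p \<theta> (group_cov p \<gamma> R B)"

definition sparse_alternatives :: "nat \<Rightarrow> nat \<Rightarrow> real \<Rightarrow> (nat \<Rightarrow> real) set" where
  "sparse_alternatives p s \<epsilon> =
     {\<theta> \<in> {..<p} \<rightarrow>\<^sub>E UNIV. L2_set \<theta> {..<p} \<ge> \<epsilon> \<and> card {i \<in> {..<p}. \<theta> i \<noteq> 0} \<le> s}"

definition tests :: "nat \<Rightarrow> ((nat \<Rightarrow> real) \<Rightarrow> nat) set" where
  "tests p = measurable (Pi\<^sub>M {..<p} (\<lambda>_. borel)) (count_space {0, 1})"

text \<open>
  For \<open>p, s \<ge> 1\<close> the set of alternatives is nonempty, so the real-valued supremum and infimum are
  taken over nonempty bounded sets.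
\<close>

definition testing_risk ::
    "nat \<Rightarrow> nat \<Rightarrow> real \<Rightarrow> nat \<Rightarrow> (nat \<Rightarrow> nat set) \<Rightarrow> real \<Rightarrow> real" where
  "testing_risk p s \<gamma> R B \<epsilon> =
     (INF \<phi>\<in>tests p.
        measure (obs_law p \<gamma> R B (\<lambda>i\<in>{..<p}. 0)) {x \<in> {..<p} \<rightarrow>\<^sub>E UNIV. \<phi> x = 1} +
        (SUP \<theta>\<in>sparse_alternatives p s \<epsilon>.
           measure (obs_law p \<gamma> R B \<theta>) {x \<in> {..<p} \<rightarrow>\<^sub>E UNIV. \<phi> x = 0}))"

text \<open>
  \<open>D\<close> is the range of the parameters \<open>(p, s, \<gamma>, R)\<close>. The constants are chosen before the
  parameters and before the groups. The rate is determined only up to universal positive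
  constants, so \<open>(\<epsilon>\<^sup>*)\<^sup>2 \<asymp> \<psi>\<^sup>2\<close> on \<open>D\<close> is \<open>minimax_separation_rate D \<psi>\<close>.
\<close>

definition minimax_separation_rate ::
    "(nat \<times> nat \<times> real \<times> nat) set \<Rightarrow> (nat \<Rightarrow> nat \<Rightarrow> real \<Rightarrow> nat \<Rightarrow> real) \<Rightarrow> bool" where
  "minimax_separation_rate D \<psi> \<longleftrightarrow>
     (\<forall>\<eta>\<in>{0<..<1}. \<exists>C\<^sub>\<eta>>0. \<forall>(p, s, \<gamma>, R)\<in>D. \<forall>B. equal_groups p R B \<longrightarrow>
        (\<forall>C>C\<^sub>\<eta>. testing_risk p s \<gamma> R B (C * \<psi> p s \<gamma> R) \<le> \<eta>)) \<and>
     (\<forall>\<eta>\<in>{0<..<1}. \<exists>c\<^sub>\<eta>>0. \<forall>(p, s, \<gamma>, R)\<in>D. \<forall>B. equal_groups p R B \<longrightarrow>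
        (\<forall>c. 0 < c \<and> c < c\<^sub>\<eta> \<longrightarrow> testing_risk p s \<gamma> R B (c * \<psi> p s \<gamma> R) \<ge> 1 - \<eta>))"

definition psi1_sq :: "nat \<Rightarrow> nat \<Rightarrow> real \<Rightarrow> real" where
  "psi1_sq p s \<gamma> =
     (if real s < sqrt (real p) then (1 - \<gamma>) * real s * ln (1 + real p / (real s)\<^sup>2)
      else (1 - \<gamma>) * sqrt (real p))"

definition rate_sq :: "nat \<Rightarrow> nat \<Rightarrow> real \<Rightarrow> nat \<Rightarrow> real" where
  "rate_sq p s \<gamma> R =
     (if real s < real p / sqrt (real R)
      then psi1_sq p s \<gamma> + (1 - \<gamma> + \<gamma> * (real p / real R)) * (real R * real s / real p) *
             ln (1 + (real p)\<^sup>2 / (real R * (real s)\<^sup>2))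
      else (1 - \<gamma>) * sqrt (real p) + (1 - \<gamma> + \<gamma> * (real p / real R)) * sqrt (real R))"

end

theory Submission imports Defs begin

text \<open>
  The covariance matrix has two eigenvalues: \<open>lam1 = 1 - \<gamma> + \<gamma> m\<close>, with \<open>m = p/R\<close>, on the vectors that are
  constant on the groups, and \<open>lam0 = 1 - \<gamma>\<close> on their orthogonal complement. Let \<open>seq_rate n r\<close> be the
  squared separation rate for \<open>r\<close>-sparse means in \<open>n\<close> independent coordinates of unit variance, that is
  \<open>r ln (1 + n/r\<^sup>2)\<close> for \<open>r < sqrt n\<close> and \<open>sqrt n\<close> otherwise. The claimed squared rate is
  \<open>lam0 seq_rate p s + lam1 seq_rate R (s/m)\<close> (lemma \<open>rate_sq_eq\<close>): the single coordinates form a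
  sequence model with noise level \<open>lam0\<close>, and the groups one with noise level \<open>lam1\<close> and sparsity \<open>s/m\<close>.

  Upper bound. Multiplying the observation by the inverse square root of the covariance matrix gives
  independent normal coordinates of unit variance (\<open>distr_whiten\<close>), and so are the rescaled group sums
  of these. In each of the two sequence models, the test adds up the scores \<open>(x\<^sup>2 - \<tau>\<^sup>2)\<^sub>+\<close>, or \<open>x\<^sup>2\<close> in the
  dense regime. Its errors are bounded by Chebyshev's inequality (\<open>sequence_test_errors\<close>); only the energy
  on some set of at most \<open>2 r\<close> coordinates has to be large. Such sets exist for the whitened mean although
  whitening destroys sparsity (\<open>energy_split\<close>): in a group that is less than half filled by the support,
  whitening keeps a quarter of the energy on the support, and the other groups are so few that all of
  their coordinates and their group means can be included.

  Lower bound. By the second moment method (\<open>testing_risk_ge\<close>) it suffices that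
  \<open>exp (\<theta>\<^sup>T \<Sigma>\<^sup>-\<^sup>1 \<theta>')\<close> has mean close to \<open>1\<close> for two independent draws from a prior. The priors put
  equal entries either on a random set of coordinates or on a random set of groups. The random set
  takes one element from each of \<open>r\<close> disjoint blocks, so that the moment of the overlap is a product
  (\<open>block_overlap_moment\<close>).
\<close>

section \<open>Linear changes of variables for product Lebesgue measure\<close>

text \<open>
  Replacing one coordinate \<open>x\<^sub>i\<close> by \<open>h x + a x\<^sub>i\<close>, where \<open>h\<close> depends on the other coordinates only,
  multiplies the volume by \<open>|a|\<close>. All linear maps needed below are products of such maps.
\<close>

lemma nn_integral_PiM_lborel_coordinate_affine:
  fixes g :: "('i \<Rightarrow> real) \<Rightarrow> ennreal"
  assumes fin: "finite I" and i: "i \<in> I" and a: "a \<noteq> 0"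
    and g [measurable]: "g \<in> borel_measurable (Pi\<^sub>M I (\<lambda>_. lborel))"
    and h [measurable]: "h \<in> borel_measurable (Pi\<^sub>M I (\<lambda>_. lborel))"
    and indep: "\<And>x y. h (x(i := y)) = h x"
  shows "(\<integral>\<^sup>+x. g x \<partial>Pi\<^sub>M I (\<lambda>_. lborel)) =
    ennreal \<bar>a\<bar> * (\<integral>\<^sup>+x. g (x(i := h x + a * x i)) \<partial>Pi\<^sub>M I (\<lambda>_. lborel))"
proof -
  interpret product_sigma_finite "\<lambda>_::'i. lborel :: real measure" ..
  define J where "J = I - {i}"
  have I: "I = insert i J" and J: "finite J" "i \<notin> J"
    using fin i by (auto simp: J_def)
  have upd [measurable]: "(\<lambda>x. x(i := h x + a * x i)) \<in>
      measurable (Pi\<^sub>M I (\<lambda>_. lborel)) (Pi\<^sub>M I (\<lambda>_. lborel))"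
    using i by (intro measurable_fun_upd[where J = I]) (auto simp: insert_absorb)
  have upd' [measurable]: "(\<lambda>y. x(i := y)) \<in> measurable lborel (Pi\<^sub>M I (\<lambda>_. lborel))"
    if "x \<in> space (Pi\<^sub>M J (\<lambda>_. lborel))" for x
    using that unfolding I by (intro measurable_fun_upd[where J = J]) auto
  have "(\<integral>\<^sup>+x. g x \<partial>Pi\<^sub>M I (\<lambda>_. lborel)) =
      (\<integral>\<^sup>+x. \<integral>\<^sup>+y. g (x(i := y)) \<partial>lborel \<partial>Pi\<^sub>M J (\<lambda>_. lborel))"
    using g J unfolding I by (intro product_nn_integral_insert) auto
  also have "\<dots> = (\<integral>\<^sup>+x. ennreal \<bar>a\<bar> * (\<integral>\<^sup>+y. g (x(i := h x + a * y)) \<partial>lborel) \<partial>Pi\<^sub>M J (\<lambda>_. lborel))"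
  proof (intro nn_integral_cong)
    fix x assume [measurable]: "x \<in> space (Pi\<^sub>M J (\<lambda>_. lborel :: real measure))"
    have "(\<lambda>y. g (x(i := y))) \<in> borel_measurable lborel"
      by measurable
    hence "(\<lambda>y. g (x(i := y))) \<in> borel_measurable borel" by simp
    from nn_integral_real_affine[OF this a, of "h x"]
    show "(\<integral>\<^sup>+y. g (x(i := y)) \<partial>lborel) =
        ennreal \<bar>a\<bar> * (\<integral>\<^sup>+y. g (x(i := h x + a * y)) \<partial>lborel)" .
  qed
  also have "\<dots> = ennreal \<bar>a\<bar> * (\<integral>\<^sup>+x. \<integral>\<^sup>+y. g (x(i := h x + a * y)) \<partial>lborel \<partial>Pi\<^sub>M J (\<lambda>_. lborel))"
  proof (rule nn_integral_cmult)
    have "(\<lambda>x. g (x(i := h x + a * x i))) \<in> borel_measurable (Pi\<^sub>M (insert i J) (\<lambda>_. lborel))"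
      unfolding I[symmetric] by measurable
    moreover have "(\<lambda>(x, y). x(i := y)) \<in> measurable (Pi\<^sub>M J (\<lambda>_. lborel) \<Otimes>\<^sub>M lborel) (Pi\<^sub>M (insert i J) (\<lambda>_. lborel))"
      by (rule measurable_add_dim)
    ultimately have "(\<lambda>z. g (((\<lambda>(x, y). x(i := y)) z)(i := h ((\<lambda>(x, y). x(i := y)) z) + a * ((\<lambda>(x, y). x(i := y)) z) i)))
        \<in> borel_measurable (Pi\<^sub>M J (\<lambda>_. lborel) \<Otimes>\<^sub>M lborel)"
      by (rule measurable_compose[rotated])
    hence "(\<lambda>(x, y). g (x(i := h x + a * y))) \<in> borel_measurable (Pi\<^sub>M J (\<lambda>_. lborel) \<Otimes>\<^sub>M lborel)"
      by (simp add: indep case_prod_beta')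
    thus "(\<lambda>x. \<integral>\<^sup>+y. g (x(i := h x + a * y)) \<partial>lborel) \<in> borel_measurable (Pi\<^sub>M J (\<lambda>_. lborel))"
      by (intro sigma_finite_measure.borel_measurable_nn_integral sigma_finite_lborel) auto
  qed
  also have "(\<integral>\<^sup>+x. \<integral>\<^sup>+y. g (x(i := h x + a * y)) \<partial>lborel \<partial>Pi\<^sub>M J (\<lambda>_. lborel)) =
      (\<integral>\<^sup>+x. g (x(i := h x + a * x i)) \<partial>Pi\<^sub>M I (\<lambda>_. lborel))"
    unfolding I
  proof (subst product_nn_integral_insert)
    show "(\<lambda>x. g (x(i := h x + a * x i))) \<in> borel_measurable (Pi\<^sub>M (insert i J) (\<lambda>_. lborel))"
      unfolding I[symmetric] by measurable
  qed (use J in \<open>auto simp: indep\<close>)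
  finally show ?thesis .
qed

lemma measurable_PiM_lborel_update:
  fixes f :: "('i \<Rightarrow> real) \<Rightarrow> 'i \<Rightarrow> real"
  assumes J: "J \<subseteq> I" and f: "\<And>j. j \<in> J \<Longrightarrow> (\<lambda>x. f x j) \<in> borel_measurable (Pi\<^sub>M I (\<lambda>_. lborel))"
  shows "(\<lambda>x j. if j \<in> J then f x j else x j) \<in> measurable (Pi\<^sub>M I (\<lambda>_. lborel)) (Pi\<^sub>M I (\<lambda>_. lborel))"
proof (rule measurable_PiM_single')
  show "(\<lambda>x j. if j \<in> J then f x j else x j) \<in> space (Pi\<^sub>M I (\<lambda>_. lborel)) \<rightarrow> I \<rightarrow>\<^sub>E space lborel"
  proof (intro Pi_I PiE_I)
    fix x j assume x: "x \<in> space (Pi\<^sub>M I (\<lambda>_. lborel :: real measure))" and j: "j \<notin> I"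
    hence "j \<notin> J" using J by blast
    moreover have "x j = undefined" using x j by (simp add: space_PiM PiE_def extensional_def)
    ultimately show "(if j \<in> J then f x j else x j) = undefined" by simp
  qed simp
  show "(\<lambda>x. if j \<in> J then f x j else x j) \<in> measurable (Pi\<^sub>M I (\<lambda>_. lborel)) lborel" if "j \<in> I" for j
    using f[of j] that by (cases "j \<in> J") (simp_all add: measurable_lborel1)
qed

lemma nn_integral_PiM_lborel_common_shift:
  fixes g :: "('i \<Rightarrow> real) \<Rightarrow> ennreal"
  assumes fin: "finite I" and i: "i \<in> I" and J: "J \<subseteq> I - {i}"
    and g [measurable]: "g \<in> borel_measurable (Pi\<^sub>M I (\<lambda>_. lborel))"
  shows "(\<integral>\<^sup>+x. g x \<partial>Pi\<^sub>M I (\<lambda>_. lborel)) =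
    (\<integral>\<^sup>+x. g (\<lambda>j. if j \<in> J then x j + b * x i else x j) \<partial>Pi\<^sub>M I (\<lambda>_. lborel))"
proof -
  have "finite J" using fin J finite_subset by blast
  thus ?thesis using J
  proof (induction J)
    case (insert j J)
    have [measurable]: "(\<lambda>x k. if k \<in> J then x k + b * x i else x k) \<in>
        measurable (Pi\<^sub>M I (\<lambda>_. lborel)) (Pi\<^sub>M I (\<lambda>_. lborel))"
    proof (rule measurable_PiM_lborel_update)
      fix k assume "k \<in> J"
      hence "k \<in> I" using insert.prems by auto
      thus "(\<lambda>x. x k + b * x i) \<in> borel_measurable (Pi\<^sub>M I (\<lambda>_. lborel))" using i by simp
    qed (use insert.prems in auto)
    have "(\<integral>\<^sup>+x. g x \<partial>Pi\<^sub>M I (\<lambda>_. lborel)) =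
        (\<integral>\<^sup>+x. g (\<lambda>k. if k \<in> J then x k + b * x i else x k) \<partial>Pi\<^sub>M I (\<lambda>_. lborel))"
      using insert by auto
    also have "\<dots> = ennreal \<bar>1\<bar> * (\<integral>\<^sup>+x. g (\<lambda>k. if k \<in> J then (x(j := b * x i + 1 * x j)) k + b * (x(j := b * x i + 1 * x j)) i
        else (x(j := b * x i + 1 * x j)) k) \<partial>Pi\<^sub>M I (\<lambda>_. lborel))"
      by (rule nn_integral_PiM_lborel_coordinate_affine[OF fin])
        (use insert.prems i in \<open>auto\<close>)
    also have "\<dots> = (\<integral>\<^sup>+x. g (\<lambda>k. if k \<in> insert j J then x k + b * x i else x k) \<partial>Pi\<^sub>M I (\<lambda>_. lborel))"
      using insert.prems insert.hyps
      by (auto intro!: nn_integral_cong arg_cong[where f = g] simp: fun_eq_iff)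
    finally show ?case .
  qed auto
qed

text \<open>
  The linear map \<open>x \<mapsto> x + b (\<Sum>\<^sub>B x) 1\<^sub>B\<close> has determinant \<open>1 + b |B|\<close>. The proof factors it into maps
  that change one coordinate at a time.
\<close>

lemma nn_integral_PiM_lborel_rank_one:
  fixes g :: "('i \<Rightarrow> real) \<Rightarrow> ennreal" and b :: real
  assumes fin: "finite I" and B: "B \<subseteq> I" "B \<noteq> {}" and nz: "1 + b * card B \<noteq> 0"
    and g [measurable]: "g \<in> borel_measurable (Pi\<^sub>M I (\<lambda>_. lborel))"
  shows "(\<integral>\<^sup>+x. g x \<partial>Pi\<^sub>M I (\<lambda>_. lborel)) = ennreal \<bar>1 + b * card B\<bar> *
    (\<integral>\<^sup>+x. g (\<lambda>j. if j \<in> B then x j + b * (\<Sum>i\<in>B. x i) else x j) \<partial>Pi\<^sub>M I (\<lambda>_. lborel))"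
proof -
  obtain i where i: "i \<in> B" using B by auto
  define J where "J = B - {i}"
  have finB: "finite B" using fin B finite_subset by blast
  have J: "J \<subseteq> I - {i}" "B = insert i J" "i \<notin> J" "finite J" "i \<in> I"
    using i B finB by (auto simp: J_def)
  let ?M = "Pi\<^sub>M I (\<lambda>_. lborel :: real measure)"
  let ?a = "1 + b * card B"
  define s where "s x = (\<Sum>j\<in>J. x j)" for x :: "'i \<Rightarrow> real"
  have s [measurable]: "s \<in> borel_measurable ?M" unfolding s_def
    using J by (intro borel_measurable_sum) auto
  have s_upd: "s (x(i := y)) = s x" for x y
    unfolding s_def using J by (intro sum.cong) auto
  have sum_B: "(\<Sum>j\<in>B. x j) = x i + s x" for x
    using J by (simp add: s_def)
  \<comment> \<open>With \<open>s = \<Sum>\<^sub>J x\<close>: first \<open>x\<^sub>i\<close> becomes \<open>s + x\<^sub>i = \<Sum>\<^sub>B x\<close>, then \<open>E\<close> adds \<open>b \<Sum>\<^sub>B x\<close> to the coordinates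
    in \<open>J\<close>, and finally \<open>x\<^sub>i\<close> is restored; only the last step has a determinant other than \<open>1\<close>.\<close>
  define E where "E x = (\<lambda>j. if j \<in> J then x j + b * x i else x j)" for x :: "'i \<Rightarrow> real"
  have E [measurable]: "E \<in> measurable ?M ?M" unfolding E_def
  proof (rule measurable_PiM_lborel_update)
    fix k assume "k \<in> J"
    hence "k \<in> I" using J by auto
    thus "(\<lambda>x. x k + b * x i) \<in> borel_measurable ?M" using J by simp
  qed (use J in auto)
  have U [measurable]: "(\<lambda>x. x(i := - s x + ?a * x i)) \<in> measurable ?M ?M"
    using J by (intro measurable_fun_upd[where J = I]) (auto simp: insert_absorb)
  have gU [measurable]: "(\<lambda>x. g (x(i := - s x + ?a * x i))) \<in> borel_measurable ?M"
    by measurable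
  have gE [measurable]: "(\<lambda>x. g ((E x)(i := - s (E x) + ?a * E x i))) \<in> borel_measurable ?M"
    by (rule measurable_compose[OF E gU])
  have s': "(\<lambda>x. - s x) \<in> borel_measurable ?M" by measurable
  have factor: "(E (x(i := s x + 1 * x i)))
      (i := - s (E (x(i := s x + 1 * x i))) + ?a * E (x(i := s x + 1 * x i)) i) =
      (\<lambda>j. if j \<in> B then x j + b * (\<Sum>i\<in>B. x i) else x j)" for x
  proof -
    let ?y = "x(i := s x + 1 * x i)"
    have "s (E ?y) = (\<Sum>j\<in>J. x j + b * (s x + x i))"
      unfolding s_def E_def using J by (intro sum.cong) auto
    also have "\<dots> = s x + card J * (b * (s x + x i))"
      by (simp add: s_def sum.distrib)
    finally have sE: "s (E ?y) = s x + card J * (b * (s x + x i))" .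
    have Ei: "E ?y i = s x + x i" using J by (simp add: E_def)
    have cB: "real (card B) = 1 + card J" using J by simp
    have "- s (E ?y) + ?a * E ?y i = x i + b * (x i + s x)"
      unfolding sE Ei cB by (simp add: algebra_simps)
    moreover have "E ?y j = x j + b * (x i + s x)" if "j \<in> J" for j
      using that J by (auto simp: E_def algebra_simps)
    moreover have "E ?y j = x j" if "j \<notin> B" for j
      using that J by (auto simp: E_def)
    ultimately show ?thesis
      unfolding fun_eq_iff using sum_B J(2) by (metis fun_upd_apply insertE insertI1)
  qed
  have "(\<integral>\<^sup>+x. g x \<partial>?M) = ennreal \<bar>?a\<bar> * (\<integral>\<^sup>+x. g (x(i := - s x + ?a * x i)) \<partial>?M)"
    using J by (intro nn_integral_PiM_lborel_coordinate_affine[OF fin _ nz g s']) (auto simp: s_upd)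
  also have "(\<integral>\<^sup>+x. g (x(i := - s x + ?a * x i)) \<partial>?M) =
      (\<integral>\<^sup>+x. g ((E x)(i := - s (E x) + ?a * E x i)) \<partial>?M)"
    unfolding E_def using J by (intro nn_integral_PiM_lborel_common_shift[OF fin _ _ gU]) auto
  also have "\<dots> = ennreal \<bar>1\<bar> * (\<integral>\<^sup>+x. g ((E (x(i := s x + 1 * x i)))
      (i := - s (E (x(i := s x + 1 * x i))) + ?a * E (x(i := s x + 1 * x i)) i)) \<partial>?M)"
    using J by (intro nn_integral_PiM_lborel_coordinate_affine[OF fin _ _ gE s]) (auto simp: s_upd)
  also have "\<dots> = (\<integral>\<^sup>+x. g (\<lambda>j. if j \<in> B then x j + b * (\<Sum>i\<in>B. x i) else x j) \<partial>?M)"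
    by (simp only: factor) simp
  finally show ?thesis by simp
qed

lemma nn_integral_PiM_lborel_block_map:
  fixes g :: "('i \<Rightarrow> real) \<Rightarrow> ennreal" and b :: real and B :: "'k \<Rightarrow> 'i set"
  assumes fin: "finite I" and finK: "finite K" and disj: "disjoint_family_on B K"
    and B: "\<And>k. k \<in> K \<Longrightarrow> B k \<subseteq> I \<and> B k \<noteq> {} \<and> card (B k) = m" and nz: "1 + b * m \<noteq> 0"
    and g: "g \<in> borel_measurable (Pi\<^sub>M I (\<lambda>_. lborel))"
  shows "(\<integral>\<^sup>+x. g x \<partial>Pi\<^sub>M I (\<lambda>_. lborel)) = ennreal (\<bar>1 + b * m\<bar> ^ card K) *
    (\<integral>\<^sup>+x. g (\<lambda>j. x j + b * (\<Sum>k\<in>{k\<in>K. j \<in> B k}. \<Sum>i\<in>B k. x i)) \<partial>Pi\<^sub>M I (\<lambda>_. lborel))"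
  using finK disj B g
proof (induction K arbitrary: g)
  case (insert k K)
  note g [measurable] = insert.prems(3)
  let ?F = "\<lambda>x j. if j \<in> B k then x j + b * (\<Sum>i\<in>B k. x i) else x j"
  have Bk: "B k \<subseteq> I" "B k \<noteq> {}" "card (B k) = m" using insert.prems by auto
  have S [measurable]: "(\<lambda>x. \<Sum>i\<in>B k. x i) \<in> borel_measurable (Pi\<^sub>M I (\<lambda>_. lborel :: real measure))"
    using Bk by (intro borel_measurable_sum) auto
  have F [measurable]: "?F \<in> measurable (Pi\<^sub>M I (\<lambda>_. lborel)) (Pi\<^sub>M I (\<lambda>_. lborel))"
  proof (rule measurable_PiM_lborel_update[OF Bk(1)])
    fix j assume "j \<in> B k"
    hence "j \<in> I" using Bk by auto
    thus "(\<lambda>x. x j + b * (\<Sum>i\<in>B k. x i)) \<in> borel_measurable (Pi\<^sub>M I (\<lambda>_. lborel))" by simp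
  qed
  have disj: "disjoint_family_on B K" "j \<in> B k \<Longrightarrow> l \<in> K \<Longrightarrow> j \<notin> B l" for j l
    using insert.prems(1) insert.hyps by (auto simp: disjoint_family_on_def)
  have factor: "?F (\<lambda>j. x j + b * (\<Sum>k\<in>{k\<in>K. j \<in> B k}. \<Sum>i\<in>B k. x i)) =
      (\<lambda>j. x j + b * (\<Sum>l\<in>{l\<in>insert k K. j \<in> B l}. \<Sum>i\<in>B l. x i))" for x
  proof
    fix j
    have K0: "{l \<in> K. j \<in> B l} = {}" if "j \<in> B k" for j using disj that by auto
    have K1: "{l \<in> insert k K. j \<in> B l} = (if j \<in> B k then {k} else {l \<in> K. j \<in> B l})"
      using disj by auto
    have inner: "(\<Sum>i\<in>B k. x i + b * (\<Sum>k\<in>{k\<in>K. i \<in> B k}. \<Sum>i\<in>B k. x i)) = (\<Sum>i\<in>B k. x i)"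
    proof (intro sum.cong refl)
      fix i assume "i \<in> B k"
      thus "x i + b * (\<Sum>k\<in>{k\<in>K. i \<in> B k}. \<Sum>i\<in>B k. x i) = x i"
        by (subst K0) simp_all
    qed
    show "?F (\<lambda>j. x j + b * (\<Sum>k\<in>{k\<in>K. j \<in> B k}. \<Sum>i\<in>B k. x i)) j =
        x j + b * (\<Sum>l\<in>{l\<in>insert k K. j \<in> B l}. \<Sum>i\<in>B l. x i)"
    proof (cases "j \<in> B k")
      case True
      show ?thesis unfolding K1 inner using True by (subst K0) simp_all
    next
      case False
      thus ?thesis unfolding K1 by simp
    qed
  qed
  have "(\<integral>\<^sup>+x. g x \<partial>Pi\<^sub>M I (\<lambda>_. lborel)) =
      ennreal \<bar>1 + b * m\<bar> * (\<integral>\<^sup>+x. g (?F x) \<partial>Pi\<^sub>M I (\<lambda>_. lborel))"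
    using nn_integral_PiM_lborel_rank_one[OF fin Bk(1,2) _ g, of b] Bk(3) nz by simp
  also have "(\<integral>\<^sup>+x. g (?F x) \<partial>Pi\<^sub>M I (\<lambda>_. lborel)) = ennreal (\<bar>1 + b * m\<bar> ^ card K) *
    (\<integral>\<^sup>+x. g (?F (\<lambda>j. x j + b * (\<Sum>k\<in>{k\<in>K. j \<in> B k}. \<Sum>i\<in>B k. x i))) \<partial>Pi\<^sub>M I (\<lambda>_. lborel))"
  proof (rule insert.IH)
    show "(\<lambda>x. g (?F x)) \<in> borel_measurable (Pi\<^sub>M I (\<lambda>_. lborel))"
      by (rule measurable_compose[OF F g])
    show "B l \<subseteq> I \<and> B l \<noteq> {} \<and> card (B l) = m" if "l \<in> K" for l
      using that by (intro insert.prems) simp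
  qed (fact disj(1))
  also have "(\<integral>\<^sup>+x. g (?F (\<lambda>j. x j + b * (\<Sum>k\<in>{k\<in>K. j \<in> B k}. \<Sum>i\<in>B k. x i))) \<partial>Pi\<^sub>M I (\<lambda>_. lborel)) =
      (\<integral>\<^sup>+x. g (\<lambda>j. x j + b * (\<Sum>l\<in>{l\<in>insert k K. j \<in> B l}. \<Sum>i\<in>B l. x i)) \<partial>Pi\<^sub>M I (\<lambda>_. lborel))"
    by (simp only: factor)
  finally show ?case using insert.hyps
    by (simp add: ennreal_mult mult.assoc)
qed auto

lemma nn_integral_PiM_lborel_scale:
  fixes g :: "('i \<Rightarrow> real) \<Rightarrow> ennreal" and c :: real
  assumes fin: "finite I" and c: "c \<noteq> 0"
    and g: "g \<in> borel_measurable (Pi\<^sub>M I (\<lambda>_. lborel))"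
  shows "(\<integral>\<^sup>+x. g x \<partial>Pi\<^sub>M I (\<lambda>_. lborel)) =
    ennreal (\<bar>c\<bar> ^ card I) * (\<integral>\<^sup>+x. g (\<lambda>j\<in>I. c * x j) \<partial>Pi\<^sub>M I (\<lambda>_. lborel))"
proof -
  have "(\<integral>\<^sup>+x. g x \<partial>Pi\<^sub>M I (\<lambda>_. lborel)) = ennreal (\<bar>c\<bar> ^ card J) *
      (\<integral>\<^sup>+x. g (\<lambda>j. if j \<in> J then c * x j else x j) \<partial>Pi\<^sub>M I (\<lambda>_. lborel))" if "J \<subseteq> I" for J
    using finite_subset[OF that fin] that g
  proof (induction J arbitrary: g)
    case (insert i J)
    note g [measurable] = insert.prems(2)
    have c_meas: "(\<lambda>x j. if j \<in> J then c * x j else x j) \<in>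
        measurable (Pi\<^sub>M I (\<lambda>_. lborel)) (Pi\<^sub>M I (\<lambda>_. lborel))"
    proof (rule measurable_PiM_lborel_update)
      fix j assume "j \<in> J"
      hence "j \<in> I" using insert.prems by auto
      thus "(\<lambda>x. c * x j) \<in> borel_measurable (Pi\<^sub>M I (\<lambda>_. lborel))" by simp
    qed (use insert.prems in auto)
    have gc: "(\<lambda>x. g (\<lambda>j. if j \<in> J then c * x j else x j)) \<in> borel_measurable (Pi\<^sub>M I (\<lambda>_. lborel))"
      by (rule measurable_compose[OF c_meas g])
    have "(\<integral>\<^sup>+x. g x \<partial>Pi\<^sub>M I (\<lambda>_. lborel)) = ennreal (\<bar>c\<bar> ^ card J) *
        (\<integral>\<^sup>+x. g (\<lambda>j. if j \<in> J then c * x j else x j) \<partial>Pi\<^sub>M I (\<lambda>_. lborel))"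
      using insert by auto
    also have "(\<integral>\<^sup>+x. g (\<lambda>j. if j \<in> J then c * x j else x j) \<partial>Pi\<^sub>M I (\<lambda>_. lborel)) = ennreal \<bar>c\<bar> *
        (\<integral>\<^sup>+x. g (\<lambda>j. if j \<in> J then c * (x(i := 0 + c * x i)) j else (x(i := 0 + c * x i)) j)
          \<partial>Pi\<^sub>M I (\<lambda>_. lborel))"
      using insert.prems by (intro nn_integral_PiM_lborel_coordinate_affine[OF fin _ c gc]) auto
    also have "(\<integral>\<^sup>+x. g (\<lambda>j. if j \<in> J then c * (x(i := 0 + c * x i)) j else (x(i := 0 + c * x i)) j)
          \<partial>Pi\<^sub>M I (\<lambda>_. lborel)) =
        (\<integral>\<^sup>+x. g (\<lambda>j. if j \<in> insert i J then c * x j else x j) \<partial>Pi\<^sub>M I (\<lambda>_. lborel))"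
      using insert.hyps by (intro nn_integral_cong arg_cong[where f = g]) (auto simp: fun_eq_iff)
    finally show ?case using insert.hyps by (simp add: ennreal_mult mult_ac)
  qed auto
  from this[of I] have "(\<integral>\<^sup>+x. g x \<partial>Pi\<^sub>M I (\<lambda>_. lborel)) = ennreal (\<bar>c\<bar> ^ card I) *
      (\<integral>\<^sup>+x. g (\<lambda>j. if j \<in> I then c * x j else x j) \<partial>Pi\<^sub>M I (\<lambda>_. lborel))" by simp
  also have "(\<integral>\<^sup>+x. g (\<lambda>j. if j \<in> I then c * x j else x j) \<partial>Pi\<^sub>M I (\<lambda>_. lborel)) =
      (\<integral>\<^sup>+x. g (\<lambda>j\<in>I. c * x j) \<partial>Pi\<^sub>M I (\<lambda>_. lborel))"
    by (intro nn_integral_cong arg_cong[where f = g])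
      (auto simp: fun_eq_iff space_PiM PiE_def extensional_def restrict_def)
  finally show ?thesis .
qed

section \<open>The covariance matrix of the grouped model\<close>

text \<open>
  Sylvester's determinant identity. Both sides are the determinant of one block matrix, from which
  either of the off-diagonal blocks is eliminated.
\<close>

lemma det_smult_one_add_mult:
  fixes U :: "real Matrix.mat"
  assumes U: "U \<in> carrier_mat p R" and V: "V \<in> carrier_mat R p" and a: "a \<noteq> 0"
  shows "Determinant.det (a \<cdot>\<^sub>m 1\<^sub>m p + U * V) =
    a ^ p * Determinant.det (1\<^sub>m R + (1 / a) \<cdot>\<^sub>m (V * U))"
proof -
  let ?A = "four_block_mat (1\<^sub>m R) (- V) U (a \<cdot>\<^sub>m 1\<^sub>m p)"
  have A: "?A \<in> carrier_mat (R + p) (R + p)" using U V by auto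
  let ?E = "four_block_mat (1\<^sub>m R) V (0\<^sub>m p R) (1\<^sub>m p)"
  let ?F = "four_block_mat (1\<^sub>m R) (0\<^sub>m R p) (- (1 / a) \<cdot>\<^sub>m U) (1\<^sub>m p)"
  have detE: "Determinant.det ?E = 1"
    using V by (subst det_four_block_mat_lower_left_zero) auto
  have detF: "Determinant.det ?F = 1"
    using U by (subst det_four_block_mat_upper_right_zero) auto
  have "?A * ?E = four_block_mat (1\<^sub>m R * 1\<^sub>m R + (- V) * 0\<^sub>m p R) (1\<^sub>m R * V + (- V) * 1\<^sub>m p)
      (U * 1\<^sub>m R + (a \<cdot>\<^sub>m 1\<^sub>m p) * 0\<^sub>m p R) (U * V + (a \<cdot>\<^sub>m 1\<^sub>m p) * 1\<^sub>m p)"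
    using U V by (intro mult_four_block_mat) auto
  also have "\<dots> = four_block_mat (1\<^sub>m R) (0\<^sub>m R p) U (a \<cdot>\<^sub>m 1\<^sub>m p + U * V)"
    using U V by (intro cong_four_block_mat) (auto simp: comm_add_mat)
  finally have "Determinant.det (?A * ?E) = Determinant.det (a \<cdot>\<^sub>m 1\<^sub>m p + U * V)"
    using U V by (simp add: det_four_block_mat_upper_right_zero[of _ R _ p])
  moreover have "Determinant.det (?A * ?E) = Determinant.det ?A"
    using U V A detE by (subst det_mult[of _ "R + p"]) auto
  moreover have "?A * ?F = four_block_mat (1\<^sub>m R * 1\<^sub>m R + (- V) * (- (1 / a) \<cdot>\<^sub>m U)) (1\<^sub>m R * 0\<^sub>m R p + (- V) * 1\<^sub>m p)
      (U * 1\<^sub>m R + (a \<cdot>\<^sub>m 1\<^sub>m p) * (- (1 / a) \<cdot>\<^sub>m U)) (U * 0\<^sub>m R p + (a \<cdot>\<^sub>m 1\<^sub>m p) * 1\<^sub>m p)"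
    using U V by (intro mult_four_block_mat) auto
  moreover have "\<dots> = four_block_mat (1\<^sub>m R + (1 / a) \<cdot>\<^sub>m (V * U)) (- V) (0\<^sub>m p R) (a \<cdot>\<^sub>m 1\<^sub>m p)"
  proof (intro cong_four_block_mat)
    show "1\<^sub>m R * 1\<^sub>m R + - V * (- (1 / a) \<cdot>\<^sub>m U) = 1\<^sub>m R + (1 / a) \<cdot>\<^sub>m (V * U)"
      using U V by (auto simp: scalar_prod_def sum_distrib_left sum_negf)
    show "U * 1\<^sub>m R + (a \<cdot>\<^sub>m 1\<^sub>m p) * (- (1 / a) \<cdot>\<^sub>m U) = 0\<^sub>m p R"
      using U V a by auto
    show "1\<^sub>m R * 0\<^sub>m R p + - V * 1\<^sub>m p = - V" using V by auto
    show "U * 0\<^sub>m R p + a \<cdot>\<^sub>m 1\<^sub>m p * 1\<^sub>m p = a \<cdot>\<^sub>m 1\<^sub>m p" using U by auto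
  qed
  moreover have "Determinant.det (four_block_mat (1\<^sub>m R + (1 / a) \<cdot>\<^sub>m (V * U)) (- V) (0\<^sub>m p R) (a \<cdot>\<^sub>m 1\<^sub>m p)) =
      Determinant.det (1\<^sub>m R + (1 / a) \<cdot>\<^sub>m (V * U)) * a ^ p"
    using U V by (subst det_four_block_mat_lower_left_zero[of _ R _ p]) auto
  moreover have "Determinant.det (?A * ?F) = Determinant.det ?A"
    using U V A detF by (subst det_mult[of _ "R + p"]) auto
  ultimately show ?thesis by (simp add: mult.commute)
qed

lemma the_mat_inverse_eqI:
  fixes A :: "real Matrix.mat"
  assumes A: "A \<in> carrier_mat n n" and Q: "Q \<in> carrier_mat n n" and QA: "Q * A = 1\<^sub>m n"
  shows "the (mat_inverse A) = Q"
proof (cases "mat_inverse A")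
  case None
  have "A * Q = 1\<^sub>m n" using mat_mult_left_right_inverse[OF Q A QA] .
  hence "A \<in> Units (ring_mat TYPE(real) n ())"
    using A Q QA by (auto simp: Units_def ring_mat_def)
  thus ?thesis using mat_inverse(1)[OF A None, where b = "()"] by blast
next
  case (Some Q')
  hence Q': "A * Q' = 1\<^sub>m n" "Q' \<in> carrier_mat n n" using mat_inverse(2)[OF A Some] by auto
  have "Q = Q * (A * Q')" using Q Q' by simp
  also have "\<dots> = (Q * A) * Q'" using assoc_mult_mat[OF Q A Q'(2)] by simp
  also have "\<dots> = Q'" using QA Q' by simp
  finally show ?thesis using Some by simp
qed

lemma sum_of_bool_eq_mult:
  fixes f :: "nat \<Rightarrow> real"
  assumes "i < n" shows "(\<Sum>l<n. of_bool (i = l) * f l) = f i"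
proof -
  have "(\<Sum>l<n. of_bool (i = l) * f l) = (\<Sum>l<n. if l = i then f l else 0)"
    by (intro sum.cong) auto
  thus ?thesis using assms by simp
qed

text \<open>
  The model with fixed parameters: \<open>p\<close> coordinates in \<open>R\<close> groups \<open>B 0, \<dots>, B (R - 1)\<close> of equal size
  and correlation \<open>\<gamma>\<close> within the groups.
\<close>

locale group_model =
  fixes p R :: nat and \<gamma> :: real and B :: "nat \<Rightarrow> nat set"
  assumes R: "1 \<le> R" "R dvd p" and p: "1 \<le> p"
    and groups: "equal_groups p R B" and \<gamma>: "0 \<le> \<gamma>" "\<gamma> < 1"
begin

text \<open>The size of a group.\<close>

definition m :: nat where "m = p div R"

text \<open>
  The covariance matrix has the eigenvalue \<open>lam1\<close> on the vectors that are constant on every group,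
  and the eigenvalue \<open>lam0\<close> on their orthogonal complement.
\<close>

definition lam0 :: real where "lam0 = 1 - \<gamma>"

definition lam1 :: real where "lam1 = 1 - \<gamma> + \<gamma> * m"

text \<open>The number of the group that contains the coordinate \<open>i < p\<close>.\<close>

definition grp :: "nat \<Rightarrow> nat" where "grp i = (SOME k. k < R \<and> i \<in> B k)"

lemma p_eq: "p = R * m" using R by (simp add: m_def)

lemma m_pos: "1 \<le> m" using p p_eq by (cases m) auto

lemma lam0_pos: "0 < lam0" using \<gamma> by (simp add: lam0_def)

lemma lam_le: "lam0 \<le> lam1" using \<gamma> by (simp add: lam0_def lam1_def)

lemma lam1_pos: "0 < lam1" using lam0_pos lam_le by simp

lemma lam1_eq: "lam1 = lam0 + \<gamma> * m" by (simp add: lam0_def lam1_def)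

lemma card_B: "k < R \<Longrightarrow> card (B k) = m"
  using groups by (auto simp: equal_groups_def m_def)

lemma B_subset: "k < R \<Longrightarrow> B k \<subseteq> {..<p}"
  using groups by (auto simp: equal_groups_def)

lemma finite_B: "k < R \<Longrightarrow> finite (B k)"
  using B_subset finite_subset by blast

lemma disjoint_B: "disjoint_family_on B {..<R}"
  using groups by (auto simp: equal_groups_def)

lemma grp: assumes "i < p" shows "grp i < R" "i \<in> B (grp i)"
proof -
  have "\<exists>k. k < R \<and> i \<in> B k" using assms groups by (auto simp: equal_groups_def)
  from someI_ex[OF this] show "grp i < R" "i \<in> B (grp i)" by (auto simp: grp_def)
qed

lemma grp_eq: assumes "k < R" "i \<in> B k" shows "grp i = k"
proof (rule ccontr)
  assume "grp i \<noteq> k"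
  moreover have "i < p" using B_subset assms by auto
  ultimately show False using assms grp[of i] disjoint_B
    by (auto simp: disjoint_family_on_def)
qed

lemma B_eq: "k < R \<Longrightarrow> B k = {i. i < p \<and> grp i = k}"
  using grp grp_eq B_subset by blast

lemma sum_groups: "(\<Sum>i<p. f i) = (\<Sum>k<R. \<Sum>i\<in>B k. f i)"
proof -
  have "{..<p} = (\<Union>k<R. B k)" using groups by (auto simp: equal_groups_def)
  thus ?thesis using disjoint_B finite_B
    by (simp add: sum.UNION_disjoint disjoint_family_on_def)
qed

lemma sum_group_indicator:
  assumes "i < p" shows "(\<Sum>j<p. of_bool (grp i = grp j) * f j) = (\<Sum>j\<in>B (grp i). f j :: real)"
proof -
  have "B (grp i) = {j\<in>{..<p}. grp i = grp j}"
    unfolding B_eq[OF grp(1)[OF assms]] by auto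
  hence "(\<Sum>j\<in>B (grp i). f j) = (\<Sum>j\<in>{j\<in>{..<p}. grp i = grp j}. f j)" by simp
  also have "\<dots> = (\<Sum>j<p. of_bool (grp i = grp j) * f j)"
    unfolding sum.inter_filter[OF finite_lessThan] by (intro sum.cong) auto
  finally show ?thesis ..
qed

lemma group_cov_index:
  assumes "i < p" "j < p"
  shows "group_cov p \<gamma> R B $$ (i, j) = lam0 * of_bool (i = j) + \<gamma> * of_bool (grp i = grp j)"
proof -
  have "(\<Sum>k<R. indicator (B k) i * indicator (B k) j) = (\<Sum>k<R. of_bool (k = grp i) * of_bool (grp i = grp j) :: real)"
    using assms by (intro sum.cong) (auto simp: B_eq grp indicator_def)
  also have "\<dots> = of_bool (grp i = grp j)"
    using grp[OF assms(1)] by (simp flip: sum_distrib_right)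
  finally show ?thesis using assms by (simp add: group_cov_def lam0_def)
qed

text \<open>
  The covariance matrix is \<open>lam0 I + \<gamma> U U\<^sup>T\<close>, where \<open>U\<close> is the \<open>p \<times> R\<close> incidence matrix of the groups
  and \<open>U\<^sup>T U = m I\<close>.
\<close>

lemma det_group_cov: "Determinant.det (group_cov p \<gamma> R B) = lam0 ^ p * (lam1 / lam0) ^ R"
proof -
  define U where "U = Matrix.mat p R (\<lambda>(i, k). of_bool (grp i = k) :: real)"
  define V where "V = Matrix.mat R p (\<lambda>(k, i). \<gamma> * of_bool (grp i = k))"
  have U: "U \<in> carrier_mat p R" and V: "V \<in> carrier_mat R p" by (auto simp: U_def V_def)
  have "group_cov p \<gamma> R B = lam0 \<cdot>\<^sub>m 1\<^sub>m p + U * V"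
  proof (rule eq_matI)
    fix i j assume "i < dim_row (lam0 \<cdot>\<^sub>m 1\<^sub>m p + U * V)" "j < dim_col (lam0 \<cdot>\<^sub>m 1\<^sub>m p + U * V)"
    hence ij: "i < p" "j < p" using U V by auto
    have "(U * V) $$ (i, j) = (\<Sum>k<R. of_bool (k = grp i) * (\<gamma> * of_bool (grp i = grp j)))"
      using ij by (auto simp: U_def V_def scalar_prod_def atLeast0LessThan intro!: sum.cong)
    also have "\<dots> = \<gamma> * of_bool (grp i = grp j)"
      using grp[OF ij(1)] by (simp flip: sum_distrib_right)
    finally show "group_cov p \<gamma> R B $$ (i, j) = (lam0 \<cdot>\<^sub>m 1\<^sub>m p + U * V) $$ (i, j)"
      using ij U V by (simp add: group_cov_index)
  qed (use U V in \<open>auto simp: group_cov_def\<close>)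
  moreover have "1\<^sub>m R + (1 / lam0) \<cdot>\<^sub>m (V * U) = (lam1 / lam0) \<cdot>\<^sub>m 1\<^sub>m R"
  proof (rule eq_matI)
    fix k l assume "k < dim_row ((lam1 / lam0) \<cdot>\<^sub>m 1\<^sub>m R)" "l < dim_col ((lam1 / lam0) \<cdot>\<^sub>m 1\<^sub>m R)"
    hence kl: "k < R" "l < R" by auto
    have "(V * U) $$ (k, l) = (\<Sum>i<p. V $$ (k, i) * U $$ (i, l))"
      using kl U V by (auto simp: scalar_prod_def atLeast0LessThan)
    also have "\<dots> = (\<Sum>i<p. if grp i = k then \<gamma> * of_bool (k = l) else 0)"
      using kl by (intro sum.cong) (auto simp: U_def V_def)
    also have "\<dots> = (\<Sum>i\<in>{i\<in>{..<p}. grp i = k}. \<gamma> * of_bool (k = l))"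
      by (rule sum.inter_filter[symmetric]) auto
    also have "{i\<in>{..<p}. grp i = k} = B k" using kl by (auto simp: B_eq)
    also have "(\<Sum>i\<in>B k. \<gamma> * of_bool (k = l)) = real m * \<gamma> * of_bool (k = l)" using kl by (simp add: card_B)
    finally show "(1\<^sub>m R + (1 / lam0) \<cdot>\<^sub>m (V * U)) $$ (k, l) = ((lam1 / lam0) \<cdot>\<^sub>m 1\<^sub>m R) $$ (k, l)"
      using kl U V lam0_pos by (auto simp: lam1_eq field_simps)
  qed (use U V in auto)
  ultimately show ?thesis
    using det_smult_one_add_mult[OF U V, of lam0] lam0_pos by simp
qed

lemma mat_inverse_group_cov:
  "the (mat_inverse (group_cov p \<gamma> R B)) =
    Matrix.mat p p (\<lambda>(i, j). (of_bool (i = j) - \<gamma> / lam1 * of_bool (grp i = grp j)) / lam0)"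
proof (rule the_mat_inverse_eqI)
  let ?Q = "Matrix.mat p p (\<lambda>(i, j). (of_bool (i = j) - \<gamma> / lam1 * of_bool (grp i = grp j)) / lam0)"
  show "?Q * group_cov p \<gamma> R B = 1\<^sub>m p"
  proof (rule eq_matI)
    fix i j assume "i < dim_row (1\<^sub>m p)" "j < dim_col (1\<^sub>m p)"
    hence ij: "i < p" "j < p" by auto
    let ?e = "of_bool (i = j) :: real" and ?g = "of_bool (grp i = grp j) :: real"
    have alg: "(e - \<gamma> / lam1 * g) / lam0 * (lam0 * f + \<gamma> * h) =
        e * (f + \<gamma> / lam0 * h) - \<gamma> / lam1 * (g * f) - \<gamma> / lam1 * (\<gamma> / lam0) * (g * h)" for e f g h
      using lam0_pos lam1_pos by (simp add: divide_simps) (simp add: algebra_simps)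
    have "(?Q * group_cov p \<gamma> R B) $$ (i, j) = (\<Sum>l<p. ?Q $$ (i, l) * group_cov p \<gamma> R B $$ (l, j))"
      using ij by (auto simp: scalar_prod_def atLeast0LessThan group_cov_def)
    also have "\<dots> = (\<Sum>l<p. of_bool (i = l) * (of_bool (l = j) + \<gamma> / lam0 * of_bool (grp l = grp j))
        - \<gamma> / lam1 * (of_bool (grp i = grp l) * of_bool (l = j))
        - \<gamma> / lam1 * (\<gamma> / lam0) * (of_bool (grp i = grp l) * ?g))"
    proof (intro sum.cong refl)
      fix l assume l: "l \<in> {..<p}"
      have "of_bool (grp i = grp l) * of_bool (grp l = grp j) = of_bool (grp i = grp l) * ?g" by auto
      moreover have "?Q $$ (i, l) = (of_bool (i = l) - \<gamma> / lam1 * of_bool (grp i = grp l)) / lam0"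
        using ij l by simp
      moreover have "group_cov p \<gamma> R B $$ (l, j) = lam0 * of_bool (l = j) + \<gamma> * of_bool (grp l = grp j)"
        using ij l by (simp add: group_cov_index)
      ultimately show "?Q $$ (i, l) * group_cov p \<gamma> R B $$ (l, j) =
        of_bool (i = l) * (of_bool (l = j) + \<gamma> / lam0 * of_bool (grp l = grp j))
        - \<gamma> / lam1 * (of_bool (grp i = grp l) * of_bool (l = j))
        - \<gamma> / lam1 * (\<gamma> / lam0) * (of_bool (grp i = grp l) * ?g)"
        by (simp only: alg)
    qed
    also have "\<dots> = (\<Sum>l<p. of_bool (i = l) * (of_bool (l = j) + \<gamma> / lam0 * of_bool (grp l = grp j)))
        - \<gamma> / lam1 * (\<Sum>l<p. of_bool (grp i = grp l) * of_bool (l = j))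
        - \<gamma> / lam1 * (\<gamma> / lam0) * (\<Sum>l<p. of_bool (grp i = grp l) * ?g)"
      by (simp only: sum_subtractf sum_distrib_left)
    also have "(\<Sum>l<p. of_bool (i = l) * (of_bool (l = j) + \<gamma> / lam0 * of_bool (grp l = grp j))) =
        ?e + \<gamma> / lam0 * ?g"
      by (rule sum_of_bool_eq_mult[OF ij(1)])
    also have "(\<Sum>l<p. of_bool (grp i = grp l) * of_bool (l = j) :: real) = ?g"
    proof -
      have "(\<Sum>l<p. of_bool (grp i = grp l) * of_bool (l = j) :: real) =
          (\<Sum>l<p. of_bool (j = l) * of_bool (grp i = grp l))"
        by (intro sum.cong) auto
      thus ?thesis by (simp only: sum_of_bool_eq_mult[OF ij(2)])
    qed
    also have "(\<Sum>l<p. of_bool (grp i = grp l) * ?g) = m * ?g"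
      using ij by (simp only: sum_group_indicator) (simp add: card_B grp)
    also have "?e + \<gamma> / lam0 * ?g - \<gamma> / lam1 * ?g - \<gamma> / lam1 * (\<gamma> / lam0) * (m * ?g) =
        ?e + \<gamma> * ?g * (1 / lam0 - 1 / lam1 - \<gamma> * m / (lam1 * lam0))"
      by (simp add: algebra_simps)
    also have "1 / lam0 - 1 / lam1 - \<gamma> * m / (lam1 * lam0) = 0"
      using lam0_pos lam1_pos by (simp add: lam1_eq field_simps)
    finally show "(?Q * group_cov p \<gamma> R B) $$ (i, j) = 1\<^sub>m p $$ (i, j)" using ij by simp
  qed (auto simp: group_cov_def)
qed (auto simp: group_cov_def)

text \<open>The bilinear form of the inverse covariance matrix.\<close>

lemma quadratic_form_group_cov:
  "scalar_prod (Matrix.vec p d) (mult_mat_vec (the (mat_inverse (group_cov p \<gamma> R B))) (Matrix.vec p e)) =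
    ((\<Sum>i<p. d i * e i) - \<gamma> / lam1 * (\<Sum>k<R. (\<Sum>i\<in>B k. d i) * (\<Sum>i\<in>B k. e i))) / lam0"
proof -
  let ?S = "\<lambda>k. \<Sum>i\<in>B k. e i"
  have "vec_index (mult_mat_vec (the (mat_inverse (group_cov p \<gamma> R B))) (Matrix.vec p e)) i =
      (e i - \<gamma> / lam1 * ?S (grp i)) / lam0" if "i < p" for i
  proof -
    have "vec_index (mult_mat_vec (the (mat_inverse (group_cov p \<gamma> R B))) (Matrix.vec p e)) i =
        (\<Sum>j<p. (of_bool (i = j) * e j - \<gamma> / lam1 * (of_bool (grp i = grp j) * e j)) / lam0)"
      using that by (auto simp: mat_inverse_group_cov scalar_prod_def atLeast0LessThan algebra_simps intro!: sum.cong)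
    also have "\<dots> = ((\<Sum>j<p. of_bool (i = j) * e j) - \<gamma> / lam1 * (\<Sum>j<p. of_bool (grp i = grp j) * e j)) / lam0"
      by (simp only: sum_subtractf sum_distrib_left[symmetric] sum_divide_distrib[symmetric])
    also have "(\<Sum>j<p. of_bool (i = j) * e j) = e i"
      by (rule sum_of_bool_eq_mult[OF that])
    finally show ?thesis unfolding sum_group_indicator[OF that] .
  qed
  hence "scalar_prod (Matrix.vec p d) (mult_mat_vec (the (mat_inverse (group_cov p \<gamma> R B))) (Matrix.vec p e)) =
      (\<Sum>i<p. (d i * e i - \<gamma> / lam1 * (d i * ?S (grp i))) / lam0)"
    by (auto simp: scalar_prod_def atLeast0LessThan mat_inverse_group_cov algebra_simps intro!: sum.cong)
  also have "\<dots> = ((\<Sum>i<p. d i * e i) - \<gamma> / lam1 * (\<Sum>i<p. d i * ?S (grp i))) / lam0"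
    by (simp only: sum_subtractf sum_distrib_left[symmetric] sum_divide_distrib[symmetric])
  also have "(\<Sum>i<p. d i * ?S (grp i)) = (\<Sum>k<R. (\<Sum>i\<in>B k. d i) * ?S k)"
    unfolding sum_groups sum_distrib_right by (intro sum.cong) (auto simp: grp_eq)
  finally show ?thesis .
qed

end

section \<open>Whitening the observation\<close>

lemma density_PiM_lborel_prod:
  fixes f :: "'i \<Rightarrow> real \<Rightarrow> ennreal"
  assumes fin: "finite I"
    and f: "\<And>i. i \<in> I \<Longrightarrow> f i \<in> borel_measurable borel"
    and prob: "\<And>i. i \<in> I \<Longrightarrow> prob_space (density lborel (f i))"
  shows "density (Pi\<^sub>M I (\<lambda>_. lborel)) (\<lambda>x. \<Prod>i\<in>I. f i (x i)) = Pi\<^sub>M I (\<lambda>i. density lborel (f i))"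
proof -
  define N where "N i = (if i \<in> I then density lborel (f i) else lborel)" for i
  have "sigma_finite_measure (N i)" for i
    by (cases "i \<in> I") (auto simp: N_def sigma_finite_lborel prob prob_space_imp_sigma_finite)
  then interpret N: product_sigma_finite N by (simp add: product_sigma_finite_def)
  interpret L: product_sigma_finite "\<lambda>_::'i. lborel :: real measure" ..
  have meas [measurable]: "(\<lambda>x. \<Prod>i\<in>I. f i (x i)) \<in> borel_measurable (Pi\<^sub>M I (\<lambda>_. lborel))"
  proof (rule borel_measurable_prod_ennreal)
    fix i assume "i \<in> I"
    from f[OF this] measurable_component_singleton[OF this, of "\<lambda>_. lborel :: real measure"]
    show "(\<lambda>x. f i (x i)) \<in> borel_measurable (Pi\<^sub>M I (\<lambda>_. lborel))"
      by (auto intro: measurable_compose)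
  qed
  have "density (Pi\<^sub>M I (\<lambda>_. lborel)) (\<lambda>x. \<Prod>i\<in>I. f i (x i)) = Pi\<^sub>M I N"
  proof (rule N.PiM_eqI[OF fin])
    show "sets (density (Pi\<^sub>M I (\<lambda>_. lborel)) (\<lambda>x. \<Prod>i\<in>I. f i (x i))) = sets (Pi\<^sub>M I N)"
      by (simp, intro sets_PiM_cong) (auto simp: N_def)
    fix A assume A0: "\<And>i. i \<in> I \<Longrightarrow> A i \<in> sets (N i)"
    have A [measurable]: "A i \<in> sets borel" if "i \<in> I" for i
      using A0[OF that] that by (simp add: N_def)
    have "Pi\<^sub>E I A \<in> sets (Pi\<^sub>M I (\<lambda>_. lborel))"
      using fin A by (intro sets_PiM_I_finite) auto
    hence "emeasure (density (Pi\<^sub>M I (\<lambda>_. lborel)) (\<lambda>x. \<Prod>i\<in>I. f i (x i))) (Pi\<^sub>E I A) =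
        (\<integral>\<^sup>+x. (\<Prod>i\<in>I. f i (x i)) * indicator (Pi\<^sub>E I A) x \<partial>Pi\<^sub>M I (\<lambda>_. lborel))"
      by (simp add: emeasure_density)
    also have "\<dots> = (\<integral>\<^sup>+x. (\<Prod>i\<in>I. f i (x i) * indicator (A i) (x i)) \<partial>Pi\<^sub>M I (\<lambda>_. lborel))"
    proof (intro nn_integral_cong)
      fix x assume x: "x \<in> space (Pi\<^sub>M I (\<lambda>_. lborel :: real measure))"
      have "indicator (Pi\<^sub>E I A) x = (\<Prod>i\<in>I. indicator (A i) (x i) :: ennreal)"
      proof (cases "x \<in> Pi\<^sub>E I A")
        case False
        hence "\<exists>i\<in>I. x i \<notin> A i" using x by (auto simp: space_PiM PiE_def extensional_def)
        hence "(\<Prod>i\<in>I. indicator (A i) (x i) :: ennreal) = 0"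
          using fin by (intro prod_zero) (auto simp: indicator_def)
        thus ?thesis using False by simp
      next
        case True
        hence "(\<Prod>i\<in>I. indicator (A i) (x i) :: ennreal) = 1"
          by (intro prod.neutral) (auto simp: indicator_def PiE_iff)
        thus ?thesis using True by simp
      qed
      thus "(\<Prod>i\<in>I. f i (x i)) * indicator (Pi\<^sub>E I A) x = (\<Prod>i\<in>I. f i (x i) * indicator (A i) (x i))"
        by (simp add: prod.distrib)
    qed
    also have "\<dots> = (\<Prod>i\<in>I. \<integral>\<^sup>+x. f i x * indicator (A i) x \<partial>lborel)"
      using fin f A by (intro L.product_nn_integral_prod) auto
    also have "\<dots> = (\<Prod>i\<in>I. emeasure (N i) (A i))"
      using f A by (intro prod.cong refl) (auto simp: N_def emeasure_density)
    finally show "emeasure (density (Pi\<^sub>M I (\<lambda>_. lborel)) (\<lambda>x. \<Prod>i\<in>I. f i (x i))) (Pi\<^sub>E I A) =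
        (\<Prod>i\<in>I. emeasure (N i) (A i))" .
  qed
  also have "Pi\<^sub>M I N = Pi\<^sub>M I (\<lambda>i. density lborel (f i))"
    by (intro PiM_cong) (auto simp: N_def)
  finally show ?thesis .
qed

context group_model
begin

text \<open>
  Multiplication by the inverse square root of the covariance matrix: the group averages are divided
  by \<open>sqrt lam1\<close> and the deviations from them by \<open>sqrt lam0\<close>. Among the possible square roots the
  symmetric one is chosen because it changes a sparse vector only by a multiple of its group averages.
  As a map of the extensional function space it is undefined outside \<open>{..<p}\<close>.
\<close>

definition rho :: real where "rho = sqrt (lam0 / lam1)"

definition whiten :: "(nat \<Rightarrow> real) \<Rightarrow> nat \<Rightarrow> real" where
  "whiten x = (\<lambda>i\<in>{..<p}. (x i + (rho - 1) / m * (\<Sum>j\<in>B (grp i). x j)) / sqrt lam0)"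

lemma rho: "0 < rho" "rho \<le> 1" "rho\<^sup>2 = lam0 / lam1"
  using lam0_pos lam1_pos lam_le by (auto simp: rho_def)

lemma whiten_measurable [measurable]:
  "whiten \<in> measurable (Pi\<^sub>M {..<p} (\<lambda>_. lborel)) (Pi\<^sub>M {..<p} (\<lambda>_. lborel))"
  unfolding whiten_def
proof (rule measurable_restrict)
  fix i assume i: "i \<in> {..<p}"
  hence Bi: "B (grp i) \<subseteq> {..<p}" using B_subset[of "grp i"] grp[of i] by auto
  have S: "(\<lambda>x. \<Sum>j\<in>B (grp i). x j) \<in> borel_measurable (Pi\<^sub>M {..<p} (\<lambda>_. lborel :: real measure))"
  proof (rule borel_measurable_sum)
    fix j assume "j \<in> B (grp i)"
    with Bi have "j \<in> {..<p}" by auto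
    thus "(\<lambda>x. x j) \<in> borel_measurable (Pi\<^sub>M {..<p} (\<lambda>_. lborel :: real measure))" by simp
  qed
  show "(\<lambda>x. (x i + (rho - 1) / m * (\<Sum>j\<in>B (grp i). x j)) / sqrt lam0) \<in>
      measurable (Pi\<^sub>M {..<p} (\<lambda>_. lborel)) lborel"
    unfolding measurable_lborel1 using i
    by (intro borel_measurable_divide borel_measurable_add borel_measurable_times S borel_measurable_const) auto
qed

lemma nn_integral_whiten:
  assumes g [measurable]: "g \<in> borel_measurable (Pi\<^sub>M {..<p} (\<lambda>_. lborel))"
  shows "(\<integral>\<^sup>+x. g x \<partial>Pi\<^sub>M {..<p} (\<lambda>_. lborel)) =
    ennreal ((1 / sqrt lam0) ^ p * rho ^ R) * (\<integral>\<^sup>+x. g (whiten x) \<partial>Pi\<^sub>M {..<p} (\<lambda>_. lborel))"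
proof -
  let ?c = "1 / sqrt lam0" and ?b = "(rho - 1) / m"
  have b: "1 + ?b * m = rho" using m_pos by simp
  have [measurable]: "(\<lambda>x. \<lambda>j\<in>{..<p}. ?c * x j) \<in> measurable (Pi\<^sub>M {..<p} (\<lambda>_. lborel)) (Pi\<^sub>M {..<p} (\<lambda>_. lborel))"
    by (rule measurable_restrict) auto
  have scale: "(\<integral>\<^sup>+x. g x \<partial>Pi\<^sub>M {..<p} (\<lambda>_. lborel)) = ennreal (\<bar>?c\<bar> ^ card {..<p}) *
      (\<integral>\<^sup>+x. g (\<lambda>j\<in>{..<p}. ?c * x j) \<partial>Pi\<^sub>M {..<p} (\<lambda>_. lborel))"
    using lam0_pos by (intro nn_integral_PiM_lborel_scale) auto
  have block: "(\<integral>\<^sup>+x. g (\<lambda>j\<in>{..<p}. ?c * x j) \<partial>Pi\<^sub>M {..<p} (\<lambda>_. lborel)) =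
      ennreal (\<bar>1 + ?b * m\<bar> ^ card {..<R}) * (\<integral>\<^sup>+x. g (\<lambda>j\<in>{..<p}. ?c *
        (x j + ?b * (\<Sum>k\<in>{k\<in>{..<R}. j \<in> B k}. \<Sum>i\<in>B k. x i))) \<partial>Pi\<^sub>M {..<p} (\<lambda>_. lborel))"
  proof (rule nn_integral_PiM_lborel_block_map)
    show "B k \<subseteq> {..<p} \<and> B k \<noteq> {} \<and> card (B k) = m" if "k \<in> {..<R}" for k
    proof -
      have "card (B k) = m" "B k \<subseteq> {..<p}" using that card_B B_subset by auto
      thus ?thesis using m_pos by (metis card.empty not_one_le_zero)
    qed
    show "1 + ?b * m \<noteq> 0" unfolding b using rho(1) by simp
    show "(\<lambda>x. g (\<lambda>j\<in>{..<p}. ?c * x j)) \<in> borel_measurable (Pi\<^sub>M {..<p} (\<lambda>_. lborel))" by measurable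
  qed (use disjoint_B in simp_all)
  have whiten: "(\<integral>\<^sup>+x. g (\<lambda>j\<in>{..<p}. ?c * (x j + ?b * (\<Sum>k\<in>{k\<in>{..<R}. j \<in> B k}. \<Sum>i\<in>B k. x i)))
        \<partial>Pi\<^sub>M {..<p} (\<lambda>_. lborel)) = (\<integral>\<^sup>+x. g (whiten x) \<partial>Pi\<^sub>M {..<p} (\<lambda>_. lborel))"
  proof (rule nn_integral_cong)
    fix x
    have "(\<lambda>j\<in>{..<p}. ?c * (x j + ?b * (\<Sum>k\<in>{k\<in>{..<R}. j \<in> B k}. \<Sum>i\<in>B k. x i))) = whiten x"
    proof
      fix j
      have "{k\<in>{..<R}. j \<in> B k} = {grp j}" if "j < p"
      proof (rule Set.set_eqI)
        fix l
        have "l < R \<and> j \<in> B l \<longleftrightarrow> l = grp j" using grp[OF that] grp_eq[of l j] by blast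
        thus "l \<in> {k\<in>{..<R}. j \<in> B k} \<longleftrightarrow> l \<in> {grp j}" by simp
      qed
      thus "(\<lambda>j\<in>{..<p}. ?c * (x j + ?b * (\<Sum>k\<in>{k\<in>{..<R}. j \<in> B k}. \<Sum>i\<in>B k. x i))) j = whiten x j"
        by (simp add: whiten_def restrict_def)
    qed
    thus "g (\<lambda>j\<in>{..<p}. ?c * (x j + ?b * (\<Sum>k\<in>{k\<in>{..<R}. j \<in> B k}. \<Sum>i\<in>B k. x i))) = g (whiten x)"
      by simp
  qed
  have "\<bar>?c\<bar> ^ card {..<p} * \<bar>1 + ?b * m\<bar> ^ card {..<R} = ?c ^ p * rho ^ R"
    unfolding b using rho(1) lam0_pos by simp
  hence "ennreal (\<bar>?c\<bar> ^ card {..<p}) * (ennreal (\<bar>1 + ?b * m\<bar> ^ card {..<R}) * J) =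
      ennreal (?c ^ p * rho ^ R) * J" for J
    by (simp only: mult.assoc[symmetric] ennreal_mult[symmetric] zero_le_power abs_ge_zero)
  thus ?thesis unfolding scale block whiten .
qed

lemma whiten_sum_squares:
  "(\<Sum>i<p. (whiten x i - whiten y i)\<^sup>2) =
    ((\<Sum>i<p. (x i - y i) * (x i - y i)) - \<gamma> / lam1 * (\<Sum>k<R. (\<Sum>i\<in>B k. x i - y i) * (\<Sum>i\<in>B k. x i - y i))) / lam0"
proof -
  define d where "d i = x i - y i" for i
  define S where "S k = (\<Sum>i\<in>B k. d i)" for k
  define b where "b = (rho - 1) / m"
  have "m > 0" using m_pos by simp
  have "rho\<^sup>2 - 1 = - (\<gamma> * m / lam1)" using rho lam1_pos by (simp add: lam1_eq field_simps)
  hence coeff: "2 * b + m * b\<^sup>2 = - (\<gamma> / lam1)"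
  proof -
    have "2 * b + m * b\<^sup>2 = (rho\<^sup>2 - 1) / m"
      using \<open>m > 0\<close> by (simp add: b_def power_divide power2_eq_square) (simp add: field_simps)
    thus ?thesis using \<open>rho\<^sup>2 - 1 = _\<close> \<open>m > 0\<close> by simp
  qed
  have "(\<Sum>i<p. (whiten x i - whiten y i)\<^sup>2) = (\<Sum>i<p. (d i + b * S (grp i))\<^sup>2 / lam0)"
  proof (intro sum.cong refl)
    fix i assume "i \<in> {..<p}"
    hence "whiten x i - whiten y i = (d i + b * S (grp i)) / sqrt lam0"
      by (simp add: whiten_def b_def d_def S_def sum_subtractf diff_divide_distrib[symmetric])
        (simp add: algebra_simps)
    thus "(whiten x i - whiten y i)\<^sup>2 = (d i + b * S (grp i))\<^sup>2 / lam0"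
      using lam0_pos by (simp add: power_divide)
  qed
  also have "\<dots> = (\<Sum>k<R. \<Sum>i\<in>B k. (d i + b * S k)\<^sup>2) / lam0"
    unfolding sum_groups sum_divide_distrib[symmetric]
    by (intro sum.cong arg_cong[where f = "\<lambda>x. x / lam0"]) (auto simp: grp_eq)
  also have "(\<Sum>k<R. \<Sum>i\<in>B k. (d i + b * S k)\<^sup>2) = (\<Sum>k<R. (\<Sum>i\<in>B k. d i * d i) - \<gamma> / lam1 * (S k * S k))"
  proof (intro sum.cong refl)
    fix k assume "k \<in> {..<R}"
    hence c: "card (B k) = m" by (simp add: card_B)
    have "(\<Sum>i\<in>B k. (d i + b * S k)\<^sup>2) = (\<Sum>i\<in>B k. d i * d i + 2 * b * S k * d i + b\<^sup>2 * (S k)\<^sup>2)"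
      by (intro sum.cong refl) (simp only: power2_eq_square, simp only: algebra_simps)
    also have "\<dots> = (\<Sum>i\<in>B k. d i * d i) + 2 * b * S k * S k + m * (b\<^sup>2 * (S k)\<^sup>2)"
      by (simp only: sum.distrib sum_distrib_left[symmetric] S_def[symmetric] sum_constant c mult.left_commute)
    also have "\<dots> = (\<Sum>i\<in>B k. d i * d i) + (2 * b + m * b\<^sup>2) * (S k * S k)"
      by (simp only: power2_eq_square, simp only: algebra_simps)
    finally show "(\<Sum>i\<in>B k. (d i + b * S k)\<^sup>2) = (\<Sum>i\<in>B k. d i * d i) - \<gamma> / lam1 * (S k * S k)"
      unfolding coeff by simp
  qed
  also have "\<dots> = (\<Sum>i<p. d i * d i) - \<gamma> / lam1 * (\<Sum>k<R. S k * S k)"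
    by (simp only: sum_subtractf sum_distrib_left sum_groups)
  finally show ?thesis by (simp add: d_def S_def)
qed

lemma mvn_density_eq:
  "mvn_density p \<theta> (group_cov p \<gamma> R B) x =
    (1 / sqrt lam0) ^ p * rho ^ R * (\<Prod>i<p. normal_density (whiten \<theta> i) 1 (whiten x i))"
proof -
  let ?Q = "scalar_prod (Matrix.vec p (\<lambda>i. x i - \<theta> i))
      (mult_mat_vec (the (mat_inverse (group_cov p \<gamma> R B))) (Matrix.vec p (\<lambda>i. x i - \<theta> i)))"
  let ?D = "(2 * pi) ^ p * (lam0 ^ p * (lam1 / lam0) ^ R)" and ?K = "(1 / sqrt lam0) ^ p * rho ^ R"
  have "(\<Prod>i<p. normal_density (whiten \<theta> i) 1 (whiten x i)) =
      (\<Prod>i<p. (1 / sqrt (2 * pi)) * exp (- (whiten x i - whiten \<theta> i)\<^sup>2 / 2))"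
    by (simp add: normal_density_def)
  also have "\<dots> = (1 / sqrt (2 * pi)) ^ p * exp (\<Sum>i<p. - (whiten x i - whiten \<theta> i)\<^sup>2 / 2)"
    by (simp only: prod.distrib prod_constant card_lessThan exp_sum[OF finite_lessThan])
  also have "(\<Sum>i<p. - (whiten x i - whiten \<theta> i)\<^sup>2 / 2) = - (\<Sum>i<p. (whiten x i - whiten \<theta> i)\<^sup>2) / 2"
    by (simp only: sum_negf sum_divide_distrib[symmetric])
  also have "(\<Sum>i<p. (whiten x i - whiten \<theta> i)\<^sup>2) = ?Q"
    unfolding whiten_sum_squares quadratic_form_group_cov ..
  finally have prod: "(\<Prod>i<p. normal_density (whiten \<theta> i) 1 (whiten x i)) =
      (1 / sqrt (2 * pi)) ^ p * exp (- ?Q / 2)" .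
  have "rho = 1 / sqrt (lam1 / lam0)"
    using lam0_pos lam1_pos by (simp add: rho_def real_sqrt_divide)
  hence const: "1 / sqrt ?D = ?K * (1 / sqrt (2 * pi)) ^ p"
    by (simp only: real_sqrt_mult real_sqrt_power power_one_over) simp
  have "exp (- ?Q / 2) / sqrt ?D = exp (- ?Q / 2) * (1 / sqrt ?D)" by simp
  also have "\<dots> = ?K * ((1 / sqrt (2 * pi)) ^ p * exp (- ?Q / 2))" unfolding const by (simp only: mult_ac)
  finally show ?thesis unfolding mvn_density_def Let_def det_group_cov prod .
qed

lemma borel_measurable_mvn_density [measurable]:
  "(\<lambda>x. mvn_density p \<theta> (group_cov p \<gamma> R B) x) \<in> borel_measurable (Pi\<^sub>M {..<p} (\<lambda>_. lborel))"
proof -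
  have "(\<lambda>x. whiten x i) \<in> borel_measurable (Pi\<^sub>M {..<p} (\<lambda>_. lborel))" if "i < p" for i
    using measurable_compose[OF whiten_measurable measurable_component_singleton[of i]] that by auto
  thus ?thesis unfolding mvn_density_eq
    by (intro borel_measurable_times borel_measurable_const borel_measurable_prod
      measurable_compose[OF _ borel_measurable_normal_density]) auto
qed

lemma sets_obs_law [measurable_cong]: "sets (obs_law p \<gamma> R B \<theta>) = sets (Pi\<^sub>M {..<p} (\<lambda>_. lborel))"
  by (simp add: obs_law_def mvn_def)

lemma space_obs_law: "space (obs_law p \<gamma> R B \<theta>) = {..<p} \<rightarrow>\<^sub>E UNIV"
  by (simp add: obs_law_def mvn_def space_PiM)

text \<open>
  The whitened observation has independent normal coordinates of unit variance, with mean vector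
  \<open>whiten \<theta>\<close>. In particular every \<open>obs_law\<close> is a probability measure.
\<close>

lemma distr_whiten:
  "distr (obs_law p \<gamma> R B \<theta>) (Pi\<^sub>M {..<p} (\<lambda>_. lborel)) whiten =
    Pi\<^sub>M {..<p} (\<lambda>i. density lborel (normal_density (whiten \<theta> i) 1))"
proof -
  let ?L = "Pi\<^sub>M {..<p} (\<lambda>_. lborel :: real measure)"
  let ?f = "\<lambda>x. \<Prod>i<p. ennreal (normal_density (whiten \<theta> i) 1 (x i))"
  let ?K = "(1 / sqrt lam0) ^ p * rho ^ R"
  have K: "?K > 0" using lam0_pos rho by simp
  have [measurable]: "?f \<in> borel_measurable ?L"
    by (intro borel_measurable_prod_ennreal measurable_compose[OF _ measurable_ennreal]
      measurable_compose[OF _ borel_measurable_normal_density]) auto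
  have "distr (obs_law p \<gamma> R B \<theta>) ?L whiten = density ?L ?f"
  proof (rule measure_eqI)
    fix A assume "A \<in> sets (distr (obs_law p \<gamma> R B \<theta>) ?L whiten)"
    hence A [measurable]: "A \<in> sets ?L" by simp
    have wA: "whiten -` A \<inter> space ?L \<in> sets ?L" by measurable
    have "emeasure (distr (obs_law p \<gamma> R B \<theta>) ?L whiten) A =
        emeasure (obs_law p \<gamma> R B \<theta>) (whiten -` A \<inter> space ?L)"
      by (subst emeasure_distr) (auto simp: obs_law_def mvn_def)
    also have "\<dots> = (\<integral>\<^sup>+x. ennreal (mvn_density p \<theta> (group_cov p \<gamma> R B) x) *
        indicator (whiten -` A \<inter> space ?L) x \<partial>?L)"
      unfolding obs_law_def mvn_def by (subst emeasure_density) (use wA in auto)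
    also have "\<dots> = (\<integral>\<^sup>+x. ennreal ?K * (?f (whiten x) * indicator A (whiten x)) \<partial>?L)"
    proof (intro nn_integral_cong)
      fix x assume x: "x \<in> space ?L"
      have "ennreal (mvn_density p \<theta> (group_cov p \<gamma> R B) x) = ennreal ?K * ?f (whiten x)"
        unfolding mvn_density_eq using K
        by (subst ennreal_mult') (auto simp: prod_ennreal prod_nonneg)
      moreover have "indicator (whiten -` A \<inter> space ?L) x = (indicator A (whiten x) :: ennreal)"
        using x by (auto simp: indicator_def)
      ultimately show "ennreal (mvn_density p \<theta> (group_cov p \<gamma> R B) x) * indicator (whiten -` A \<inter> space ?L) x =
          ennreal ?K * (?f (whiten x) * indicator A (whiten x))" by (simp add: mult.assoc)
    qed
    also have "\<dots> = ennreal ?K * (\<integral>\<^sup>+x. ?f (whiten x) * indicator A (whiten x) \<partial>?L)"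
      by (intro nn_integral_cmult) measurable
    also have "\<dots> = (\<integral>\<^sup>+x. ?f x * indicator A x \<partial>?L)"
      by (rule nn_integral_whiten[symmetric]) measurable
    also have "\<dots> = emeasure (density ?L ?f) A"
      by (subst emeasure_density) auto
    finally show "emeasure (distr (obs_law p \<gamma> R B \<theta>) ?L whiten) A = emeasure (density ?L ?f) A" .
  qed simp
  also have "\<dots> = Pi\<^sub>M {..<p} (\<lambda>i. density lborel (\<lambda>x. ennreal (normal_density (whiten \<theta> i) 1 x)))"
    by (rule density_PiM_lborel_prod) (auto intro: prob_space_normal_density)
  finally show ?thesis .
qed

lemma prob_space_obs_law: "prob_space (obs_law p \<gamma> R B \<theta>)"
proof -
  let ?N = "Pi\<^sub>M {..<p} (\<lambda>i. density lborel (\<lambda>x. ennreal (normal_density (whiten \<theta> i) 1 x)))"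
  have "prob_space ?N" by (intro prob_space_PiM prob_space_normal_density) auto
  hence "prob_space (distr (obs_law p \<gamma> R B \<theta>) (Pi\<^sub>M {..<p} (\<lambda>_. lborel)) whiten)"
    by (simp add: distr_whiten)
  thus ?thesis by (rule prob_space_distrD[rotated]) measurable
qed

end

section \<open>Sums of scores of independent variables\<close>

text \<open>
  The variances of independent centred variables add up.
\<close>

lemma (in prob_space) expectation_square_sum_indep:
  fixes Y :: "'i \<Rightarrow> 'a \<Rightarrow> real"
  assumes fin: "finite I" and indep: "indep_vars (\<lambda>_. borel) Y I"
    and int: "\<And>i. i \<in> I \<Longrightarrow> integrable M (Y i)" and int2: "\<And>i. i \<in> I \<Longrightarrow> integrable M (\<lambda>x. (Y i x)\<^sup>2)"
    and zero: "\<And>i. i \<in> I \<Longrightarrow> expectation (Y i) = 0"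
  shows "integrable M (\<lambda>x. (\<Sum>i\<in>I. Y i x)\<^sup>2) \<and>
    expectation (\<lambda>x. (\<Sum>i\<in>I. Y i x)\<^sup>2) = (\<Sum>i\<in>I. expectation (\<lambda>x. (Y i x)\<^sup>2))"
  using assms
proof (induction I)
  case (insert i I)
  let ?S = "\<lambda>x. \<Sum>i\<in>I. Y i x"
  have indep: "indep_vars (\<lambda>_. borel) Y I" "indep_var borel (Y i) borel ?S"
    using insert.hyps insert.prems(1) by (auto intro: indep_vars_subset indep_vars_sum)
  have IH: "integrable M (\<lambda>x. (?S x)\<^sup>2)"
      "expectation (\<lambda>x. (?S x)\<^sup>2) = (\<Sum>i\<in>I. expectation (\<lambda>x. (Y i x)\<^sup>2))"
    using insert.IH[OF indep(1)] insert.prems by auto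
  have int: "integrable M (Y i)" "integrable M ?S" "integrable M (\<lambda>x. (Y i x)\<^sup>2)"
    using insert.prems by auto
  have prod: "integrable M (\<lambda>x. Y i x * ?S x)" "expectation (\<lambda>x. Y i x * ?S x) = 0"
    using indep_var_integrable[OF indep(2) int(1,2)] indep_var_lebesgue_integral[OF indep(2) int(1,2)]
      insert.prems(4)[of i] by auto
  have sq: "(\<Sum>j\<in>insert i I. Y j x)\<^sup>2 = (Y i x)\<^sup>2 + 2 * (Y i x * ?S x) + (?S x)\<^sup>2" for x
    using insert.hyps by (simp add: power2_sum)
  show ?case unfolding sq using insert.hyps IH int prod by simp
qed auto

text \<open>
  Chebyshev's inequality for the test that rejects when \<open>\<Sum>\<^sub>i (g(X\<^sub>i) - e\<^sub>0) > D/2\<close>. Here \<open>e\<^sub>0\<close> is the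
  mean of each summand under the null hypothesis, \<open>\<Delta> i \<ge> 0\<close> its increase, and the variance
  of a summand is controlled by the increase of its mean.
\<close>

lemma (in prob_space) sum_test_errors:
  fixes X :: "'i \<Rightarrow> 'a \<Rightarrow> real" and g :: "real \<Rightarrow> real" and v w D :: real
  assumes fin: "finite I" and indep: "indep_vars (\<lambda>_. borel) X I" and g [measurable]: "g \<in> borel_measurable borel"
    and int: "\<And>i. i \<in> I \<Longrightarrow> integrable M (\<lambda>x. g (X i x))"
    and int2: "\<And>i. i \<in> I \<Longrightarrow> integrable M (\<lambda>x. (g (X i x))\<^sup>2)"
    and mean: "\<And>i. i \<in> I \<Longrightarrow> expectation (\<lambda>x. g (X i x)) = e0 + \<Delta> i"
    and var: "\<And>i. i \<in> I \<Longrightarrow> variance (\<lambda>x. g (X i x)) \<le> v + w * \<Delta> i"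
    and D: "0 < D" and v: "0 \<le> v" and w: "0 \<le> w"
  shows "(\<And>i. i \<in> I \<Longrightarrow> \<Delta> i = 0) \<Longrightarrow>
      prob {x \<in> space M. (\<Sum>i\<in>I. g (X i x) - e0) > D / 2} \<le> 4 * (card I * v) / D\<^sup>2"
    and "D \<le> (\<Sum>i\<in>I. \<Delta> i) \<Longrightarrow>
      prob {x \<in> space M. (\<Sum>i\<in>I. g (X i x) - e0) \<le> D / 2} \<le> 4 * (card I * v) / D\<^sup>2 + 4 * w / D"
proof -
  have [measurable]: "random_variable borel (X i)" if "i \<in> I" for i
    using indep that by (auto simp: indep_vars_def)
  define Y where "Y i x = g (X i x) - (e0 + \<Delta> i)" for i x
  define S where "S x = (\<Sum>i\<in>I. Y i x)" for x
  have indepY: "indep_vars (\<lambda>_. borel) Y I"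
    unfolding Y_def by (rule indep_vars_compose2[OF indep, where Y = "\<lambda>i x. g x - (e0 + \<Delta> i)"]) auto
  have Y2: "(Y i x)\<^sup>2 = (g (X i x))\<^sup>2 - 2 * (e0 + \<Delta> i) * g (X i x) + (e0 + \<Delta> i)\<^sup>2" for i x
    by (simp add: Y_def power2_diff algebra_simps)
  have ex: "integrable M (\<lambda>x. (S x)\<^sup>2)" "expectation (\<lambda>x. (S x)\<^sup>2) = (\<Sum>i\<in>I. expectation (\<lambda>x. (Y i x)\<^sup>2))"
  proof -
    have "integrable M (\<lambda>x. (\<Sum>i\<in>I. Y i x)\<^sup>2) \<and>
        expectation (\<lambda>x. (\<Sum>i\<in>I. Y i x)\<^sup>2) = (\<Sum>i\<in>I. expectation (\<lambda>x. (Y i x)\<^sup>2))"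
    proof (rule expectation_square_sum_indep[OF fin indepY])
      fix i assume i: "i \<in> I"
      show "integrable M (Y i)" unfolding Y_def using int[OF i] by auto
      show "integrable M (\<lambda>x. (Y i x)\<^sup>2)" unfolding Y2 using int[OF i] int2[OF i] by auto
      show "expectation (Y i) = 0" unfolding Y_def using int[OF i] mean[OF i] by (simp add: prob_space)
    qed
    thus "integrable M (\<lambda>x. (S x)\<^sup>2)" "expectation (\<lambda>x. (S x)\<^sup>2) = (\<Sum>i\<in>I. expectation (\<lambda>x. (Y i x)\<^sup>2))"
      by (auto simp: S_def)
  qed
  have S_meas [measurable]: "S \<in> borel_measurable M" unfolding S_def Y_def by measurable
  have "expectation (\<lambda>x. (Y i x)\<^sup>2) \<le> v + w * \<Delta> i" if "i \<in> I" for i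
    using var[OF that] mean[OF that] by (simp add: Y_def)
  hence "expectation (\<lambda>x. (S x)\<^sup>2) \<le> (\<Sum>i\<in>I. v + w * \<Delta> i)"
    unfolding ex(2) by (intro sum_mono) auto
  hence ES: "expectation (\<lambda>x. (S x)\<^sup>2) \<le> card I * v + w * (\<Sum>i\<in>I. \<Delta> i)"
    by (simp add: sum.distrib sum_distrib_left)
  have stat: "(\<Sum>i\<in>I. g (X i x) - e0) = S x + (\<Sum>i\<in>I. \<Delta> i)" for x
    by (simp add: S_def Y_def sum_subtractf sum.distrib)
  have cheb: "prob {x \<in> space M. a \<le> \<bar>S x\<bar>} \<le> expectation (\<lambda>x. (S x)\<^sup>2) / a\<^sup>2" if "a > 0" for a
    using second_moment_method[OF S_meas ex(1) that] by simp
  {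
    assume 0: "\<And>i. i \<in> I \<Longrightarrow> \<Delta> i = 0"
    have "prob {x \<in> space M. (\<Sum>i\<in>I. g (X i x) - e0) > D / 2} \<le> prob {x \<in> space M. D / 2 \<le> \<bar>S x\<bar>}"
      unfolding stat using 0 by (intro finite_measure_mono) auto
    also have "\<dots> \<le> expectation (\<lambda>x. (S x)\<^sup>2) / (D / 2)\<^sup>2" using D by (intro cheb) simp
    also have "\<dots> \<le> (card I * v) / (D / 2)\<^sup>2"
      using ES 0 D by (intro divide_right_mono) auto
    finally show "prob {x \<in> space M. (\<Sum>i\<in>I. g (X i x) - e0) > D / 2} \<le> 4 * (card I * v) / D\<^sup>2"
      by (simp add: power_divide mult_ac)
  next
    let ?T = "\<Sum>i\<in>I. \<Delta> i"
    assume T: "D \<le> ?T"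
    have "prob {x \<in> space M. (\<Sum>i\<in>I. g (X i x) - e0) \<le> D / 2} \<le> prob {x \<in> space M. ?T / 2 \<le> \<bar>S x\<bar>}"
      unfolding stat using T by (intro finite_measure_mono) auto
    also have "\<dots> \<le> expectation (\<lambda>x. (S x)\<^sup>2) / (?T / 2)\<^sup>2" using D T by (intro cheb) simp
    also have "\<dots> \<le> (card I * v + w * ?T) / (?T / 2)\<^sup>2"
      using ES by (intro divide_right_mono) auto
    also have "\<dots> = 4 * (card I * v) / ?T\<^sup>2 + 4 * w / ?T"
      using D T by (simp add: field_simps power2_eq_square)
    also have "\<dots> \<le> 4 * (card I * v) / D\<^sup>2 + 4 * w / D"
      using D T v w by (intro add_mono divide_left_mono) (auto intro!: power_mono mult_pos_pos)
    finally show "prob {x \<in> space M. (\<Sum>i\<in>I. g (X i x) - e0) \<le> D / 2} \<le> 4 * (card I * v) / D\<^sup>2 + 4 * w / D" .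
  }
qed

section \<open>Moments of a standard normal variable\<close>

text \<open>\<open>gauss_int f\<close> and \<open>gauss_ex f\<close>: integrability and expectation of \<open>f(\<xi>)\<close> for \<open>\<xi> \<sim> N(0, 1)\<close>.\<close>

definition gauss_int :: "(real \<Rightarrow> real) \<Rightarrow> bool" where
  "gauss_int f \<longleftrightarrow> integrable lborel (\<lambda>x. std_normal_density x * f x)"

definition gauss_ex :: "(real \<Rightarrow> real) \<Rightarrow> real" where
  "gauss_ex f = (\<integral>x. std_normal_density x * f x \<partial>lborel)"

lemma gauss_int_add: "gauss_int f \<Longrightarrow> gauss_int g \<Longrightarrow> gauss_int (\<lambda>x. f x + g x)"
  by (simp add: gauss_int_def ring_distribs)

lemma gauss_int_diff: "gauss_int f \<Longrightarrow> gauss_int g \<Longrightarrow> gauss_int (\<lambda>x. f x - g x)"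
  by (simp add: gauss_int_def ring_distribs)

lemma gauss_int_cmult: "gauss_int f \<Longrightarrow> gauss_int (\<lambda>x. c * f x)"
  by (simp add: gauss_int_def mult.left_commute[of _ c])

lemma gauss_ex_add: "gauss_int f \<Longrightarrow> gauss_int g \<Longrightarrow> gauss_ex (\<lambda>x. f x + g x) = gauss_ex f + gauss_ex g"
  by (simp add: gauss_int_def gauss_ex_def ring_distribs)

lemma gauss_ex_diff: "gauss_int f \<Longrightarrow> gauss_int g \<Longrightarrow> gauss_ex (\<lambda>x. f x - g x) = gauss_ex f - gauss_ex g"
  by (simp add: gauss_int_def gauss_ex_def ring_distribs)

lemma gauss_ex_cmult: "gauss_ex (\<lambda>x. c * f x) = c * gauss_ex f"
  by (simp add: gauss_ex_def mult.left_commute[of _ c])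

lemma gauss_ex_mono: "gauss_int f \<Longrightarrow> gauss_int g \<Longrightarrow> (\<And>x. f x \<le> g x) \<Longrightarrow> gauss_ex f \<le> gauss_ex g"
  unfolding gauss_int_def gauss_ex_def by (intro integral_mono mult_left_mono) auto

lemma gauss_int_power: "gauss_int (\<lambda>x. x ^ k)"
  by (simp add: gauss_int_def integrable_std_normal_moment)

lemma gauss_int_const: "gauss_int (\<lambda>_. c)"
  by (simp add: gauss_int_def)

lemma gauss_ex_const: "gauss_ex (\<lambda>_. c) = c"
  by (simp add: gauss_ex_def)

lemma gauss_ex_moments:
  "gauss_ex (\<lambda>x. x) = 0" "gauss_ex (\<lambda>x. x\<^sup>2) = 1" "gauss_ex (\<lambda>x. x ^ 3) = 0" "gauss_ex (\<lambda>x. x ^ 4) = 3"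
  using integral_std_normal_moment_odd[of 0] integral_std_normal_moment_even[of 1]
    integral_std_normal_moment_odd[of 1] integral_std_normal_moment_even[of 2]
  by (simp_all add: gauss_ex_def fact_numeral)

lemma gauss_int_bound:
  assumes [measurable]: "f \<in> borel_measurable borel" and g: "gauss_int g" and le: "\<And>x. \<bar>f x\<bar> \<le> g x"
  shows "gauss_int f"
  unfolding gauss_int_def
proof (rule Bochner_Integration.integrable_bound[OF g[unfolded gauss_int_def]])
  show "AE x in lborel. norm (std_normal_density x * f x) \<le> norm (std_normal_density x * g x)"
  proof (intro AE_I2)
    fix x
    have "\<bar>f x\<bar> \<le> \<bar>g x\<bar>" using le[of x] by simp
    thus "norm (std_normal_density x * f x) \<le> norm (std_normal_density x * g x)"
      by (simp add: abs_mult mult_left_mono)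
  qed
qed simp

lemma gauss_int_quartic:
  assumes "f \<in> borel_measurable borel" and "\<And>x. \<bar>f x\<bar> \<le> a + b * x ^ 4"
  shows "gauss_int f"
  using gauss_int_bound[OF assms(1) gauss_int_add[OF gauss_int_const[of a] gauss_int_cmult[OF gauss_int_power[of 4], of b]]] assms(2)
  by simp

lemma gauss_minus:
  "gauss_int (\<lambda>x. f (- x)) \<longleftrightarrow> gauss_int f" "gauss_ex (\<lambda>x. f (- x)) = gauss_ex f"
  using lborel_integrable_real_affine_iff[of "-1" "\<lambda>x. std_normal_density x * f x" 0]
    lborel_integral_real_affine[of "-1" "\<lambda>x. std_normal_density x * f x" 0]
  by (simp_all add: gauss_int_def gauss_ex_def std_normal_density_def)

lemma gauss_exp_square:
  "gauss_int (\<lambda>x. exp (3 * x\<^sup>2 / 8))" "gauss_ex (\<lambda>x. exp (3 * x\<^sup>2 / 8)) = 2"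
proof -
  have "std_normal_density x * exp (3 * x\<^sup>2 / 8) = 2 * normal_density 0 2 x" for x
  proof -
    have "std_normal_density x * exp (3 * x\<^sup>2 / 8) = 1 / sqrt (2 * pi) * exp (- x\<^sup>2 / 2 + 3 * x\<^sup>2 / 8)"
      by (simp only: exp_add std_normal_density_def mult.assoc)
    also have "- x\<^sup>2 / 2 + 3 * x\<^sup>2 / 8 = - (x - 0)\<^sup>2 / (2 * 2\<^sup>2)" by simp
    also have "1 / sqrt (2 * pi) = 2 * (1 / sqrt (2 * pi * 2\<^sup>2))"
      by (subst (2) real_sqrt_mult) simp
    finally show ?thesis by (simp only: normal_density_def mult.assoc)
  qed
  thus "gauss_int (\<lambda>x. exp (3 * x\<^sup>2 / 8))" "gauss_ex (\<lambda>x. exp (3 * x\<^sup>2 / 8)) = 2"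
    by (simp_all add: gauss_int_def gauss_ex_def)
qed

text \<open>
  The bound comes from \<open>x\<^sup>4 \<le> 128 exp (x\<^sup>2/8)\<close> and, for \<open>|x| > \<tau>\<close>, \<open>1 \<le> exp ((x\<^sup>2 - \<tau>\<^sup>2)/4)\<close>.
\<close>

lemma gauss_quartic_tail:
  assumes \<tau>: "\<tau> \<ge> 0"
  shows "gauss_int (\<lambda>x. if \<bar>x\<bar> > \<tau> then x ^ 4 else 0)"
    "gauss_ex (\<lambda>x. if \<bar>x\<bar> > \<tau> then x ^ 4 else 0) \<le> 256 * exp (- \<tau>\<^sup>2 / 4)"
proof -
  let ?f = "\<lambda>x::real. if \<bar>x\<bar> > \<tau> then x ^ 4 else 0"
  show int: "gauss_int ?f"
    by (rule gauss_int_quartic[of _ 0 1]) auto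
  have le: "?f x \<le> 128 * exp (- \<tau>\<^sup>2 / 4) * exp (3 * x\<^sup>2 / 8)" for x
  proof (cases "\<bar>x\<bar> > \<tau>")
    case True
    hence "\<tau>\<^sup>2 \<le> x\<^sup>2" using \<tau> by (metis abs_le_square_iff abs_of_nonneg less_imp_le)
    have "(x\<^sup>2 / 8)\<^sup>2 / 2 \<le> exp (x\<^sup>2 / 8)"
    proof -
      have "0 \<le> x\<^sup>2 / 8" by simp
      with exp_lower_Taylor_quadratic[OF this] show ?thesis by linarith
    qed
    hence "x ^ 4 \<le> 128 * exp (x\<^sup>2 / 8)" by (simp add: power_divide flip: power_mult)
    also have "\<dots> \<le> 128 * exp (- \<tau>\<^sup>2 / 4 + 3 * x\<^sup>2 / 8)" using \<open>\<tau>\<^sup>2 \<le> x\<^sup>2\<close> by simp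
    also have "\<dots> = 128 * exp (- \<tau>\<^sup>2 / 4) * exp (3 * x\<^sup>2 / 8)"
      by (simp only: exp_add mult.assoc)
    finally show ?thesis using True by simp
  qed auto
  have "gauss_ex ?f \<le> gauss_ex (\<lambda>x. 128 * exp (- \<tau>\<^sup>2 / 4) * exp (3 * x\<^sup>2 / 8))"
    by (intro gauss_ex_mono int gauss_int_cmult gauss_exp_square le)
  thus "gauss_ex ?f \<le> 256 * exp (- \<tau>\<^sup>2 / 4)"
    by (simp add: gauss_ex_cmult gauss_exp_square)
qed

lemma gauss_ex_variance_le:
  assumes f: "gauss_int f" "gauss_int (\<lambda>x. (f x)\<^sup>2)"
  shows "gauss_ex (\<lambda>x. (f x - gauss_ex f)\<^sup>2) \<le> gauss_ex (\<lambda>x. (f x - c)\<^sup>2)"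
proof -
  have eq: "gauss_ex (\<lambda>x. (f x - a)\<^sup>2) = gauss_ex (\<lambda>x. (f x)\<^sup>2) - 2 * a * gauss_ex f + a\<^sup>2" for a
  proof -
    have "(\<lambda>x. (f x - a)\<^sup>2) = (\<lambda>x. ((f x)\<^sup>2 - 2 * a * f x) + a\<^sup>2)"
      by (auto simp: power2_diff)
    thus ?thesis using f
      by (simp add: gauss_ex_add gauss_ex_diff gauss_int_diff gauss_int_cmult gauss_int_const gauss_ex_const gauss_ex_cmult)
  qed
  have "0 \<le> (c - gauss_ex f)\<^sup>2" by simp
  thus ?thesis unfolding eq by (simp add: power2_diff power2_eq_square[of "gauss_ex f"])
qed

lemma (in prob_space) distributed_normal_expectation:
  assumes X: "distributed M lborel X (normal_density \<mu> 1)" and g [measurable]: "g \<in> borel_measurable borel"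
    and int: "gauss_int (\<lambda>x. g (\<mu> + x))"
  shows "integrable M (\<lambda>x. g (X x)) \<and> expectation (\<lambda>x. g (X x)) = gauss_ex (\<lambda>x. g (\<mu> + x))"
proof -
  have dens: "normal_density \<mu> 1 (\<mu> + x) = std_normal_density x" for x
    by (simp add: normal_density_def)
  have "integrable lborel (\<lambda>x. normal_density \<mu> 1 x * g x)"
    using int lborel_integrable_real_affine_iff[of 1 "\<lambda>x. normal_density \<mu> 1 x * g x" \<mu>]
    by (simp add: gauss_int_def dens)
  moreover have "(\<integral>x. normal_density \<mu> 1 x * g x \<partial>lborel) = gauss_ex (\<lambda>x. g (\<mu> + x))"
    using lborel_integral_real_affine[of 1 "\<lambda>x. normal_density \<mu> 1 x * g x" \<mu>]
    by (simp add: gauss_ex_def dens)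
  ultimately show ?thesis
    using distributed_integrable[OF X, of g] distributed_integral[OF X, of g] by simp
qed

section \<open>Testing in the Gaussian sequence model\<close>

text \<open>
  The squared separation rate for \<open>r\<close>-sparse mean vectors observed in \<open>n\<close> independent coordinates of
  unit variance. The sparsity \<open>r\<close> is real, since the group-level problem has \<open>r = s R / p\<close>.
\<close>

definition seq_rate :: "nat \<Rightarrow> real \<Rightarrow> real" where
  "seq_rate n r = (if r < sqrt n then r * ln (1 + n / r\<^sup>2) else sqrt n)"

text \<open>
  The score of one coordinate: its square in the dense regime, and in the sparse regime its square
  in excess of the threshold \<open>\<tau>\<^sup>2 = 4 ln (1 + n/r\<^sup>2)\<close>. The factor \<open>4\<close> makes
  \<open>n exp (- \<tau>\<^sup>2/4) \<le> r\<^sup>2\<close>, so that the null fluctuation of the sum of the scores is of order \<open>r\<close>.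
\<close>

definition score :: "nat \<Rightarrow> real \<Rightarrow> real \<Rightarrow> real" where
  "score n r x = (if r < sqrt n then max 0 (x\<^sup>2 - 4 * ln (1 + n / r\<^sup>2)) else x\<^sup>2)"

lemma gauss_square_moments:
  "gauss_int (\<lambda>x. (\<mu> + x)\<^sup>2)" "gauss_int (\<lambda>x. ((\<mu> + x)\<^sup>2)\<^sup>2)"
  "gauss_ex (\<lambda>x. (\<mu> + x)\<^sup>2) = \<mu>\<^sup>2 + 1"
  "gauss_ex (\<lambda>x. ((\<mu> + x)\<^sup>2 - (\<mu>\<^sup>2 + 1))\<^sup>2) = 2 + 4 * \<mu>\<^sup>2"
proof -
  note int = gauss_int_add gauss_int_cmult gauss_int_const gauss_int_power gauss_int_power[of 1, simplified]
  have 2: "(\<lambda>x. (\<mu> + x)\<^sup>2) = (\<lambda>x. (\<mu>\<^sup>2 + 2 * \<mu> * x) + x\<^sup>2)"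
    by (auto simp: power2_sum)
  have 4: "(\<lambda>x. ((\<mu> + x)\<^sup>2)\<^sup>2) = (\<lambda>x. \<mu> ^ 4 + 4 * \<mu> ^ 3 * x + 6 * \<mu>\<^sup>2 * x\<^sup>2 + 4 * \<mu> * x ^ 3 + 1 * x ^ 4)"
    by (auto simp: fun_eq_iff power2_eq_square power3_eq_cube power4_eq_xxxx algebra_simps)
  have c: "(\<lambda>x. ((\<mu> + x)\<^sup>2 - (\<mu>\<^sup>2 + 1))\<^sup>2) =
      (\<lambda>x. 1 + (- 4 * \<mu>) * x + (4 * \<mu>\<^sup>2 - 2) * x\<^sup>2 + 4 * \<mu> * x ^ 3 + 1 * x ^ 4)"
    by (auto simp: fun_eq_iff power2_eq_square power3_eq_cube power4_eq_xxxx algebra_simps)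
  show "gauss_int (\<lambda>x. (\<mu> + x)\<^sup>2)" unfolding 2 by (intro int)
  show "gauss_int (\<lambda>x. ((\<mu> + x)\<^sup>2)\<^sup>2)" unfolding 4 by (intro int)
  show "gauss_ex (\<lambda>x. (\<mu> + x)\<^sup>2) = \<mu>\<^sup>2 + 1" unfolding 2
    by (subst gauss_ex_add, (intro int)+)+ (simp add: gauss_ex_const gauss_ex_cmult gauss_ex_moments)
  show "gauss_ex (\<lambda>x. ((\<mu> + x)\<^sup>2 - (\<mu>\<^sup>2 + 1))\<^sup>2) = 2 + 4 * \<mu>\<^sup>2" unfolding c
    by (subst gauss_ex_add, (intro int)+)+
      (simp only: gauss_ex_const gauss_ex_cmult gauss_ex_moments, simp)
qed

text \<open>
  Moments of the thresholded square \<open>(x\<^sup>2 - \<tau>\<^sup>2)\<^sub>+\<close> of a normal variable with mean \<open>\<mu>\<close> and variance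
  \<open>1\<close>. The last bound is the important one: up to an exponentially small term, the variance is at
  most a multiple of \<open>\<tau>\<^sup>2\<close> times the increase of the mean over the case \<open>\<mu> = 0\<close>.
\<close>

lemma gauss_threshold_moments:
  fixes \<tau> \<mu> :: real
  assumes \<tau>: "0 \<le> \<tau>" "2 \<le> \<tau>\<^sup>2"
  defines "g \<equiv> \<lambda>x::real. max 0 (x\<^sup>2 - \<tau>\<^sup>2)"
  defines "G \<equiv> gauss_ex (\<lambda>x. g (\<mu> + x))"
  shows "gauss_int (\<lambda>x. g (\<mu> + x))" "gauss_int (\<lambda>x. (g (\<mu> + x))\<^sup>2)"
    "gauss_ex g \<le> G" "\<mu>\<^sup>2 - \<tau>\<^sup>2 \<le> G" "gauss_ex g \<le> 1"
    "gauss_ex (\<lambda>x. (g (\<mu> + x) - G)\<^sup>2) \<le> 23808 * exp (- \<tau>\<^sup>2 / 4) + 12 * \<tau>\<^sup>2 * (G - gauss_ex g)"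
proof -
  have [measurable]: "g \<in> borel_measurable borel" unfolding g_def by measurable
  have g: "0 \<le> g x" "g x \<le> x\<^sup>2" "x\<^sup>2 - \<tau>\<^sup>2 \<le> g x" for x by (auto simp: g_def)
  have gsq: "(g x)\<^sup>2 \<le> (x\<^sup>2)\<^sup>2" for x using g by (intro power_mono) auto
  have int: "gauss_int (\<lambda>x. g (\<mu> + x))" for \<mu>
    by (rule gauss_int_bound[OF _ gauss_square_moments(1)[of \<mu>]]) (use g in auto)
  have int2: "gauss_int (\<lambda>x. (g (\<mu> + x))\<^sup>2)" for \<mu>
    by (rule gauss_int_bound[OF _ gauss_square_moments(2)[of \<mu>]]) (use gsq in auto)
  show "gauss_int (\<lambda>x. g (\<mu> + x))" "gauss_int (\<lambda>x. (g (\<mu> + x))\<^sup>2)" by (rule int int2)+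
  have int0: "gauss_int g" using int[of 0] by simp
  have "gauss_ex g \<le> gauss_ex (\<lambda>x. x\<^sup>2)"
    by (intro gauss_ex_mono int0 gauss_int_power g)
  thus e0: "gauss_ex g \<le> 1" by (simp add: gauss_ex_moments)
  have "gauss_ex (\<lambda>x. (\<mu> + x)\<^sup>2 - \<tau>\<^sup>2) \<le> G" unfolding G_def
    by (intro gauss_ex_mono gauss_int_diff gauss_square_moments gauss_int_const int g)
  thus G_ge: "\<mu>\<^sup>2 - \<tau>\<^sup>2 \<le> G"
    by (simp add: gauss_ex_diff gauss_square_moments gauss_int_const gauss_ex_const)
  have G_nonneg: "0 \<le> G"
    using gauss_ex_mono[OF gauss_int_const[of 0] int[of \<mu>]] g by (simp add: G_def gauss_ex_const)
  show mono: "gauss_ex g \<le> G"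
  proof -
    have int': "gauss_int (\<lambda>x. g (\<mu> - x))" "gauss_ex (\<lambda>x. g (\<mu> - x)) = G"
      using gauss_minus[of "\<lambda>x. g (\<mu> + x)"] int by (simp_all add: G_def)
    \<comment> \<open>symmetry of the normal law and convexity of \<open>g\<close>\<close>
    have "gauss_ex (\<lambda>x. 2 * g x) \<le> gauss_ex (\<lambda>x. g (\<mu> + x) + g (\<mu> - x))"
    proof (intro gauss_ex_mono gauss_int_cmult gauss_int_add int0 int int')
      fix x
      have "2 * (x\<^sup>2 - \<tau>\<^sup>2) \<le> ((\<mu> + x)\<^sup>2 - \<tau>\<^sup>2) + ((\<mu> - x)\<^sup>2 - \<tau>\<^sup>2)"
        using zero_le_power2[of \<mu>] by (simp add: power2_sum power2_diff)
      thus "2 * g x \<le> g (\<mu> + x) + g (\<mu> - x)" unfolding g_def by linarith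
    qed
    thus ?thesis using int int' by (simp add: gauss_ex_cmult gauss_ex_add G_def)
  qed
  let ?tail = "\<lambda>x::real. if \<bar>x\<bar> > \<tau> then x ^ 4 else 0"
  have tail: "gauss_int ?tail" "gauss_ex ?tail \<le> 256 * exp (- \<tau>\<^sup>2 / 4)"
    using gauss_quartic_tail[OF \<tau>(1)] by auto
  have abs_gt: "\<bar>x\<bar> > \<tau>" if "x\<^sup>2 > \<tau>\<^sup>2" for x
    using that \<tau>(1) by (metis abs_le_square_iff abs_of_nonneg not_le)
  have te0: "\<tau>\<^sup>2 * gauss_ex g \<le> 256 * exp (- \<tau>\<^sup>2 / 4)"
  proof -
    have "gauss_ex (\<lambda>x. \<tau>\<^sup>2 * g x) \<le> gauss_ex ?tail"
    proof (intro gauss_ex_mono gauss_int_cmult int0 tail)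
      fix x
      show "\<tau>\<^sup>2 * g x \<le> ?tail x"
      proof (cases "x\<^sup>2 > \<tau>\<^sup>2")
        case True
        hence "\<tau>\<^sup>2 * g x \<le> x\<^sup>2 * x\<^sup>2" using g by (intro mult_mono) auto
        thus ?thesis using abs_gt[OF True] by (simp add: power4_eq_xxxx power2_eq_square mult_ac)
      qed (auto simp: g_def)
    qed
    thus ?thesis using tail by (simp add: gauss_ex_cmult)
  qed
  have "gauss_ex (\<lambda>x. (g (\<mu> + x) - G)\<^sup>2) \<le> 12 * \<tau>\<^sup>2 * G + 20736 * exp (- \<tau>\<^sup>2 / 4)"
  proof (cases "2 * \<tau> \<le> \<bar>\<mu>\<bar>")
    case True
    \<comment> \<open>The mean is far above the threshold: \<open>g\<close> is compared with its value at \<open>\<mu>\<close>.\<close>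
    hence "(2 * \<tau>)\<^sup>2 \<le> \<mu>\<^sup>2" using \<tau>(1) by (metis abs_le_square_iff abs_mult abs_numeral abs_of_nonneg)
    hence mu: "4 * \<tau>\<^sup>2 \<le> \<mu>\<^sup>2" by (simp add: power_mult_distrib)
    have eq: "(\<lambda>x. (2 * \<mu> * x + x\<^sup>2)\<^sup>2) = (\<lambda>x. 4 * \<mu>\<^sup>2 * x\<^sup>2 + 4 * \<mu> * x ^ 3 + 1 * x ^ 4)"
      by (auto simp: fun_eq_iff power2_eq_square power3_eq_cube power4_eq_xxxx algebra_simps)
    have intq: "gauss_int (\<lambda>x. (2 * \<mu> * x + x\<^sup>2)\<^sup>2)" unfolding eq
      by (intro gauss_int_add gauss_int_cmult gauss_int_power)
    have le: "(g (\<mu> + x) - g \<mu>)\<^sup>2 \<le> (2 * \<mu> * x + x\<^sup>2)\<^sup>2" for x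
    proof (rule abs_le_square_iff[THEN iffD1])
      have "\<bar>g (\<mu> + x) - g \<mu>\<bar> \<le> \<bar>(\<mu> + x)\<^sup>2 - \<mu>\<^sup>2\<bar>" unfolding g_def by linarith
      thus "\<bar>g (\<mu> + x) - g \<mu>\<bar> \<le> \<bar>2 * \<mu> * x + x\<^sup>2\<bar>" by (simp add: power2_sum algebra_simps)
    qed
    have "gauss_ex (\<lambda>x. (g (\<mu> + x) - G)\<^sup>2) \<le> gauss_ex (\<lambda>x. (g (\<mu> + x) - g \<mu>)\<^sup>2)"
      unfolding G_def by (intro gauss_ex_variance_le int int2)
    also have "\<dots> \<le> gauss_ex (\<lambda>x. (2 * \<mu> * x + x\<^sup>2)\<^sup>2)"
      by (intro gauss_ex_mono intq le gauss_int_bound[OF _ intq]) (use le in auto)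
    also have "\<dots> = 4 * \<mu>\<^sup>2 + 3" unfolding eq
      by (subst gauss_ex_add, (intro gauss_int_add gauss_int_cmult gauss_int_power)+)+
        (simp only: gauss_ex_cmult gauss_ex_moments)
    also have "\<dots> \<le> 12 * (\<mu>\<^sup>2 - \<tau>\<^sup>2)" using mu \<tau>(2) by simp
    also have "\<dots> \<le> 12 * G" using G_ge by simp
    also have "\<dots> \<le> 12 * \<tau>\<^sup>2 * G"
      using mult_right_mono[of 1 "\<tau>\<^sup>2" "12 * G"] \<tau>(2) G_nonneg by (simp add: mult_ac)
    finally show ?thesis by (simp add: add_increasing2)
  next
    case False
    \<comment> \<open>Here \<open>g \<le> 8 \<tau>\<^sup>2\<close> unless the deviation \<open>x\<close> from the mean exceeds \<open>\<tau>\<close>, and then \<open>g \<le> 9 x\<^sup>2\<close>.\<close>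
    have le: "(g (\<mu> + x))\<^sup>2 \<le> 8 * \<tau>\<^sup>2 * g (\<mu> + x) + 81 * ?tail x" for x
    proof (cases "\<bar>\<mu> + x\<bar> \<le> 3 * \<tau>")
      case True
      hence "(\<mu> + x)\<^sup>2 \<le> (3 * \<tau>)\<^sup>2" using \<tau>(1) by (metis abs_le_square_iff abs_mult abs_numeral abs_of_nonneg)
      hence "g (\<mu> + x) \<le> 8 * \<tau>\<^sup>2" using zero_le_power2[of \<tau>] unfolding g_def by (simp add: power_mult_distrib)
      hence "g (\<mu> + x) * g (\<mu> + x) \<le> 8 * \<tau>\<^sup>2 * g (\<mu> + x)" using g by (intro mult_right_mono)
      thus ?thesis by (simp add: power2_eq_square add_increasing2)
    next
      case gt: False
      hence x: "\<bar>x\<bar> > \<tau>" "\<bar>\<mu> + x\<bar> \<le> \<bar>3 * x\<bar>" using False by linarith+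
      hence "(\<mu> + x)\<^sup>2 \<le> (3 * x)\<^sup>2" by (simp only: abs_le_square_iff)
      hence "g (\<mu> + x) \<le> 9 * x\<^sup>2" using g(2)[of "\<mu> + x"] by (simp add: power_mult_distrib)
      hence "(g (\<mu> + x))\<^sup>2 \<le> (9 * x\<^sup>2)\<^sup>2" using g by (intro power_mono)
      also have "\<dots> = 81 * ?tail x" using x by (simp add: power_mult_distrib flip: power_mult)
      finally show ?thesis using g(1)[of "\<mu> + x"] by (simp add: add_increasing)
    qed
    have "gauss_ex (\<lambda>x. (g (\<mu> + x) - G)\<^sup>2) \<le> gauss_ex (\<lambda>x. (g (\<mu> + x) - 0)\<^sup>2)"
      unfolding G_def by (intro gauss_ex_variance_le int int2)
    also have "\<dots> \<le> gauss_ex (\<lambda>x. 8 * \<tau>\<^sup>2 * g (\<mu> + x) + 81 * ?tail x)"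
      using int2[of \<mu>] le by (intro gauss_ex_mono gauss_int_add gauss_int_cmult int tail) auto
    also have "\<dots> = 8 * \<tau>\<^sup>2 * G + 81 * gauss_ex ?tail"
      by (subst gauss_ex_add) (intro gauss_int_cmult int tail, intro gauss_int_cmult tail, simp only: gauss_ex_cmult G_def)
    also have "\<dots> \<le> 12 * \<tau>\<^sup>2 * G + 20736 * exp (- \<tau>\<^sup>2 / 4)"
    proof -
      have "8 * \<tau>\<^sup>2 * G \<le> 12 * \<tau>\<^sup>2 * G" using G_nonneg by (intro mult_right_mono) auto
      thus ?thesis using tail(2) by linarith
    qed
    finally show ?thesis .
  qed
  also have "\<dots> \<le> 23808 * exp (- \<tau>\<^sup>2 / 4) + 12 * \<tau>\<^sup>2 * (G - gauss_ex g)"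
  proof -
    have "12 * \<tau>\<^sup>2 * (G - gauss_ex g) = 12 * \<tau>\<^sup>2 * G - 12 * (\<tau>\<^sup>2 * gauss_ex g)"
      by (simp add: algebra_simps)
    thus ?thesis using te0 by linarith
  qed
  finally show "gauss_ex (\<lambda>x. (g (\<mu> + x) - G)\<^sup>2) \<le> 23808 * exp (- \<tau>\<^sup>2 / 4) + 12 * \<tau>\<^sup>2 * (G - gauss_ex g)" .
qed

text \<open>
  The Chebyshev bound for normal variables, with the conditions on \<open>g\<close> expressed by Gaussian
  expectations.
\<close>

lemma (in prob_space) normal_sum_test_errors:
  fixes X :: "'i \<Rightarrow> 'a \<Rightarrow> real" and g :: "real \<Rightarrow> real" and v w D :: real
  defines "\<Delta> \<equiv> \<lambda>\<mu>. gauss_ex (\<lambda>x. g (\<mu> + x)) - gauss_ex g"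
  assumes fin: "finite I" and indep: "indep_vars (\<lambda>_. borel) X I"
    and X: "\<And>i. i \<in> I \<Longrightarrow> distributed M lborel (X i) (normal_density (\<nu> i) 1)"
    and g [measurable]: "g \<in> borel_measurable borel"
    and int: "\<And>\<mu>. gauss_int (\<lambda>x. g (\<mu> + x))" "\<And>\<mu>. gauss_int (\<lambda>x. (g (\<mu> + x))\<^sup>2)"
    and var: "\<And>\<mu>. gauss_ex (\<lambda>x. (g (\<mu> + x) - gauss_ex (\<lambda>x. g (\<mu> + x)))\<^sup>2) \<le> v + w * \<Delta> \<mu>"
    and D: "0 < D" and v: "0 \<le> v" and w: "0 \<le> w"
  shows "(\<And>i. i \<in> I \<Longrightarrow> \<nu> i = 0) \<Longrightarrow>
      prob {x \<in> space M. (\<Sum>i\<in>I. g (X i x) - gauss_ex g) > D / 2} \<le> 4 * (card I * v) / D\<^sup>2"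
    and "D \<le> (\<Sum>i\<in>I. \<Delta> (\<nu> i)) \<Longrightarrow>
      prob {x \<in> space M. (\<Sum>i\<in>I. g (X i x) - gauss_ex g) \<le> D / 2} \<le> 4 * (card I * v) / D\<^sup>2 + 4 * w / D"
proof -
  have mean: "integrable M (\<lambda>x. g (X i x))" "expectation (\<lambda>x. g (X i x)) = gauss_ex g + \<Delta> (\<nu> i)" if "i \<in> I" for i
    using distributed_normal_expectation[OF X[OF that] g int(1)] by (auto simp: \<Delta>_def)
  have sq: "integrable M (\<lambda>x. (g (X i x))\<^sup>2)" if "i \<in> I" for i
    using distributed_normal_expectation[OF X[OF that], of "\<lambda>x. (g x)\<^sup>2"] int(2) by auto
  have v': "variance (\<lambda>x. g (X i x)) \<le> v + w * \<Delta> (\<nu> i)" if "i \<in> I" for i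
  proof -
    let ?c = "gauss_ex (\<lambda>x. g (\<nu> i + x))"
    have E: "expectation (\<lambda>x. g (X i x)) = ?c" using mean(2)[OF that] by (simp add: \<Delta>_def)
    have "(\<lambda>x. (g (\<nu> i + x) - ?c)\<^sup>2) = (\<lambda>x. (g (\<nu> i + x))\<^sup>2 - 2 * ?c * g (\<nu> i + x) + ?c\<^sup>2)"
      by (auto simp: power2_diff)
    hence "gauss_int (\<lambda>x. (g (\<nu> i + x) - ?c)\<^sup>2)"
      using int by (simp add: gauss_int_add gauss_int_diff gauss_int_cmult gauss_int_const)
    hence "variance (\<lambda>x. g (X i x)) = gauss_ex (\<lambda>x. (g (\<nu> i + x) - ?c)\<^sup>2)"
      using distributed_normal_expectation[OF X[OF that], of "\<lambda>x. (g x - ?c)\<^sup>2"] by (simp add: E)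
    thus ?thesis using var[of "\<nu> i"] by simp
  qed
  note errors = sum_test_errors[where ?e0.0 = "gauss_ex g" and \<Delta> = "\<lambda>i. \<Delta> (\<nu> i)", OF fin indep g mean(1) sq mean(2) v' D v w]
  show "prob {x \<in> space M. (\<Sum>i\<in>I. g (X i x) - gauss_ex g) > D / 2} \<le> 4 * (card I * v) / D\<^sup>2"
    if "\<And>i. i \<in> I \<Longrightarrow> \<nu> i = 0"
    by (rule errors(1)) (use that in \<open>auto simp: \<Delta>_def\<close>)
  show "prob {x \<in> space M. (\<Sum>i\<in>I. g (X i x) - gauss_ex g) \<le> D / 2} \<le> 4 * (card I * v) / D\<^sup>2 + 4 * w / D"
    if "D \<le> (\<Sum>i\<in>I. \<Delta> (\<nu> i))"
    by (rule errors(2)) (use that in auto)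
qed

lemma ln_one_plus_ge_half:
  assumes "1 \<le> (y::real)" shows "1 / 2 \<le> ln (1 + y)"
proof -
  have "1 / 2 \<le> ln (2::real)" using ln2_ge_two_thirds by simp
  also have "\<dots> \<le> ln (1 + y)" using assms by simp
  finally show ?thesis .
qed

text \<open>
  The test for the sequence model with \<open>n\<close> independent coordinates of unit variance. Only the
  energy of \<open>\<nu>\<close> on some set of at most \<open>2r\<close> coordinates has to be large; the other coordinates
  of \<open>\<nu>\<close> are arbitrary.
\<close>

lemma (in prob_space) sequence_test_errors:
  fixes X :: "'i \<Rightarrow> 'a \<Rightarrow> real" and r C :: real
  assumes fin: "finite I" and n: "card I = n" "1 \<le> n" and indep: "indep_vars (\<lambda>_. borel) X I"
    and X: "\<And>i. i \<in> I \<Longrightarrow> distributed M lborel (X i) (normal_density (\<nu> i) 1)"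
    and r: "1 \<le> r" and C: "24 \<le> C"
  shows "(\<And>i. i \<in> I \<Longrightarrow> \<nu> i = 0) \<Longrightarrow>
      prob {x \<in> space M. (\<Sum>i\<in>I. score n r (X i x) - gauss_ex (score n r)) > C * seq_rate n r / 4} \<le> 64000 / C"
    and "T \<subseteq> I \<Longrightarrow> card T \<le> 2 * r \<Longrightarrow> C * seq_rate n r \<le> (\<Sum>i\<in>T. (\<nu> i)\<^sup>2) \<Longrightarrow>
      prob {x \<in> space M. (\<Sum>i\<in>I. score n r (X i x) - gauss_ex (score n r)) \<le> C * seq_rate n r / 4} \<le> 64000 / C"
proof -
  let ?g = "score n r"
  define \<Delta> where "\<Delta> \<mu> = gauss_ex (\<lambda>x. ?g (\<mu> + x)) - gauss_ex ?g" for \<mu>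
  define D where "D = C * seq_rate n r / 2"
  have C2: "24 * C \<le> C\<^sup>2" using C by (simp add: power2_eq_square)
  have [measurable]: "?g \<in> borel_measurable borel" unfolding score_def by measurable
  have "\<exists>(v::real) (w::real). 0 \<le> v \<and> 0 \<le> w \<and> 0 < D \<and> 4 * (real n * v) / D\<^sup>2 + 4 * w / D \<le> 64000 / C \<and>
      (\<forall>\<mu>. gauss_int (\<lambda>x. ?g (\<mu> + x)) \<and> gauss_int (\<lambda>x. (?g (\<mu> + x))\<^sup>2) \<and> 0 \<le> \<Delta> \<mu> \<and>
        gauss_ex (\<lambda>x. (?g (\<mu> + x) - gauss_ex (\<lambda>x. ?g (\<mu> + x)))\<^sup>2) \<le> v + w * \<Delta> \<mu>) \<and>
      (\<forall>T\<subseteq>I. card T \<le> 2 * r \<longrightarrow> C * seq_rate n r \<le> (\<Sum>i\<in>T. (\<nu> i)\<^sup>2) \<longrightarrow> D \<le> (\<Sum>i\<in>T. \<Delta> (\<nu> i)))"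
  proof (cases "r < sqrt n")
    case False
    have g: "?g = (\<lambda>x. x\<^sup>2)" using False by (auto simp: score_def)
    have rate: "seq_rate n r = sqrt n" using False by (simp add: seq_rate_def)
    have \<Delta>: "\<Delta> \<mu> = \<mu>\<^sup>2" for \<mu> by (simp add: \<Delta>_def g gauss_square_moments gauss_ex_moments)
    have n1: "1 \<le> sqrt n" using n by simp
    have D: "0 < D" using C n1 by (simp add: D_def rate)
    have "4 * (real n * 2) / D\<^sup>2 = 32 / C\<^sup>2" using n C by (simp add: D_def rate power_divide power_mult_distrib)
    also have "\<dots> \<le> 32 / (24 * C)" using C C2 by (intro divide_left_mono) auto
    finally have "4 * (real n * 2) / D\<^sup>2 \<le> 32 / (24 * C)" .
    moreover have "4 * 4 / D \<le> 32 / C"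
      using C n1 by (simp add: D_def rate divide_simps)
    ultimately have "4 * (real n * 2) / D\<^sup>2 + 4 * 4 / D \<le> 32 / (24 * C) + 32 / C" by (rule add_mono)
    also have "\<dots> \<le> 64000 / C" using C by (simp add: field_simps)
    finally have err: "4 * (real n * 2) / D\<^sup>2 + 4 * 4 / D \<le> 64000 / C" .
    have sig: "D \<le> (\<Sum>i\<in>T. \<Delta> (\<nu> i))" if "C * seq_rate n r \<le> (\<Sum>i\<in>T. (\<nu> i)\<^sup>2)" for T
      using that D unfolding \<Delta> D_def by simp
    have mom: "gauss_int (\<lambda>x. ?g (\<mu> + x))" "gauss_int (\<lambda>x. (?g (\<mu> + x))\<^sup>2)" "0 \<le> \<Delta> \<mu>"
        "gauss_ex (\<lambda>x. (?g (\<mu> + x) - gauss_ex (\<lambda>x. ?g (\<mu> + x)))\<^sup>2) \<le> 2 + 4 * \<Delta> \<mu>" for \<mu>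
      unfolding \<Delta> unfolding g gauss_square_moments(3,4) by (rule gauss_square_moments | simp)+
    show ?thesis
    proof (rule exI[of _ "2 :: real"], rule exI[of _ "4 :: real"], intro conjI)
      show "\<forall>\<mu>. gauss_int (\<lambda>x. ?g (\<mu> + x)) \<and> gauss_int (\<lambda>x. (?g (\<mu> + x))\<^sup>2) \<and> 0 \<le> \<Delta> \<mu> \<and>
        gauss_ex (\<lambda>x. (?g (\<mu> + x) - gauss_ex (\<lambda>x. ?g (\<mu> + x)))\<^sup>2) \<le> 2 + 4 * \<Delta> \<mu>"
        using mom by simp
    qed (use D err sig in simp_all)
  next
    case True
    define L where "L = ln (1 + n / r\<^sup>2)"
    define \<tau> where "\<tau> = sqrt (4 * L)"
    have "r\<^sup>2 < n" using True r
      by (metis abs_of_nonneg less_le_trans linorder_not_less of_nat_0_le_iff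
        order_less_imp_le real_sqrt_abs real_sqrt_less_iff real_sqrt_pow2 zero_le_one)
    hence nr: "1 \<le> n / r\<^sup>2" using r by simp
    have L: "1 / 2 \<le> L" unfolding L_def by (rule ln_one_plus_ge_half[OF nr])
    have \<tau>: "0 \<le> \<tau>" "\<tau>\<^sup>2 = 4 * L" "2 \<le> \<tau>\<^sup>2" using L by (auto simp: \<tau>_def)
    have g: "?g = (\<lambda>x. max 0 (x\<^sup>2 - \<tau>\<^sup>2))" using True by (auto simp: score_def L_def \<tau>)
    have rate: "seq_rate n r = r * L" using True by (simp add: seq_rate_def L_def)
    have rL: "1 / 2 \<le> r * L"
    proof -
      have "1 * L \<le> r * L" using r L by (intro mult_right_mono) auto
      thus ?thesis using L by linarith
    qed
    have D: "0 < D" using C rL by (simp add: D_def rate)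
    have mom: "gauss_int (\<lambda>x. ?g (\<mu> + x))" "gauss_int (\<lambda>x. (?g (\<mu> + x))\<^sup>2)"
      "gauss_ex ?g \<le> gauss_ex (\<lambda>x. ?g (\<mu> + x))" "\<mu>\<^sup>2 - \<tau>\<^sup>2 \<le> gauss_ex (\<lambda>x. ?g (\<mu> + x))" "gauss_ex ?g \<le> 1"
      "gauss_ex (\<lambda>x. (?g (\<mu> + x) - gauss_ex (\<lambda>x. ?g (\<mu> + x)))\<^sup>2) \<le>
        23808 * exp (- \<tau>\<^sup>2 / 4) + 12 * \<tau>\<^sup>2 * (gauss_ex (\<lambda>x. ?g (\<mu> + x)) - gauss_ex ?g)" for \<mu>
      unfolding g by (rule gauss_threshold_moments[OF \<tau>(1,3)])+
    let ?v = "23808 * exp (- \<tau>\<^sup>2 / 4)" and ?w = "12 * \<tau>\<^sup>2"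
    have "exp (- \<tau>\<^sup>2 / 4) = inverse (exp L)" by (simp add: \<tau>(2) exp_minus)
    also have "exp L = 1 + n / r\<^sup>2" unfolding L_def using nr by (subst exp_ln) auto
    also have "inverse (1 + n / r\<^sup>2) \<le> inverse (n / r\<^sup>2)" using nr by (intro le_imp_inverse_le) auto
    also have "\<dots> = r\<^sup>2 / n" by simp
    finally have "n * ?v \<le> n * (23808 * (r\<^sup>2 / n))" by (intro mult_left_mono) auto
    hence nv: "n * ?v \<le> 23808 * r\<^sup>2" using n by simp
    have "1 / 4 \<le> L\<^sup>2" using power_mono[OF L, of 2] by (simp add: power_divide)
    have "4 * (n * ?v) / D\<^sup>2 \<le> 4 * (23808 * r\<^sup>2) / D\<^sup>2"
      using nv by (intro divide_right_mono mult_left_mono) auto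
    also have "\<dots> = 380928 / (C\<^sup>2 * L\<^sup>2)" using r C L by (simp add: D_def rate power_divide power_mult_distrib)
    also have "\<dots> \<le> 380928 / ((24 * C) * (1 / 4))"
      using C C2 L \<open>1 / 4 \<le> L\<^sup>2\<close> by (intro divide_left_mono mult_mono) (auto intro!: mult_pos_pos)
    also have "\<dots> = 63488 / C" by simp
    finally have e1: "4 * (n * ?v) / D\<^sup>2 \<le> 63488 / C" .
    have "4 * ?w / D = 384 / (C * r)" using C L r by (simp add: \<tau>(2) D_def rate)
    also have "\<dots> \<le> 384 / C" using C r by (intro divide_left_mono) auto
    finally have "4 * (n * ?v) / D\<^sup>2 + 4 * ?w / D \<le> 63488 / C + 384 / C"
      by (rule add_mono[OF e1])
    also have "\<dots> \<le> 64000 / C" using C by (simp add: divide_right_mono flip: add_divide_distrib)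
    finally have err: "4 * (n * ?v) / D\<^sup>2 + 4 * ?w / D \<le> 64000 / C" .
    \<comment> \<open>Thresholding costs at most \<open>4 L + 1 \<le> 6 L\<close> on each of the \<open>2 r\<close> coordinates, hence at most half of the signal.\<close>
    have sig: "D \<le> (\<Sum>i\<in>T. \<Delta> (\<nu> i))"
      if T: "card T \<le> 2 * r" "C * seq_rate n r \<le> (\<Sum>i\<in>T. (\<nu> i)\<^sup>2)" for T
    proof -
      have "card T * (4 * L + 1) \<le> (2 * r) * (6 * L)" using T(1) L by (intro mult_mono) auto
      also have "\<dots> \<le> D" using C L r by (simp add: D_def rate)
      finally have "card T * (4 * L + 1) \<le> D" .
      hence "D \<le> (\<Sum>i\<in>T. (\<nu> i)\<^sup>2) - card T * (4 * L + 1)" using T(2) by (simp add: D_def)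
      also have "\<dots> = (\<Sum>i\<in>T. (\<nu> i)\<^sup>2 - (4 * L + 1))" by (simp add: sum_subtractf)
      also have "\<dots> \<le> (\<Sum>i\<in>T. \<Delta> (\<nu> i))"
      proof (rule sum_mono)
        fix i show "(\<nu> i)\<^sup>2 - (4 * L + 1) \<le> \<Delta> (\<nu> i)"
          using mom(4)[of "\<nu> i"] mom(5) unfolding \<Delta>_def \<tau>(2) by simp
      qed
      finally show ?thesis .
    qed
    have mom': "gauss_int (\<lambda>x. ?g (\<mu> + x))" "gauss_int (\<lambda>x. (?g (\<mu> + x))\<^sup>2)" "0 \<le> \<Delta> \<mu>"
        "gauss_ex (\<lambda>x. (?g (\<mu> + x) - gauss_ex (\<lambda>x. ?g (\<mu> + x)))\<^sup>2) \<le> ?v + ?w * \<Delta> \<mu>" for \<mu>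
      using mom(1,2,3,6)[of \<mu>] by (auto simp: \<Delta>_def)
    show ?thesis
    proof (rule exI[of _ ?v], rule exI[of _ ?w], intro conjI)
      show "\<forall>\<mu>. gauss_int (\<lambda>x. ?g (\<mu> + x)) \<and> gauss_int (\<lambda>x. (?g (\<mu> + x))\<^sup>2) \<and> 0 \<le> \<Delta> \<mu> \<and>
        gauss_ex (\<lambda>x. (?g (\<mu> + x) - gauss_ex (\<lambda>x. ?g (\<mu> + x)))\<^sup>2) \<le> ?v + ?w * \<Delta> \<mu>"
        using mom' by simp
    qed (use D err sig in simp_all)
  qed
  then obtain v w :: real where vw: "0 \<le> v" "0 \<le> w" and D: "0 < D"
      and err: "4 * (real n * v) / D\<^sup>2 + 4 * w / D \<le> 64000 / C"
      and moments: "\<forall>\<mu>. gauss_int (\<lambda>x. ?g (\<mu> + x)) \<and> gauss_int (\<lambda>x. (?g (\<mu> + x))\<^sup>2) \<and> 0 \<le> \<Delta> \<mu> \<and>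
        gauss_ex (\<lambda>x. (?g (\<mu> + x) - gauss_ex (\<lambda>x. ?g (\<mu> + x)))\<^sup>2) \<le> v + w * \<Delta> \<mu>"
      and signal: "\<forall>T\<subseteq>I. card T \<le> 2 * r \<longrightarrow> C * seq_rate n r \<le> (\<Sum>i\<in>T. (\<nu> i)\<^sup>2) \<longrightarrow> D \<le> (\<Sum>i\<in>T. \<Delta> (\<nu> i))"
    by (elim exE conjE) (rule that)
  have int: "gauss_int (\<lambda>x. ?g (\<mu> + x))" "gauss_int (\<lambda>x. (?g (\<mu> + x))\<^sup>2)" and pos: "0 \<le> \<Delta> \<mu>"
    and var: "gauss_ex (\<lambda>x. (?g (\<mu> + x) - gauss_ex (\<lambda>x. ?g (\<mu> + x)))\<^sup>2) \<le> v + w * \<Delta> \<mu>" for \<mu>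
    using moments[THEN spec, of \<mu>] by simp_all
  have sig: "D \<le> (\<Sum>i\<in>T. \<Delta> (\<nu> i))"
    if "T \<subseteq> I" "card T \<le> 2 * r" "C * seq_rate n r \<le> (\<Sum>i\<in>T. (\<nu> i)\<^sup>2)" for T
    using signal that by simp
  have "0 \<le> 4 * w / D" using vw D by simp
  have half: "D / 2 = C * seq_rate n r / 4" by (simp add: D_def)
  note errors = normal_sum_test_errors[OF fin indep X _ int var[unfolded \<Delta>_def] D vw, folded \<Delta>_def, unfolded half n(1)]
  show "prob {x \<in> space M. (\<Sum>i\<in>I. ?g (X i x) - gauss_ex ?g) > C * seq_rate n r / 4} \<le> 64000 / C"
    if "\<And>i. i \<in> I \<Longrightarrow> \<nu> i = 0"
    using errors(1)[OF _ _ that] err \<open>0 \<le> 4 * w / D\<close> by force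
  show "prob {x \<in> space M. (\<Sum>i\<in>I. ?g (X i x) - gauss_ex ?g) \<le> C * seq_rate n r / 4} \<le> 64000 / C"
    if "T \<subseteq> I" "card T \<le> 2 * r" "C * seq_rate n r \<le> (\<Sum>i\<in>T. (\<nu> i)\<^sup>2)"
  proof -
    have "D \<le> (\<Sum>i\<in>T. \<Delta> (\<nu> i))" using that by (rule sig)
    also have "\<dots> \<le> (\<Sum>i\<in>I. \<Delta> (\<nu> i))" using fin that(1) pos by (intro sum_mono2) auto
    finally have "D \<le> (\<Sum>i\<in>I. \<Delta> (\<nu> i))" .
    from errors(2)[OF _ _ this] err show ?thesis by force
  qed
qed

section \<open>Laws of the whitened coordinates and of the group means\<close>

context group_model
begin

abbreviation "law \<theta> \<equiv> obs_law p \<gamma> R B \<theta>"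

text \<open>
  The sum of the whitened coordinates in a group, scaled to unit variance.
\<close>

definition group_mean :: "nat \<Rightarrow> (nat \<Rightarrow> real) \<Rightarrow> real" where
  "group_mean k x = (\<Sum>i\<in>B k. whiten x i) / sqrt m"

lemma whiten_component_measurable [measurable]:
  "i < p \<Longrightarrow> (\<lambda>x. whiten x i) \<in> borel_measurable (Pi\<^sub>M {..<p} (\<lambda>_. lborel))"
  using measurable_compose[OF whiten_measurable measurable_component_singleton[of i]] by auto

lemma group_mean_measurable [measurable]:
  assumes "k < R"
  shows "group_mean k \<in> borel_measurable (Pi\<^sub>M {..<p} (\<lambda>_. lborel))"
proof -
  have "(\<lambda>x. \<Sum>i\<in>B k. whiten x i) \<in> borel_measurable (Pi\<^sub>M {..<p} (\<lambda>_. lborel))"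
    by (rule borel_measurable_sum) (use B_subset[OF assms] in \<open>auto intro: whiten_component_measurable\<close>)
  thus ?thesis unfolding group_mean_def by (intro borel_measurable_divide) auto
qed

lemma law_measurable_eq: "borel_measurable (law \<theta>) = borel_measurable (Pi\<^sub>M {..<p} (\<lambda>_. lborel))"
  by (rule measurable_cong_sets[OF sets_obs_law]) simp

lemma distributed_whiten:
  assumes i: "i < p"
  shows "distributed (law \<theta>) lborel (\<lambda>x. whiten x i) (normal_density (whiten \<theta> i) 1)"
proof -
  let ?L = "Pi\<^sub>M {..<p} (\<lambda>_. lborel :: real measure)"
  let ?N = "\<lambda>i. density lborel (\<lambda>x. ennreal (normal_density (whiten \<theta> i) 1 x))"
  have w: "whiten \<in> measurable (law \<theta>) ?L" by measurable
  have "distr (law \<theta>) lborel (\<lambda>x. whiten x i) = distr (distr (law \<theta>) ?L whiten) lborel (\<lambda>x. x i)"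
    using i by (subst distr_distr[OF _ w]) (auto simp: comp_def)
  also have "\<dots> = distr (Pi\<^sub>M {..<p} ?N) lborel (\<lambda>x. x i)" by (simp add: distr_whiten)
  also have "\<dots> = distr (Pi\<^sub>M {..<p} ?N) (?N i) (\<lambda>x. x i)" by (intro distr_cong) auto
  also have "\<dots> = ?N i"
    using i by (intro distr_PiM_component prob_space_normal_density) auto
  finally show ?thesis using i unfolding distributed_def
    by (simp add: law_measurable_eq measurable_lborel1 whiten_component_measurable)
qed

lemma indep_whiten: "prob_space.indep_vars (law \<theta>) (\<lambda>_. borel) (\<lambda>i x. whiten x i) {..<p}"
proof -
  interpret prob_space "law \<theta>" by (rule prob_space_obs_law)
  let ?L = "Pi\<^sub>M {..<p} (\<lambda>_. lborel :: real measure)"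
  let ?N = "\<lambda>i. density lborel (\<lambda>x. ennreal (normal_density (whiten \<theta> i) 1 x))"
  have "distr (law \<theta>) (Pi\<^sub>M {..<p} (\<lambda>_. borel)) (\<lambda>x. \<lambda>i\<in>{..<p}. whiten x i) = distr (law \<theta>) ?L whiten"
    by (intro distr_cong refl sets_PiM_cong) (auto simp: whiten_def fun_eq_iff)
  also have "\<dots> = Pi\<^sub>M {..<p} ?N" by (rule distr_whiten)
  also have "\<dots> = Pi\<^sub>M {..<p} (\<lambda>i. distr (law \<theta>) borel (\<lambda>x. whiten x i))"
  proof (intro PiM_cong refl)
    fix i assume "i \<in> {..<p}"
    hence "distr (law \<theta>) lborel (\<lambda>x. whiten x i) = ?N i"
      using distributed_distr_eq_density[OF distributed_whiten] by simp
    moreover have "distr (law \<theta>) lborel (\<lambda>x. whiten x i) = distr (law \<theta>) borel (\<lambda>x. whiten x i)"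
      by (intro distr_cong) auto
    ultimately show "?N i = distr (law \<theta>) borel (\<lambda>x. whiten x i)" by simp
  qed
  finally have "distr (law \<theta>) (Pi\<^sub>M {..<p} (\<lambda>_. borel)) (\<lambda>x. \<lambda>i\<in>{..<p}. whiten x i) =
      Pi\<^sub>M {..<p} (\<lambda>i. distr (law \<theta>) borel (\<lambda>x. whiten x i))" .
  moreover have "0 \<in> {..<p}" using p by simp
  hence "{..<p} \<noteq> {}" by blast
  ultimately show ?thesis
    by (subst indep_vars_iff_distr_eq_PiM') (auto simp: law_measurable_eq whiten_component_measurable)
qed

lemma indep_group_mean: "prob_space.indep_vars (law \<theta>) (\<lambda>_. borel) group_mean {..<R}"
proof -
  interpret prob_space "law \<theta>" by (rule prob_space_obs_law)
  have ind: "indep_vars (\<lambda>k. Pi\<^sub>M (B k) (\<lambda>_. borel)) (\<lambda>k x. \<lambda>i\<in>B k. whiten x i) {..<R}"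
    by (rule indep_vars_restrict[OF indep_whiten]) (use B_subset disjoint_B in auto)
  have "indep_vars (\<lambda>_. borel) (\<lambda>k x. (\<Sum>i\<in>B k. (\<lambda>i\<in>B k. whiten x i) i) / sqrt m) {..<R}"
    by (rule indep_vars_compose2[OF ind, where Y = "\<lambda>k y. (\<Sum>i\<in>B k. y i) / sqrt m"])
      (auto intro!: borel_measurable_divide borel_measurable_sum)
  thus ?thesis
    by (subst (asm) indep_vars_cong) (auto simp: group_mean_def fun_eq_iff)
qed

lemma distributed_group_mean:
  assumes k: "k < R"
  shows "distributed (law \<theta>) lborel (group_mean k) (normal_density (group_mean k \<theta>) 1)"
proof -
  interpret prob_space "law \<theta>" by (rule prob_space_obs_law)
  have Bk: "finite (B k)" "B k \<noteq> {}" "card (B k) = m" "B k \<subseteq> {..<p}"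
    using k finite_B card_B m_pos B_subset by (auto dest: card_B)
  have "distributed (law \<theta>) lborel (\<lambda>x. \<Sum>i\<in>B k. whiten x i)
      (normal_density (\<Sum>i\<in>B k. whiten \<theta> i) (sqrt (\<Sum>i\<in>B k. 1\<^sup>2)))"
    using Bk by (intro sum_indep_normal indep_vars_subset[OF indep_whiten] distributed_whiten) auto
  hence "distributed (law \<theta>) lborel (\<lambda>x. \<Sum>i\<in>B k. whiten x i)
      (normal_density (\<Sum>i\<in>B k. whiten \<theta> i) (sqrt m))" using Bk by simp
  from normal_density_affine[OF this, of "1 / sqrt m" 0] m_pos
  show ?thesis by (simp add: group_mean_def[abs_def])
qed

end

section \<open>The upper bound\<close>

context group_model
begin

lemma m_eq: "real m = real p / real R"
proof -
  have "real p = real R * real m" using p_eq by (metis of_nat_mult)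
  thus ?thesis using R by simp
qed

text \<open>
  The rate is the sum of two sequence-model rates: one for \<open>p\<close> coordinates with noise level \<open>lam0\<close> and
  sparsity \<open>s\<close>, and one for \<open>R\<close> groups with noise level \<open>lam1\<close> and sparsity \<open>s/m\<close>.
\<close>

lemma rate_sq_eq:
  assumes s: "real m \<le> real s"
  shows "rate_sq p s \<gamma> R = lam0 * seq_rate p s + lam1 * seq_rate R (s / m)"
proof -
  have m: "0 < real m" using m_pos by simp
  have pR: "real p = R * m" using p_eq by simp
  have R0: "0 < real R" using R by simp
  have rt: "real p / sqrt R = sqrt R * m" unfolding pR using R0 by (simp add: real_div_sqrt flip: times_divide_eq_left)
  have iff: "real s < real p / sqrt R \<longleftrightarrow> real s / m < sqrt R"
    unfolding rt using m by (simp add: pos_divide_less_eq)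
  have psi1: "psi1_sq p s \<gamma> = lam0 * seq_rate p s"
    by (simp add: psi1_sq_def seq_rate_def lam0_def)
  have l1: "1 - \<gamma> + \<gamma> * (real p / real R) = lam1" by (simp add: lam1_def m_eq)
  show ?thesis
  proof (cases "real s / m < sqrt R")
    case True
    have "real R * real s / real p = s / m" unfolding pR using R0 by simp
    moreover have "(real p)\<^sup>2 / (real R * (real s)\<^sup>2) = R / (s / m)\<^sup>2"
      unfolding pR using R0 m by (simp add: power_divide power_mult_distrib power2_eq_square)
    ultimately show ?thesis using True
      unfolding rate_sq_def l1 iff psi1 by (simp add: seq_rate_def mult.assoc)
  next
    case False
    have "sqrt p \<le> sqrt R * m"
    proof (rule real_le_lsqrt)
      have "real p * 1 \<le> real p * m" using m_pos by (intro mult_left_mono) auto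
      moreover have "(sqrt R * m)\<^sup>2 = real R * m * m"
        by (simp only: power_mult_distrib) (simp add: power2_eq_square)
      ultimately show "real p \<le> (sqrt R * m)\<^sup>2" unfolding pR by simp
    qed (use m R0 in auto)
    also have "\<dots> \<le> s" using False m by (simp add: pos_divide_less_eq not_less)
    finally have "\<not> real s < sqrt p" by simp
    thus ?thesis using False
      unfolding rate_sq_def l1 iff by (simp add: seq_rate_def lam0_def)
  qed
qed

text \<open>
  On a group with at most half of its coordinates in the support, whitening keeps a quarter of
  the energy on the support; on the other groups the whitened coordinates and the group mean
  together keep all of it.
\<close>

lemma energy_of_group:
  fixes \<theta> :: "nat \<Rightarrow> real"
  assumes k: "k < R"
  defines "S \<equiv> {i \<in> B k. \<theta> i \<noteq> 0}"
  shows "2 * card S < m \<Longrightarrow> (\<Sum>i\<in>B k. (\<theta> i)\<^sup>2) / 4 \<le> lam0 * (\<Sum>i\<in>S. (whiten \<theta> i)\<^sup>2)"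
    and "(\<Sum>i\<in>B k. (\<theta> i)\<^sup>2) \<le> lam0 * (\<Sum>i\<in>B k. (whiten \<theta> i)\<^sup>2) + lam1 * (group_mean k \<theta>)\<^sup>2"
proof -
  define \<sigma> where "\<sigma> = (\<Sum>i\<in>B k. \<theta> i)"
  define q where "q = (\<Sum>i\<in>B k. (\<theta> i)\<^sup>2)"
  define c where "c = (1 - rho) / m"
  have m: "0 < real m" using m_pos by simp
  have c: "0 \<le> c" "c * m \<le> 1" "c * m = 1 - rho" using rho m by (auto simp: c_def)
  have fin: "finite (B k)" "finite S" using finite_B[OF k] by (auto simp: S_def)
  have w: "whiten \<theta> i = (\<theta> i - c * \<sigma>) / sqrt lam0" if "i \<in> B k" for i
    using that B_subset[OF k] grp_eq[OF k that] m by (auto simp: whiten_def c_def \<sigma>_def field_simps)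
  have sum: "lam0 * (\<Sum>i\<in>A. (whiten \<theta> i)\<^sup>2) = q - 2 * c * \<sigma>\<^sup>2 + card A * (c\<^sup>2 * \<sigma>\<^sup>2)"
    if A: "S \<subseteq> A" "A \<subseteq> B k" for A
  proof -
    have "lam0 * (\<Sum>i\<in>A. (whiten \<theta> i)\<^sup>2) = (\<Sum>i\<in>A. (\<theta> i - c * \<sigma>)\<^sup>2)"
      unfolding sum_distrib_left using A w lam0_pos by (intro sum.cong refl) (auto simp: power_divide)
    also have "\<dots> = (\<Sum>i\<in>A. (\<theta> i)\<^sup>2 - 2 * c * \<sigma> * \<theta> i + c\<^sup>2 * \<sigma>\<^sup>2)"
      by (intro sum.cong refl) (simp add: power2_diff power_mult_distrib)
    also have "\<dots> = (\<Sum>i\<in>A. (\<theta> i)\<^sup>2) - 2 * c * \<sigma> * (\<Sum>i\<in>A. \<theta> i) + card A * (c\<^sup>2 * \<sigma>\<^sup>2)"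
      by (simp only: sum.distrib sum_subtractf sum_distrib_left[symmetric] sum_constant mult.left_commute)
    also have "(\<Sum>i\<in>A. \<theta> i) = \<sigma>" unfolding \<sigma>_def
      using A fin by (intro sum.mono_neutral_left) (auto simp: S_def)
    also have "(\<Sum>i\<in>A. (\<theta> i)\<^sup>2) = q" unfolding q_def
      using A fin by (intro sum.mono_neutral_left) (auto simp: S_def)
    finally show ?thesis by (simp only: power2_eq_square mult.assoc)
  qed
  show "(\<Sum>i\<in>B k. (\<theta> i)\<^sup>2) / 4 \<le> lam0 * (\<Sum>i\<in>S. (whiten \<theta> i)\<^sup>2)" if few: "2 * card S < m"
  proof -
    define u where "u = c * card S"
    have "2 * u \<le> c * m" unfolding u_def using few c(1)
      by (simp add: mult.left_commute mult_left_mono)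
    hence u: "0 \<le> u" "u \<le> 1 / 2" using c by (auto simp: u_def)
    have "\<sigma> = (\<Sum>i\<in>S. \<theta> i)" unfolding \<sigma>_def
      using fin by (intro sum.mono_neutral_right) (auto simp: S_def)
    moreover have "q = (\<Sum>i\<in>S. (\<theta> i)\<^sup>2)" unfolding q_def
      using fin by (intro sum.mono_neutral_right) (auto simp: S_def)
    ultimately have "\<sigma>\<^sup>2 \<le> card S * q"
      using sum_squared_le_sum_of_squares[of \<theta> S] by (simp add: mult.commute)
    hence "c * \<sigma>\<^sup>2 \<le> u * q" using c(1) by (simp add: u_def mult.assoc mult_left_mono)
    hence "c * \<sigma>\<^sup>2 * (2 - u) \<le> u * q * (2 - u)" using u by (intro mult_right_mono) auto
    also have "\<dots> = (u * (2 - u)) * q" by simp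
    also have "\<dots> \<le> (3 / 4) * q"
    proof (rule mult_right_mono)
      have "0 \<le> (1 / 2 - u) * (3 / 2 - u)" using u by (intro mult_nonneg_nonneg) auto
      also have "(1 / 2 - u) * (3 / 2 - u) = 3 / 4 - u * (2 - u)" by (simp add: field_simps)
      finally show "u * (2 - u) \<le> 3 / 4" by simp
      show "0 \<le> q" by (simp add: q_def sum_nonneg)
    qed
    finally have "c * \<sigma>\<^sup>2 * (2 - u) \<le> (3 / 4) * q" .
    moreover have "lam0 * (\<Sum>i\<in>S. (whiten \<theta> i)\<^sup>2) = q - c * \<sigma>\<^sup>2 * (2 - u)"
      by (subst sum) (auto simp: S_def u_def power2_eq_square algebra_simps)
    ultimately show ?thesis by (simp add: q_def)
  qed
  have "group_mean k \<theta> = rho * \<sigma> / (sqrt lam0 * sqrt m)"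
  proof -
    have "(\<Sum>i\<in>B k. whiten \<theta> i) = (\<Sum>i\<in>B k. \<theta> i - c * \<sigma>) / sqrt lam0"
      unfolding sum_divide_distrib using w by (intro sum.cong) auto
    also have "(\<Sum>i\<in>B k. \<theta> i - c * \<sigma>) = \<sigma> - c * m * \<sigma>"
      using k by (simp add: sum_subtractf \<sigma>_def card_B)
    also have "\<dots> = rho * \<sigma>" unfolding c(3) by (simp add: algebra_simps)
    finally show ?thesis by (simp add: group_mean_def)
  qed
  hence "lam1 * (group_mean k \<theta>)\<^sup>2 = lam1 * rho\<^sup>2 * \<sigma>\<^sup>2 / (lam0 * m)"
    using lam0_pos by (simp add: power_divide power_mult_distrib)
  also have "\<dots> = \<sigma>\<^sup>2 / m" using lam0_pos lam1_pos by (simp add: rho)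
  finally have gm: "lam1 * (group_mean k \<theta>)\<^sup>2 = \<sigma>\<^sup>2 / m" .
  have "0 \<le> (1 - c * m)\<^sup>2 * \<sigma>\<^sup>2 / m" using m by simp
  also have "\<dots> = - 2 * c * \<sigma>\<^sup>2 + m * (c\<^sup>2 * \<sigma>\<^sup>2) + \<sigma>\<^sup>2 / m"
    using m by (simp add: field_simps power2_eq_square)
  finally have "0 \<le> - 2 * c * \<sigma>\<^sup>2 + m * (c\<^sup>2 * \<sigma>\<^sup>2) + \<sigma>\<^sup>2 / m" .
  thus "(\<Sum>i\<in>B k. (\<theta> i)\<^sup>2) \<le> lam0 * (\<Sum>i\<in>B k. (whiten \<theta> i)\<^sup>2) + lam1 * (group_mean k \<theta>)\<^sup>2"
    unfolding gm by (subst sum) (use k in \<open>auto simp: S_def card_B q_def\<close>)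
qed

text \<open>
  The groups are divided by whether the support of \<open>\<theta>\<close> fills at least half of them. There are at most
  \<open>2 s/m\<close> such groups, the index set \<open>G\<close>; the set \<open>T\<close> consists of all their coordinates and of the
  support in the other groups, and has at most \<open>2 s\<close> elements.
\<close>

lemma energy_split:
  assumes s: "card {i \<in> {..<p}. \<theta> i \<noteq> 0} \<le> s"
  obtains T G where "T \<subseteq> {..<p}" "G \<subseteq> {..<R}" "card T \<le> 2 * s" "card G * m \<le> 2 * s"
    "(\<Sum>i<p. (\<theta> i)\<^sup>2) / 4 \<le> lam0 * (\<Sum>i\<in>T. (whiten \<theta> i)\<^sup>2) + lam1 * (\<Sum>k\<in>G. (group_mean k \<theta>)\<^sup>2)"
proof -
  define S where "S k = {i \<in> B k. \<theta> i \<noteq> 0}" for k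
  define T where "T = {i \<in> {..<p}. m \<le> 2 * card (S (grp i)) \<or> \<theta> i \<noteq> 0}"
  define G where "G = {k \<in> {..<R}. m \<le> 2 * card (S k)}"
  have sum_T: "(\<Sum>i\<in>T. f i) = (\<Sum>k<R. \<Sum>i\<in>(if m \<le> 2 * card (S k) then B k else S k). f i)" for f :: "nat \<Rightarrow> real"
  proof -
    have "(\<Sum>i\<in>T. f i) = (\<Sum>k<R. \<Sum>i\<in>B k. if m \<le> 2 * card (S (grp i)) \<or> \<theta> i \<noteq> 0 then f i else 0)"
      unfolding T_def by (subst sum.inter_filter) (simp_all add: sum_groups)
    also have "\<dots> = (\<Sum>k<R. \<Sum>i\<in>(if m \<le> 2 * card (S k) then B k else S k). f i)"
    proof (rule sum.cong[OF refl])
      fix k assume k: "k \<in> {..<R}"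
      hence "(\<Sum>i\<in>B k. if m \<le> 2 * card (S (grp i)) \<or> \<theta> i \<noteq> 0 then f i else 0) =
          (\<Sum>i\<in>B k. if m \<le> 2 * card (S k) \<or> \<theta> i \<noteq> 0 then f i else 0)"
        by (intro sum.cong) (auto simp: grp_eq)
      also have "\<dots> = (\<Sum>i\<in>(if m \<le> 2 * card (S k) then B k else S k). f i)"
        using k finite_B by (simp add: S_def sum.inter_filter)
      finally show "(\<Sum>i\<in>B k. if m \<le> 2 * card (S (grp i)) \<or> \<theta> i \<noteq> 0 then f i else 0) =
          (\<Sum>i\<in>(if m \<le> 2 * card (S k) then B k else S k). f i)" .
    qed
    finally show ?thesis .
  qed
  have cS: "(\<Sum>k<R. real (card (S k))) \<le> s"
  proof -
    have "real (card {i \<in> {..<p}. \<theta> i \<noteq> 0}) = (\<Sum>i<p. if \<theta> i \<noteq> 0 then 1 else 0)"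
      by (subst sum.inter_filter[symmetric]) auto
    also have "\<dots> = (\<Sum>k<R. real (card (S k)))"
      unfolding sum_groups S_def using finite_B
      by (intro sum.cong refl) (simp flip: sum.inter_filter)
    finally show ?thesis using s by simp
  qed
  have subsets: "T \<subseteq> {..<p}" "G \<subseteq> {..<R}" by (auto simp: T_def G_def)
  have card_T: "card T \<le> 2 * s"
  proof -
    have "real (card T) = (\<Sum>i\<in>T. 1)" by simp
    also have "\<dots> \<le> (\<Sum>k<R. 2 * real (card (S k)))"
      unfolding sum_T by (intro sum_mono) (auto simp: card_B)
    also have "\<dots> \<le> 2 * s" using cS by (simp flip: sum_distrib_left)
    finally show ?thesis by linarith
  qed
  have card_G: "card G * m \<le> 2 * s"
  proof -
    have "real (card G * m) = (\<Sum>k\<in>G. real m)" by simp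
    also have "\<dots> \<le> (\<Sum>k\<in>G. 2 * real (card (S k)))" by (intro sum_mono) (auto simp: G_def)
    also have "\<dots> \<le> (\<Sum>k<R. 2 * real (card (S k)))" by (intro sum_mono2) (auto simp: G_def)
    also have "\<dots> \<le> 2 * s" using cS by (simp flip: sum_distrib_left)
    finally show ?thesis by linarith
  qed
  have energy: "(\<Sum>i<p. (\<theta> i)\<^sup>2) / 4 \<le> lam0 * (\<Sum>i\<in>T. (whiten \<theta> i)\<^sup>2) + lam1 * (\<Sum>k\<in>G. (group_mean k \<theta>)\<^sup>2)"
  proof -
    have "(\<Sum>i<p. (\<theta> i)\<^sup>2) / 4 = (\<Sum>k<R. (\<Sum>i\<in>B k. (\<theta> i)\<^sup>2) / 4)"
      by (simp add: sum_groups sum_divide_distrib)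
    also have "\<dots> \<le> (\<Sum>k<R. lam0 * (\<Sum>i\<in>(if m \<le> 2 * card (S k) then B k else S k). (whiten \<theta> i)\<^sup>2) +
        (if m \<le> 2 * card (S k) then lam1 * (group_mean k \<theta>)\<^sup>2 else 0))"
    proof (rule sum_mono)
      fix k assume "k \<in> {..<R}"
      hence k: "k < R" by simp
      have "0 \<le> (\<Sum>i\<in>B k. (\<theta> i)\<^sup>2)" by (simp add: sum_nonneg)
      thus "(\<Sum>i\<in>B k. (\<theta> i)\<^sup>2) / 4 \<le> lam0 * (\<Sum>i\<in>(if m \<le> 2 * card (S k) then B k else S k). (whiten \<theta> i)\<^sup>2) +
          (if m \<le> 2 * card (S k) then lam1 * (group_mean k \<theta>)\<^sup>2 else 0)"
        using energy_of_group[OF k, of \<theta>] by (auto simp: S_def)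
    qed
    also have "\<dots> = lam0 * (\<Sum>i\<in>T. (whiten \<theta> i)\<^sup>2) + lam1 * (\<Sum>k\<in>G. (group_mean k \<theta>)\<^sup>2)"
      unfolding sum_T sum.distrib sum_distrib_left G_def sum.inter_filter[OF finite_lessThan]
      by (intro arg_cong2[where f = "(+)"] refl sum.cong) auto
    finally show ?thesis .
  qed
  show ?thesis by (rule that[OF subsets card_T card_G energy])
qed

lemma whiten_zero: "whiten (\<lambda>i\<in>{..<p}. 0) i = (if i < p then 0 else undefined)"
proof -
  have "(\<Sum>j\<in>B (grp i). (\<lambda>i\<in>{..<p}. 0) j) = (0::real)" if "i < p"
    using B_subset[OF grp(1)[OF that]] by (intro sum.neutral) auto
  thus ?thesis by (simp add: whiten_def)
qed

lemma group_mean_zero: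
  assumes k: "k < R" shows "group_mean k (\<lambda>i\<in>{..<p}. 0) = 0"
proof -
  have "whiten (\<lambda>i\<in>{..<p}. 0) i = 0" if "i \<in> B k" for i
    using B_subset[OF k] that by (subst whiten_zero) auto
  hence "(\<Sum>i\<in>B k. whiten (\<lambda>i\<in>{..<p}. 0) i) = 0" by (intro sum.neutral) auto
  thus ?thesis by (simp add: group_mean_def)
qed

lemma sparse_alternatives_nonempty:
  assumes "1 \<le> s" shows "sparse_alternatives p s \<epsilon> \<noteq> {}"
proof -
  let ?\<theta> = "\<lambda>i\<in>{..<p}. if i = 0 then \<bar>\<epsilon>\<bar> else (0::real)"
  have "(\<Sum>i<p. (?\<theta> i)\<^sup>2) = (\<Sum>i<p. if i = 0 then \<bar>\<epsilon>\<bar>\<^sup>2 else 0)" by (intro sum.cong) auto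
  also have "\<dots> = \<bar>\<epsilon>\<bar>\<^sup>2" using p by simp
  finally have "L2_set ?\<theta> {..<p} = \<bar>\<epsilon>\<bar>" unfolding L2_set_def by simp
  moreover have "card {i \<in> {..<p}. ?\<theta> i \<noteq> 0} \<le> card {0::nat}"
    by (intro card_mono) (auto split: if_splits)
  ultimately have "?\<theta> \<in> sparse_alternatives p s \<epsilon>" using assms
    by (auto simp: sparse_alternatives_def simp del: restrict_apply)
  thus ?thesis by blast
qed

lemma tests_sets:
  assumes "\<phi> \<in> tests p"
  shows "{x \<in> {..<p} \<rightarrow>\<^sub>E UNIV. \<phi> x = a} \<in> sets (law \<theta>)"
proof -
  have "sets (Pi\<^sub>M {..<p} (\<lambda>_. borel :: real measure)) = sets (Pi\<^sub>M {..<p} (\<lambda>_. lborel))"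
    by (intro sets_PiM_cong) auto
  hence *: "\<phi> \<in> measurable (Pi\<^sub>M {..<p} (\<lambda>_. lborel)) (count_space {0, 1})"
    using assms unfolding tests_def by (subst (asm) measurable_cong_sets) auto
  have "\<phi> -` ({a} \<inter> {0, 1}) \<inter> space (Pi\<^sub>M {..<p} (\<lambda>_. lborel :: real measure)) \<in> sets (Pi\<^sub>M {..<p} (\<lambda>_. lborel))"
    by (rule measurable_sets[OF *]) auto
  moreover have "\<phi> -` ({a} \<inter> {0, 1}) \<inter> space (Pi\<^sub>M {..<p} (\<lambda>_. lborel :: real measure)) =
      {x \<in> {..<p} \<rightarrow>\<^sub>E UNIV. \<phi> x = a}"
    using measurable_space[OF *] by (auto simp: space_PiM)
  ultimately show ?thesis by (simp add: sets_obs_law)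
qed

lemma measure_law_le_1: "measure (law \<theta>) A \<le> 1"
  using prob_space.prob_le_1[OF prob_space_obs_law] .

lemma bdd_above_type_two: "bdd_above ((\<lambda>\<theta>. measure (law \<theta>) (A \<theta>)) ` \<Theta>)"
  using measure_law_le_1 by (auto intro: bdd_aboveI[of _ 1])

lemma testing_risk_le:
  assumes s: "1 \<le> s" and \<phi>: "\<phi> \<in> tests p"
    and null: "measure (law (\<lambda>i\<in>{..<p}. 0)) {x \<in> {..<p} \<rightarrow>\<^sub>E UNIV. \<phi> x = 1} \<le> a"
    and alt: "\<And>\<theta>. \<theta> \<in> sparse_alternatives p s \<epsilon> \<Longrightarrow> measure (law \<theta>) {x \<in> {..<p} \<rightarrow>\<^sub>E UNIV. \<phi> x = 0} \<le> b"
  shows "testing_risk p s \<gamma> R B \<epsilon> \<le> a + b"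
proof -
  let ?risk = "\<lambda>\<phi>. measure (law (\<lambda>i\<in>{..<p}. 0)) {x \<in> {..<p} \<rightarrow>\<^sub>E UNIV. \<phi> x = 1} +
      (SUP \<theta>\<in>sparse_alternatives p s \<epsilon>. measure (law \<theta>) {x \<in> {..<p} \<rightarrow>\<^sub>E UNIV. \<phi> x = 0})"
  obtain \<theta> where \<theta>: "\<theta> \<in> sparse_alternatives p s \<epsilon>" using sparse_alternatives_nonempty[OF s] by blast
  have nonneg: "0 \<le> ?risk \<phi>'" for \<phi>' :: "(nat \<Rightarrow> real) \<Rightarrow> nat"
  proof (intro add_nonneg_nonneg measure_nonneg)
    have "0 \<le> measure (law \<theta>) {x \<in> {..<p} \<rightarrow>\<^sub>E UNIV. \<phi>' x = 0}" by simp
    also have "\<dots> \<le> (SUP \<theta>\<in>sparse_alternatives p s \<epsilon>. measure (law \<theta>) {x \<in> {..<p} \<rightarrow>\<^sub>E UNIV. \<phi>' x = 0})"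
      by (rule cSUP_upper[OF \<theta> bdd_above_type_two])
    finally show "0 \<le> (SUP \<theta>\<in>sparse_alternatives p s \<epsilon>. measure (law \<theta>) {x \<in> {..<p} \<rightarrow>\<^sub>E UNIV. \<phi>' x = 0})" .
  qed
  have "testing_risk p s \<gamma> R B \<epsilon> \<le> ?risk \<phi>"
    unfolding testing_risk_def by (rule cINF_lower[OF bdd_belowI2[of _ 0] \<phi>]) (rule nonneg)
  also have "\<dots> \<le> a + b"
    using null alt sparse_alternatives_nonempty[OF s] by (intro add_mono cSUP_least) auto
  finally show ?thesis .
qed

text \<open>
  The test rejects if the scores of the whitened coordinates or the scores of the group means are
  too large.
\<close>

lemma testing_risk_upper:
  assumes s: "real m \<le> real s" and C: "0 \<le> C" "24 \<le> C\<^sup>2 / 8"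
  shows "testing_risk p s \<gamma> R B (C * sqrt (rate_sq p s \<gamma> R)) \<le> 1536000 / C\<^sup>2"
proof -
  \<comment> \<open>The energy bound loses a factor \<open>4\<close>; the remaining factor is slack.\<close>
  define K where "K = C\<^sup>2 / 8"
  define t where "t = real s / m"
  have K: "24 \<le> K" using C by (simp add: K_def)
  have m: "0 < real m" using m_pos by simp
  have t: "1 \<le> t" using s m by (simp add: t_def)
  have s1: "1 \<le> s" "1 \<le> real s" using s m_pos by linarith+
  define A where "A x \<longleftrightarrow> (\<Sum>i<p. score p s (whiten x i) - gauss_ex (score p s)) > K * seq_rate p s / 4" for x
  define A' where "A' x \<longleftrightarrow> (\<Sum>k<R. score R t (group_mean k x) - gauss_ex (score R t)) > K * seq_rate R t / 4" for x
  let ?L = "Pi\<^sub>M {..<p} (\<lambda>_. lborel :: real measure)"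
  have score: "score n r \<in> borel_measurable borel" for n r unfolding score_def by measurable
  have [measurable]: "Measurable.pred ?L A" "Measurable.pred ?L A'"
    unfolding A_def A'_def
    by (intro borel_measurable_pred_less borel_measurable_const borel_measurable_sum borel_measurable_diff
      measurable_compose[OF _ score]; simp)+
  define \<phi> where "\<phi> x = (if A x \<or> A' x then 1 else (0::nat))" for x
  have sp: "space (law \<theta>) = {..<p} \<rightarrow>\<^sub>E UNIV" for \<theta> by (rule space_obs_law)
  have sets: "{x \<in> space (law \<theta>). P x} \<in> sets (law \<theta>)" if "Measurable.pred ?L P" for P \<theta>
  proof -
    have "{x \<in> space ?L. P x} \<in> sets ?L" using that by measurable
    thus ?thesis by (simp add: sets_obs_law sp space_PiM)
  qed
  have "\<phi> \<in> measurable ?L (count_space {0, 1})"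
    unfolding \<phi>_def by (intro measurable_If measurable_const) auto
  moreover have "sets ?L = sets (Pi\<^sub>M {..<p} (\<lambda>_. borel :: real measure))"
    by (intro sets_PiM_cong) auto
  ultimately have \<phi>: "\<phi> \<in> tests p" unfolding tests_def by (subst (asm) measurable_cong_sets) auto
  have "testing_risk p s \<gamma> R B (C * sqrt (rate_sq p s \<gamma> R)) \<le> (64000 / K + 64000 / K) + 64000 / K"
  proof (rule testing_risk_le[OF s1(1) \<phi>])
    let ?z = "\<lambda>i\<in>{..<p}. 0 :: real"
    interpret prob_space "law ?z" by (rule prob_space_obs_law)
    have "{x \<in> {..<p} \<rightarrow>\<^sub>E UNIV. \<phi> x = 1} = {x \<in> space (law ?z). A x} \<union> {x \<in> space (law ?z). A' x}"
      by (auto simp: sp \<phi>_def)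
    hence "prob {x \<in> {..<p} \<rightarrow>\<^sub>E UNIV. \<phi> x = 1} \<le> prob {x \<in> space (law ?z). A x} + prob {x \<in> space (law ?z). A' x}"
      using sets by (simp add: measure_Un_le)
    also have "\<dots> \<le> 64000 / K + 64000 / K"
    proof (rule add_mono)
      show "prob {x \<in> space (law ?z). A x} \<le> 64000 / K" unfolding A_def
        using p by (intro sequence_test_errors(1)[OF _ _ _ indep_whiten distributed_whiten s1(2) K])
          (auto simp: whiten_zero)
      show "prob {x \<in> space (law ?z). A' x} \<le> 64000 / K" unfolding A'_def
        using R by (intro sequence_test_errors(1)[OF _ _ _ indep_group_mean distributed_group_mean t K])
          (auto simp: group_mean_zero)
    qed
    finally show "prob {x \<in> {..<p} \<rightarrow>\<^sub>E UNIV. \<phi> x = 1} \<le> 64000 / K + 64000 / K" .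
  next
    fix \<theta> assume "\<theta> \<in> sparse_alternatives p s (C * sqrt (rate_sq p s \<gamma> R))"
    hence norm: "C * sqrt (rate_sq p s \<gamma> R) \<le> L2_set \<theta> {..<p}"
      and supp: "card {i \<in> {..<p}. \<theta> i \<noteq> 0} \<le> s" by (auto simp: sparse_alternatives_def)
    interpret prob_space "law \<theta>" by (rule prob_space_obs_law)
    have rate: "rate_sq p s \<gamma> R = lam0 * seq_rate p s + lam1 * seq_rate R t"
      unfolding t_def by (rule rate_sq_eq[OF s])
    have pos: "0 \<le> seq_rate n r" if "1 \<le> r" for n r
      using that by (auto simp: seq_rate_def intro!: mult_nonneg_nonneg ln_ge_zero)
    have rate_pos: "0 \<le> rate_sq p s \<gamma> R"
      unfolding rate using pos[OF s1(2)] pos[OF t] lam0_pos lam1_pos by simp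
    have "(C * sqrt (rate_sq p s \<gamma> R))\<^sup>2 \<le> (L2_set \<theta> {..<p})\<^sup>2"
      using norm C(1) rate_pos by (intro power_mono) auto
    hence E: "8 * K * rate_sq p s \<gamma> R \<le> (\<Sum>i<p. (\<theta> i)\<^sup>2)"
      using rate_pos by (simp add: K_def L2_set_def power_mult_distrib sum_nonneg)
    obtain T G where T: "T \<subseteq> {..<p}" "card T \<le> 2 * s" and G: "G \<subseteq> {..<R}" "card G * m \<le> 2 * s"
      and split: "(\<Sum>i<p. (\<theta> i)\<^sup>2) / 4 \<le> lam0 * (\<Sum>i\<in>T. (whiten \<theta> i)\<^sup>2) + lam1 * (\<Sum>k\<in>G. (group_mean k \<theta>)\<^sup>2)"
      using energy_split[OF supp] by metis
    have G': "card G \<le> 2 * t" using G(2) m by (simp add: t_def pos_le_divide_eq) (metis of_nat_le_iff of_nat_mult of_nat_numeral)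
    have "K * (lam0 * seq_rate p s) + K * (lam1 * seq_rate R t) \<le>
        lam0 * (\<Sum>i\<in>T. (whiten \<theta> i)\<^sup>2) + lam1 * (\<Sum>k\<in>G. (group_mean k \<theta>)\<^sup>2)"
    proof -
      have "K * rate_sq p s \<gamma> R \<le> 2 * K * rate_sq p s \<gamma> R"
        using K rate_pos by (intro mult_right_mono) auto
      also have "\<dots> \<le> (\<Sum>i<p. (\<theta> i)\<^sup>2) / 4" using E by simp
      finally show ?thesis using split unfolding rate by (simp add: distrib_left)
    qed
    then consider "lam0 * (K * seq_rate p s) \<le> lam0 * (\<Sum>i\<in>T. (whiten \<theta> i)\<^sup>2)"
      | "lam1 * (K * seq_rate R t) \<le> lam1 * (\<Sum>k\<in>G. (group_mean k \<theta>)\<^sup>2)"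
      by (simp only: mult.left_commute) linarith
    thus "prob {x \<in> {..<p} \<rightarrow>\<^sub>E UNIV. \<phi> x = 0} \<le> 64000 / K"
    proof cases
      case 1
      hence sig: "K * seq_rate p s \<le> (\<Sum>i\<in>T. (whiten \<theta> i)\<^sup>2)" using lam0_pos by simp
      have "prob {x \<in> {..<p} \<rightarrow>\<^sub>E UNIV. \<phi> x = 0} \<le> prob {x \<in> space (law \<theta>). \<not> A x}"
        using sets by (intro finite_measure_mono) (auto simp: \<phi>_def sp)
      also have "\<dots> \<le> 64000 / K" unfolding A_def not_less
        using p T sig by (intro sequence_test_errors(2)[OF _ _ _ indep_whiten distributed_whiten s1(2) K]) auto
      finally show ?thesis .
    next
      case 2
      hence sig: "K * seq_rate R t \<le> (\<Sum>k\<in>G. (group_mean k \<theta>)\<^sup>2)" using lam1_pos by simp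
      have "prob {x \<in> {..<p} \<rightarrow>\<^sub>E UNIV. \<phi> x = 0} \<le> prob {x \<in> space (law \<theta>). \<not> A' x}"
        using sets by (intro finite_measure_mono) (auto simp: \<phi>_def sp)
      also have "\<dots> \<le> 64000 / K" unfolding A'_def not_less
        using R G G' sig by (intro sequence_test_errors(2)[OF _ _ _ indep_group_mean distributed_group_mean t K]) auto
      finally show ?thesis .
    qed
  qed
  thus ?thesis by (simp add: K_def)
qed

end

section \<open>Random supports with independent overlaps\<close>

text \<open>
  A form of Bernoulli's inequality, by convexity of the exponential function.
\<close>

lemma exp_scaled_ln_le:
  assumes "0 \<le> \<delta>" "\<delta> \<le> 1" "0 \<le> (y::real)"
  shows "exp (\<delta> * ln (1 + y)) \<le> 1 + \<delta> * y"
proof -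
  have "exp ((1 - \<delta>) *\<^sub>R 0 + \<delta> *\<^sub>R ln (1 + y)) \<le> (1 - \<delta>) * exp 0 + \<delta> * exp (ln (1 + y))"
    using assms by (intro convex_onD[OF exp_convex]) auto
  thus ?thesis using assms by (simp add: algebra_simps)
qed

text \<open>
  Supports for the lower bound: \<open>{..<n}\<close> contains \<open>r\<close> disjoint blocks of length \<open>n div r\<close>, and a
  support takes one element from each block. For two independent uniformly chosen supports, the
  overlaps in the different blocks are independent.
\<close>

definition block_support :: "nat \<Rightarrow> nat \<Rightarrow> (nat \<Rightarrow> nat) \<Rightarrow> nat set" where
  "block_support n r f = (\<lambda>j. j * (n div r) + f j) ` {..<r}"

definition block_choices :: "nat \<Rightarrow> nat \<Rightarrow> (nat \<Rightarrow> nat) set" where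
  "block_choices n r = {..<r} \<rightarrow>\<^sub>E {..<n div r}"

lemma block_index_eq_iff:
  assumes "a < q" "b < (q::nat)"
  shows "i * q + a = j * q + b \<longleftrightarrow> i = j \<and> a = b"
proof
  assume eq: "i * q + a = j * q + b"
  have "(i * q + a) div q = i" "(j * q + b) div q = j" using assms by auto
  thus "i = j \<and> a = b" using eq by auto
qed auto

lemma block_support:
  assumes f: "f \<in> block_choices n r"
  shows "block_support n r f \<subseteq> {..<n}" "card (block_support n r f) = r"
proof -
  have fj: "f j < n div r" if "j < r" for j using f that by (auto simp: block_choices_def PiE_iff)
  show "block_support n r f \<subseteq> {..<n}"
  proof
    fix x assume "x \<in> block_support n r f"
    then obtain j where j: "j < r" "x = j * (n div r) + f j" by (auto simp: block_support_def)
    have "x < (j + 1) * (n div r)" using j fj[OF j(1)] by simp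
    also have "\<dots> \<le> r * (n div r)" using j by (intro mult_right_mono) auto
    also have "\<dots> \<le> n" by simp
    finally show "x \<in> {..<n}" by simp
  qed
  have "inj_on (\<lambda>j. j * (n div r) + f j) {..<r}"
    using fj by (auto simp: inj_on_def block_index_eq_iff)
  thus "card (block_support n r f) = r" by (simp add: block_support_def card_image)
qed

lemma card_block_support_Int:
  assumes f: "f \<in> block_choices n r" and g: "g \<in> block_choices n r"
  shows "card (block_support n r f \<inter> block_support n r g) = card {j \<in> {..<r}. f j = g j}"
proof -
  have fj: "f j < n div r" "g j < n div r" if "j < r" for j
    using f g that by (auto simp: block_choices_def PiE_iff)
  have "block_support n r f \<inter> block_support n r g = (\<lambda>j. j * (n div r) + f j) ` {j \<in> {..<r}. f j = g j}"
  proof (intro equalityI subsetI)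
    fix x assume "x \<in> block_support n r f \<inter> block_support n r g"
    then obtain i j where ij: "i < r" "j < r" "x = i * (n div r) + f i" "x = j * (n div r) + g j"
      by (auto simp: block_support_def)
    hence "i = j \<and> f i = g j" using block_index_eq_iff[OF fj(1)[OF ij(1)] fj(2)[OF ij(2)], of i j] by simp
    hence "i \<in> {j \<in> {..<r}. f j = g j}" using ij by auto
    thus "x \<in> (\<lambda>j. j * (n div r) + f j) ` {j \<in> {..<r}. f j = g j}"
      using ij(3) by (intro image_eqI[where x = i])
  next
    fix x assume "x \<in> (\<lambda>j. j * (n div r) + f j) ` {j \<in> {..<r}. f j = g j}"
    then obtain j where j: "j < r" "f j = g j" "x = j * (n div r) + f j" by auto
    hence "x = j * (n div r) + g j" by simp
    with j show "x \<in> block_support n r f \<inter> block_support n r g"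
      unfolding block_support_def by blast
  qed
  moreover have "inj_on (\<lambda>j. j * (n div r) + f j) {j \<in> {..<r}. f j = g j}"
    using fj by (auto simp: inj_on_def block_index_eq_iff)
  ultimately show ?thesis by (simp only: card_image)
qed

lemma finite_block_choices: "finite (block_choices n r)"
  by (simp add: block_choices_def finite_PiE)

lemma block_choices_nonempty:
  assumes "1 \<le> r" "r \<le> n" shows "block_choices n r \<noteq> {}"
proof -
  have "0 < n div r" using assms by (simp add: div_greater_zero_iff)
  hence "0 \<in> {..<n div r}" by simp
  hence "{..<n div r} \<noteq> {}" by blast
  thus ?thesis by (simp add: block_choices_def PiE_eq_empty_iff)
qed

lemma block_overlap_moment:
  fixes u \<delta> :: real
  assumes r: "1 \<le> r" "r\<^sup>2 \<le> n" and \<delta>: "0 \<le> \<delta>" "\<delta> \<le> 1" and u: "u \<le> \<delta> * ln (1 + n / (real r)\<^sup>2)"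
  shows "(\<Sum>f\<in>block_choices n r. \<Sum>g\<in>block_choices n r.
      exp (u * card (block_support n r f \<inter> block_support n r g))) \<le> exp (2 * \<delta>) * (card (block_choices n r))\<^sup>2"
proof -
  let ?F = "block_choices n r"
  define q where "q = n div r"
  have "r * 1 \<le> r\<^sup>2" using r by (simp add: power2_eq_square)
  hence rn: "r \<le> n" using r by simp
  have q1: "1 \<le> q" using rn r by (simp add: q_def div_greater_zero_iff Suc_le_eq)
  have "n = q * r + n mod r" by (simp add: q_def)
  moreover have "n mod r < r" using r by simp
  moreover have "1 * r \<le> q * r" using q1 by (intro mult_right_mono) auto
  ultimately have "n \<le> 2 * (q * r)" by linarith
  hence nq: "real n \<le> 2 * (real q * real r)" by (metis of_nat_le_iff of_nat_mult of_nat_numeral)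
  have cardF: "card ?F = q ^ r" by (simp add: block_choices_def card_PiE q_def)
  have one: "(\<Sum>g\<in>?F. exp (u * card (block_support n r f \<inter> block_support n r g))) = (real q - 1 + exp u) ^ r"
    if f: "f \<in> ?F" for f
  proof -
    have "(\<Sum>g\<in>?F. exp (u * card (block_support n r f \<inter> block_support n r g))) =
        (\<Sum>g\<in>?F. \<Prod>j<r. if f j = g j then exp u else 1)"
    proof (intro sum.cong refl)
      fix g assume g: "g \<in> ?F"
      have "exp (u * card {j \<in> {..<r}. f j = g j}) = (\<Prod>j\<in>{j \<in> {..<r}. f j = g j}. exp u)"
        by (simp add: exp_of_nat2_mult)
      also have "\<dots> = (\<Prod>j<r. if f j = g j then exp u else 1)"
        by (rule prod.inter_filter) simp
      finally show "exp (u * card (block_support n r f \<inter> block_support n r g)) =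
          (\<Prod>j<r. if f j = g j then exp u else 1)" by (simp only: card_block_support_Int[OF f g])
    qed
    also have "\<dots> = (\<Prod>j<r. \<Sum>b<q. if f j = b then exp u else 1)"
      unfolding block_choices_def q_def by (rule prod_sum_PiE[symmetric]) auto
    also have "\<dots> = (\<Prod>j<r. real q - 1 + exp u)"
    proof (intro prod.cong refl)
      fix j assume "j \<in> {..<r}"
      hence fj: "f j \<in> {..<q}" using f by (auto simp: block_choices_def PiE_iff q_def)
      have "(\<Sum>b<q. if f j = b then exp u else 1) = (\<Sum>b<q. 1 + (if b = f j then exp u - 1 else 0))"
        by (intro sum.cong) auto
      also have "\<dots> = real q - 1 + exp u" using fj by (subst sum.distrib) simp
      finally show "(\<Sum>b<q. if f j = b then exp u else 1) = real q - 1 + exp u" .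
    qed
    finally show ?thesis by simp
  qed
  have "exp u \<le> exp (\<delta> * ln (1 + n / (real r)\<^sup>2))" using u by simp
  also have "\<dots> \<le> 1 + \<delta> * (n / (real r)\<^sup>2)" using \<delta> by (intro exp_scaled_ln_le) auto
  also have "\<dots> \<le> 1 + \<delta> * (2 * q / r)"
  proof -
    have "real n / (real r)\<^sup>2 \<le> 2 * (real q * real r) / (real r)\<^sup>2" using nq by (intro divide_right_mono) auto
    also have "\<dots> = 2 * q / r" using r by (simp add: power2_eq_square)
    finally show ?thesis using \<delta> by (intro add_left_mono mult_left_mono) auto
  qed
  finally have "real q - 1 + exp u \<le> real q * (1 + 2 * \<delta> / r)" using r q1 by (simp add: field_simps)
  also have "\<dots> \<le> real q * exp (2 * \<delta> / r)" by (intro mult_left_mono exp_ge_add_one_self) auto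
  finally have "(real q - 1 + exp u) ^ r \<le> (real q * exp (2 * \<delta> / r)) ^ r"
    using q1 by (intro power_mono) (auto intro: add_nonneg_nonneg)
  also have "\<dots> = q ^ r * exp (2 * \<delta>)"
    using r by (simp add: power_mult_distrib exp_of_nat_mult[symmetric])
  finally have "(real q - 1 + exp u) ^ r \<le> q ^ r * exp (2 * \<delta>)" .
  hence "(\<Sum>f\<in>?F. (real q - 1 + exp u) ^ r) \<le> (\<Sum>f\<in>?F. q ^ r * exp (2 * \<delta>))" by (intro sum_mono)
  moreover have "(\<Sum>f\<in>?F. q ^ r * exp (2 * \<delta>)) = exp (2 * \<delta>) * (card ?F)\<^sup>2"
    by (simp add: cardF power2_eq_square)
  moreover have "(\<Sum>f\<in>?F. \<Sum>g\<in>?F. exp (u * card (block_support n r f \<inter> block_support n r g))) =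
      (\<Sum>f\<in>?F. (real q - 1 + exp u) ^ r)"
    by (rule sum.cong[OF refl one])
  ultimately show ?thesis by linarith
qed

text \<open>
  The sparsity is rounded down to an integer \<open>r'\<close> that also satisfies \<open>r'\<^sup>2 \<le> n\<close>; in the dense regime
  \<open>r'\<close> is the integer part of \<open>sqrt n\<close>, and the alternatives used are sparser than required.
\<close>

lemma seq_rate_le_integer_sparsity:
  fixes r :: real
  assumes n: "1 \<le> n" and r: "1 \<le> r"
  obtains r' :: nat where "1 \<le> r'" "real r' \<le> r" "r'\<^sup>2 \<le> n" "seq_rate n r \<le> 4 * real r' * ln (1 + n / (real r')\<^sup>2)"
proof -
  have n1: "1 \<le> sqrt n" using n by simp
  define b where "b = min r (sqrt n)"
  define r' where "r' = nat \<lfloor>b\<rfloor>"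
  have b: "1 \<le> b" using r n1 by (simp add: b_def)
  have r'_le: "real r' \<le> b" and r'_1: "1 \<le> r'" using b by (auto simp: r'_def le_nat_floor)
  have "b < real r' + 1" using b by (simp add: r'_def)
  hence b2: "b \<le> 2 * r'" using r'_1 by simp
  have r'n: "(real r')\<^sup>2 \<le> n"
    using power_mono[of "real r'" "sqrt n" 2] r'_le by (simp add: b_def)
  have n0: "0 < (real r')\<^sup>2" using r'_1 by simp
  have ge1: "1 \<le> n / (real r')\<^sup>2" using r'n n0 by simp
  have half: "1 / 2 \<le> ln (1 + n / (real r')\<^sup>2)" by (rule ln_one_plus_ge_half[OF ge1])
  have "seq_rate n r \<le> 4 * real r' * ln (1 + n / (real r')\<^sup>2)"
  proof (cases "r < sqrt n")
    case True
    have "n / r\<^sup>2 \<le> n / (real r')\<^sup>2"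
      using r'_le n0 r r'_1 by (intro divide_left_mono power_mono mult_pos_pos) (auto simp: b_def)
    hence "ln (1 + n / r\<^sup>2) \<le> ln (1 + n / (real r')\<^sup>2)"
      by (subst ln_le_cancel_iff) (auto intro: add_pos_nonneg)
    moreover have "r \<le> 4 * r'" using b2 r'_1 True by (simp add: b_def)
    moreover have "0 \<le> ln (1 + n / r\<^sup>2)" by simp
    ultimately have "r * ln (1 + n / r\<^sup>2) \<le> 4 * r' * ln (1 + n / (real r')\<^sup>2)"
      using r by (intro mult_mono) auto
    thus ?thesis using True by (simp add: seq_rate_def)
  next
    case False
    have "sqrt n \<le> 2 * r'" using False b2 by (simp add: b_def)
    also have "\<dots> = 4 * r' * (1 / 2)" by simp
    also have "\<dots> \<le> 4 * r' * ln (1 + n / (real r')\<^sup>2)" using half by (intro mult_left_mono) auto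
    finally show ?thesis using False by (simp add: seq_rate_def)
  qed
  moreover have "r'\<^sup>2 \<le> n" using r'n by (metis of_nat_le_iff of_nat_power)
  ultimately show ?thesis using that r'_1 r'_le by (simp add: b_def)
qed

section \<open>The second moment method\<close>

context group_model
begin

text \<open>
  The inner product \<open>d\<^sup>T \<Sigma>\<^sup>-\<^sup>1 e\<close> for the covariance matrix \<open>\<Sigma>\<close>, by its closed form.
\<close>

definition cov_inner :: "(nat \<Rightarrow> real) \<Rightarrow> (nat \<Rightarrow> real) \<Rightarrow> real" where
  "cov_inner d e = ((\<Sum>i<p. d i * e i) - \<gamma> / lam1 * (\<Sum>k<R. (\<Sum>i\<in>B k. d i) * (\<Sum>i\<in>B k. e i))) / lam0"

lemma cov_inner_commute: "cov_inner d e = cov_inner e d"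
  by (simp add: cov_inner_def mult.commute)

lemma cov_inner_add_left: "cov_inner (\<lambda>i. d i + e i) f = cov_inner d f + cov_inner e f"
  by (simp add: cov_inner_def sum.distrib distrib_right add_divide_distrib diff_divide_distrib distrib_left)

lemma cov_inner_diff_left: "cov_inner (\<lambda>i. d i - e i) f = cov_inner d f - cov_inner e f"
  by (simp add: cov_inner_def sum_subtractf left_diff_distrib diff_divide_distrib right_diff_distrib)

lemma cov_inner_cong:
  assumes "\<And>i. i < p \<Longrightarrow> d i = d' i" "\<And>i. i < p \<Longrightarrow> e i = e' i"
  shows "cov_inner d e = cov_inner d' e'"
proof -
  have "(\<Sum>i\<in>B k. d i) = (\<Sum>i\<in>B k. d' i)" "(\<Sum>i\<in>B k. e i) = (\<Sum>i\<in>B k. e' i)" if "k < R" for k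
    using B_subset[OF that] assms by (auto intro!: sum.cong)
  moreover have "(\<Sum>i<p. d i * e i) = (\<Sum>i<p. d' i * e' i)" using assms by simp
  ultimately show ?thesis unfolding cov_inner_def by simp
qed

lemma mvn_density_cov_inner:
  "mvn_density p \<theta> (group_cov p \<gamma> R B) x =
    exp (- cov_inner (\<lambda>i. x i - \<theta> i) (\<lambda>i. x i - \<theta> i) / 2) / sqrt ((2 * pi) ^ p * (lam0 ^ p * (lam1 / lam0) ^ R))"
  unfolding mvn_density_def Let_def quadratic_form_group_cov det_group_cov cov_inner_def ..

abbreviation "law0 \<equiv> law (\<lambda>i\<in>{..<p}. 0)"

text \<open>
  The density of the law with mean \<open>\<theta>\<close> with respect to the centred law.
\<close>

definition likelihood_ratio :: "(nat \<Rightarrow> real) \<Rightarrow> (nat \<Rightarrow> real) \<Rightarrow> real" where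
  "likelihood_ratio \<theta> x = exp (cov_inner \<theta> x - cov_inner \<theta> \<theta> / 2)"

lemma mvn_density_likelihood_ratio:
  "mvn_density p \<theta> (group_cov p \<gamma> R B) x =
    mvn_density p (\<lambda>i\<in>{..<p}. 0) (group_cov p \<gamma> R B) x * likelihood_ratio \<theta> x"
proof -
  have "cov_inner (\<lambda>i. x i - \<theta> i) (\<lambda>i. x i - \<theta> i) = cov_inner x x - 2 * cov_inner \<theta> x + cov_inner \<theta> \<theta>"
    using cov_inner_commute[of x "\<lambda>i. x i - \<theta> i"] cov_inner_commute[of \<theta> "\<lambda>i. x i - \<theta> i"]
      cov_inner_commute[of x \<theta>]
    by (simp add: cov_inner_diff_left)
  moreover have "cov_inner (\<lambda>i. x i - (\<lambda>i\<in>{..<p}. 0) i) (\<lambda>i. x i - (\<lambda>i\<in>{..<p}. 0) i) = cov_inner x x"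
    by (rule cov_inner_cong) auto
  ultimately show ?thesis
    unfolding mvn_density_cov_inner likelihood_ratio_def
    by (simp add: diff_divide_distrib add_divide_distrib flip: exp_add)
qed

lemma likelihood_ratio_measurable [measurable]:
  "likelihood_ratio \<theta> \<in> borel_measurable (Pi\<^sub>M {..<p} (\<lambda>_. lborel))"
proof -
  have B: "i < p" if "k < R" "i \<in> B k" for i k using B_subset that by blast
  show ?thesis unfolding likelihood_ratio_def[abs_def] cov_inner_def
    by measurable (auto intro: B)
qed

lemma law_eq_density: "law \<theta> = density law0 (\<lambda>x. ennreal (likelihood_ratio \<theta> x))"
proof -
  have "law \<theta> = density (Pi\<^sub>M {..<p} (\<lambda>_. lborel))
      (\<lambda>x. ennreal (mvn_density p (\<lambda>i\<in>{..<p}. 0) (group_cov p \<gamma> R B) x) * ennreal (likelihood_ratio \<theta> x))"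
    unfolding obs_law_def mvn_def
    by (subst mvn_density_likelihood_ratio) (simp add: likelihood_ratio_def ennreal_mult'')
  thus ?thesis unfolding obs_law_def mvn_def by (subst density_density_eq) auto
qed

lemma likelihood_ratio_integrals:
  "integrable law0 (likelihood_ratio \<theta>)" "(\<integral>x. likelihood_ratio \<theta> x \<partial>law0) = 1"
  "A \<in> sets law0 \<Longrightarrow> measure (law \<theta>) A = (\<integral>x. likelihood_ratio \<theta> x * indicator A x \<partial>law0)"
proof -
  have lr: "likelihood_ratio \<theta> \<in> borel_measurable law0"
    by (simp add: law_measurable_eq)
  have nonneg: "AE x in law0. 0 \<le> likelihood_ratio \<theta> x" by (simp add: likelihood_ratio_def)
  interpret P: prob_space "law \<theta>" by (rule prob_space_obs_law)
  show "integrable law0 (likelihood_ratio \<theta>)"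
    using integrable_density[OF borel_measurable_const[of "1::real" law0] lr nonneg]
    by (simp flip: law_eq_density)
  show "(\<integral>x. likelihood_ratio \<theta> x \<partial>law0) = 1"
    using integral_density[OF borel_measurable_const[of "1::real" law0] lr nonneg]
    by (simp add: P.prob_space flip: law_eq_density)
  assume A: "A \<in> sets law0"
  have "A \<inter> ({..<p} \<rightarrow>\<^sub>E UNIV) = A" using sets.sets_into_space[OF A] by (auto simp: space_obs_law)
  hence "measure (law \<theta>) A = (\<integral>x. indicator A x \<partial>law \<theta>)"
    by (simp only: Bochner_Integration.integral_indicator space_obs_law)
  also have "\<dots> = (\<integral>x. likelihood_ratio \<theta> x *\<^sub>R indicator A x \<partial>law0)"
    unfolding law_eq_density[of \<theta>] by (rule integral_density[OF borel_measurable_indicator[OF A] lr nonneg])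
  also have "\<dots> = (\<integral>x. likelihood_ratio \<theta> x * indicator A x \<partial>law0)" by simp
  finally show "measure (law \<theta>) A = (\<integral>x. likelihood_ratio \<theta> x * indicator A x \<partial>law0)" .
qed

lemma likelihood_ratio_mult:
  "likelihood_ratio \<theta> x * likelihood_ratio \<theta>' x = exp (cov_inner \<theta> \<theta>') * likelihood_ratio (\<lambda>i. \<theta> i + \<theta>' i) x"
proof -
  have "cov_inner (\<lambda>i. \<theta> i + \<theta>' i) (\<lambda>i. \<theta> i + \<theta>' i) = cov_inner \<theta> \<theta> + 2 * cov_inner \<theta> \<theta>' + cov_inner \<theta>' \<theta>'"
    using cov_inner_commute[of \<theta> "\<lambda>i. \<theta> i + \<theta>' i"] cov_inner_commute[of \<theta>' "\<lambda>i. \<theta> i + \<theta>' i"]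
      cov_inner_commute[of \<theta>' \<theta>]
    by (simp add: cov_inner_add_left)
  thus ?thesis unfolding likelihood_ratio_def
    by (simp add: cov_inner_add_left add_divide_distrib flip: exp_add)
qed

text \<open>
  The second moment method: a finite family of alternatives, with the uniform prior, cannot be
  told from the null hypothesis if the likelihood ratio of the mixture has variance at most \<open>\<eta>\<^sup>2\<close>.
\<close>

lemma testing_risk_ge:
  fixes \<eta> \<epsilon> :: real
  assumes F: "finite F" "F \<noteq> {}" and \<eta>: "0 < \<eta>"
    and alt: "\<And>f. f \<in> F \<Longrightarrow> \<Theta> f \<in> sparse_alternatives p s \<epsilon>"
    and overlap: "(\<Sum>f\<in>F. \<Sum>g\<in>F. exp (cov_inner (\<Theta> f) (\<Theta> g))) \<le> (1 + \<eta>\<^sup>2) * (card F)\<^sup>2"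
  shows "1 - \<eta> \<le> testing_risk p s \<gamma> R B \<epsilon>"
  unfolding testing_risk_def
proof (rule cINF_greatest)
  show "tests p \<noteq> {}"
  proof -
    have "(\<lambda>_. 0) \<in> tests p" by (simp add: tests_def)
    thus ?thesis by blast
  qed
  fix \<phi> assume \<phi>: "\<phi> \<in> tests p"
  interpret P0: prob_space law0 by (rule prob_space_obs_law)
  define A where "A = {x \<in> {..<p} \<rightarrow>\<^sub>E UNIV. \<phi> x = 0}"
  have A: "A \<in> sets law0" unfolding A_def by (rule tests_sets[OF \<phi>])
  have zero_one: "\<phi> x = 0 \<or> \<phi> x = 1" if "x \<in> {..<p} \<rightarrow>\<^sub>E UNIV" for x
    using measurable_space[OF \<phi>[unfolded tests_def], of x] that by (auto simp: space_PiM)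
  have "\<phi> x = 1 \<longleftrightarrow> \<phi> x \<noteq> 0" if "x \<in> {..<p} \<rightarrow>\<^sub>E UNIV" for x
    using zero_one[OF that] by auto
  hence "{x \<in> {..<p} \<rightarrow>\<^sub>E UNIV. \<phi> x = 1} = space law0 - A"
    unfolding A_def space_obs_law by (intro Set.set_eqI) (simp, blast)
  hence type1: "measure law0 {x \<in> {..<p} \<rightarrow>\<^sub>E UNIV. \<phi> x = 1} = 1 - measure law0 A"
    using P0.prob_compl[OF A] by simp
  let ?N = "real (card F)"
  have N: "0 < ?N" using F by (simp add: card_gt_0_iff)
  define L where "L x = (\<Sum>f\<in>F. likelihood_ratio (\<Theta> f) x) / ?N" for x
  have L_int: "integrable law0 L" "(\<integral>x. L x \<partial>law0) = 1"
    unfolding L_def using N by (auto simp: likelihood_ratio_integrals)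
  have sq: "(L x)\<^sup>2 = (\<Sum>f\<in>F. \<Sum>g\<in>F. exp (cov_inner (\<Theta> f) (\<Theta> g)) *
      likelihood_ratio (\<lambda>i. \<Theta> f i + \<Theta> g i) x) / ?N\<^sup>2" for x
  proof -
    have "(\<Sum>f\<in>F. likelihood_ratio (\<Theta> f) x)\<^sup>2 = (\<Sum>f\<in>F. \<Sum>g\<in>F. exp (cov_inner (\<Theta> f) (\<Theta> g)) *
        likelihood_ratio (\<lambda>i. \<Theta> f i + \<Theta> g i) x)"
      by (simp only: power2_eq_square sum_product likelihood_ratio_mult)
    thus ?thesis by (simp only: L_def power_divide)
  qed
  have L2_int: "integrable law0 (\<lambda>x. (L x)\<^sup>2)" unfolding sq
    by (intro integrable_divide_zero Bochner_Integration.integrable_sum integrable_mult_right)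
      (simp add: likelihood_ratio_integrals)
  have "(\<integral>x. (L x)\<^sup>2 \<partial>law0) = (\<Sum>f\<in>F. \<Sum>g\<in>F. exp (cov_inner (\<Theta> f) (\<Theta> g))) / ?N\<^sup>2"
    unfolding sq by (simp add: likelihood_ratio_integrals)
  also have "\<dots> \<le> 1 + \<eta>\<^sup>2" using overlap N by (simp add: pos_divide_le_eq)
  finally have L2: "(\<integral>x. (L x)\<^sup>2 \<partial>law0) \<le> 1 + \<eta>\<^sup>2" .
  define S where "S = (SUP \<theta>\<in>sparse_alternatives p s \<epsilon>. measure (law \<theta>) A)"
  have "(\<Sum>f\<in>F. measure (law (\<Theta> f)) A) \<le> (\<Sum>f\<in>F. S)"
    unfolding S_def by (intro sum_mono cSUP_upper alt bdd_above_type_two)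
  hence "(\<Sum>f\<in>F. measure (law (\<Theta> f)) A) / ?N \<le> S" using N by (simp add: pos_divide_le_eq mult.commute)
  moreover have "(\<Sum>f\<in>F. measure (law (\<Theta> f)) A) / ?N = (\<integral>x. L x * indicator A x \<partial>law0)"
  proof -
    have "integrable law0 (\<lambda>x. likelihood_ratio (\<Theta> f) x * indicator A x)" for f
      using integrable_mult_indicator[OF A likelihood_ratio_integrals(1)[of "\<Theta> f"]] by (simp add: mult.commute)
    thus ?thesis unfolding L_def likelihood_ratio_integrals(3)[OF A]
      by (simp add: sum_distrib_right)
  qed
  ultimately have S: "(\<integral>x. L x * indicator A x \<partial>law0) \<le> S" by simp
  have ind: "integrable law0 (\<lambda>x. L x * indicator A x)" "integrable law0 (indicator A :: _ \<Rightarrow> real)"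
    using integrable_mult_indicator[OF A L_int(1)] A by (simp_all add: mult.commute P0.emeasure_eq_measure)
  have int: "integrable law0 (\<lambda>x. \<eta> / 2 + ((L x)\<^sup>2 - 2 * L x + 1) / (2 * \<eta>))"
    using L2_int L_int(1) by auto
  \<comment> \<open>The Cauchy-Schwarz inequality is replaced by \<open>1 - L \<le> \<eta>/2 + (1 - L)\<^sup>2 / (2 \<eta>)\<close>.\<close>
  have "measure law0 A - (\<integral>x. L x * indicator A x \<partial>law0) = (\<integral>x. indicator A x - L x * indicator A x \<partial>law0)"
  proof -
    have "A \<inter> space law0 = A" using sets.sets_into_space[OF A] by blast
    thus ?thesis using ind by simp
  qed
  also have "\<dots> \<le> (\<integral>x. \<eta> / 2 + ((L x)\<^sup>2 - 2 * L x + 1) / (2 * \<eta>) \<partial>law0)"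
  proof (rule integral_mono[OF _ int])
    show "integrable law0 (\<lambda>x. indicator A x - L x * indicator A x)" using ind by auto
    fix x
    have sqs: "0 \<le> (\<eta> - (1 - L x))\<^sup>2" "0 \<le> (1 - L x)\<^sup>2" by auto
    have "2 * \<eta> * (1 - L x) \<le> \<eta>\<^sup>2 + (1 - L x)\<^sup>2" using sqs(1) by (simp add: power2_diff)
    hence "1 - L x \<le> \<eta> / 2 + (1 - L x)\<^sup>2 / (2 * \<eta>)"
      using \<eta> by (simp add: field_simps power2_eq_square)
    moreover have "0 \<le> \<eta> / 2 + (1 - L x)\<^sup>2 / (2 * \<eta>)" using \<eta> by simp
    moreover have "(1 - L x)\<^sup>2 = (L x)\<^sup>2 - 2 * L x + 1" by (simp add: power2_diff)
    ultimately show "indicator A x - L x * indicator A x \<le> \<eta> / 2 + ((L x)\<^sup>2 - 2 * L x + 1) / (2 * \<eta>)"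
      by (auto simp: indicator_def)
  qed
  also have "\<dots> = \<eta> / 2 + ((\<integral>x. (L x)\<^sup>2 \<partial>law0) - 1) / (2 * \<eta>)"
    using L2_int L_int by (simp add: P0.prob_space)
  also have "\<dots> \<le> \<eta> / 2 + \<eta>\<^sup>2 / (2 * \<eta>)" using L2 \<eta> by (intro add_left_mono divide_right_mono) auto
  also have "\<dots> = \<eta>" using \<eta> by (simp add: power2_eq_square)
  finally show "1 - \<eta> \<le> measure law0 {x \<in> {..<p} \<rightarrow>\<^sub>E UNIV. \<phi> x = 1} +
      (SUP \<theta>\<in>sparse_alternatives p s \<epsilon>. measure (law \<theta>) {x \<in> {..<p} \<rightarrow>\<^sub>E UNIV. \<phi> x = 0})"
    using S unfolding type1 S_def A_def by simp
qed

end

section \<open>The lower bound\<close>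

lemma sum_mult_indicator_subset:
  fixes c :: real
  assumes "finite A" "S \<subseteq> A"
  shows "(\<Sum>i\<in>A. c * indicator S i) = c * card S"
proof -
  have "(\<Sum>i\<in>A. c * indicator S i) = (\<Sum>i\<in>S. c)"
    using assms by (intro sum.mono_neutral_cong_right) auto
  thus ?thesis by simp
qed

context group_model
begin

text \<open>
  Since the entries are nonnegative, the correlation can only decrease the inner product of two
  alternatives.
\<close>

lemma cov_inner_sparse_le:
  assumes a: "0 \<le> a" and S: "S \<subseteq> {..<p}" "S' \<subseteq> {..<p}"
  shows "cov_inner (\<lambda>i\<in>{..<p}. a * indicator S i) (\<lambda>i\<in>{..<p}. a * indicator S' i) \<le>
    a\<^sup>2 / lam0 * card (S \<inter> S')"
proof -
  have "(\<Sum>i<p. (\<lambda>i\<in>{..<p}. a * indicator S i) i * (\<lambda>i\<in>{..<p}. a * indicator S' i) i) =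
      (\<Sum>i<p. a\<^sup>2 * indicator (S \<inter> S') i)"
    by (intro sum.cong) (auto simp: indicator_def power2_eq_square)
  also have "\<dots> = a\<^sup>2 * card (S \<inter> S')"
    using S by (intro sum_mult_indicator_subset) auto
  finally have main: "(\<Sum>i<p. (\<lambda>i\<in>{..<p}. a * indicator S i) i * (\<lambda>i\<in>{..<p}. a * indicator S' i) i) =
      a\<^sup>2 * card (S \<inter> S')" .
  have nonneg: "0 \<le> (\<Sum>i\<in>B k. (\<lambda>i\<in>{..<p}. a * indicator A i) i)" if "k < R" for k A
    using a B_subset[OF that] by (intro sum_nonneg) (auto simp: indicator_def)
  have "0 \<le> (\<Sum>k<R. (\<Sum>i\<in>B k. (\<lambda>i\<in>{..<p}. a * indicator S i) i) *
      (\<Sum>i\<in>B k. (\<lambda>i\<in>{..<p}. a * indicator S' i) i))"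
    by (rule sum_nonneg, rule mult_nonneg_nonneg; rule nonneg, simp)
  hence "0 \<le> \<gamma> / lam1 * (\<Sum>k<R. (\<Sum>i\<in>B k. (\<lambda>i\<in>{..<p}. a * indicator S i) i) *
      (\<Sum>i\<in>B k. (\<lambda>i\<in>{..<p}. a * indicator S' i) i))"
    using \<gamma> lam1_pos by (intro mult_nonneg_nonneg[OF divide_nonneg_pos]) auto
  hence "cov_inner (\<lambda>i\<in>{..<p}. a * indicator S i) (\<lambda>i\<in>{..<p}. a * indicator S' i) \<le> a\<^sup>2 * card (S \<inter> S') / lam0"
    unfolding cov_inner_def main using lam0_pos by (intro divide_right_mono) auto
  thus ?thesis by simp
qed

lemma cov_inner_group_sparse:
  assumes S: "S \<subseteq> {..<R}" "S' \<subseteq> {..<R}"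
  shows "cov_inner (\<lambda>i\<in>{..<p}. a * indicator S (grp i)) (\<lambda>i\<in>{..<p}. a * indicator S' (grp i)) =
    a\<^sup>2 * m / lam1 * card (S \<inter> S')"
proof -
  let ?d = "\<lambda>A. \<lambda>i\<in>{..<p}. a * indicator A (grp i)"
  have d: "?d A i = a * indicator A k" if "k < R" "i \<in> B k" for A i k
    using that B_subset grp_eq by auto
  have sum: "(\<Sum>i\<in>B k. ?d A i) = m * a * indicator A k" if "k < R" for A k
    using d[OF that] card_B[OF that] by simp
  have card: "(\<Sum>k<R. c * indicator (S \<inter> S') k) = c * card (S \<inter> S')" for c :: real
    using S by (intro sum_mult_indicator_subset) auto
  have "(\<Sum>i<p. ?d S i * ?d S' i) = (\<Sum>k<R. \<Sum>i\<in>B k. a\<^sup>2 * indicator (S \<inter> S') k)"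
    unfolding sum_groups
    by (rule sum.cong[OF refl], rule sum.cong[OF refl])
      (simp only: lessThan_iff d, simp add: indicator_def power2_eq_square)
  also have "\<dots> = (\<Sum>k<R. m * a\<^sup>2 * indicator (S \<inter> S') k)"
    by (rule sum.cong[OF refl]) (simp add: card_B)
  also have "\<dots> = m * a\<^sup>2 * card (S \<inter> S')" by (rule card)
  finally have 1: "(\<Sum>i<p. ?d S i * ?d S' i) = m * a\<^sup>2 * card (S \<inter> S')" .
  have "(\<Sum>k<R. (\<Sum>i\<in>B k. ?d S i) * (\<Sum>i\<in>B k. ?d S' i)) = (\<Sum>k<R. (m * a)\<^sup>2 * indicator (S \<inter> S') k)"
    by (rule sum.cong[OF refl]) (simp only: lessThan_iff sum, simp add: indicator_def power2_eq_square)
  also have "\<dots> = (m * a)\<^sup>2 * card (S \<inter> S')" by (rule card)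
  finally have 2: "(\<Sum>k<R. (\<Sum>i\<in>B k. ?d S i) * (\<Sum>i\<in>B k. ?d S' i)) = (m * a)\<^sup>2 * card (S \<inter> S')" .
  have "m * a\<^sup>2 * card (S \<inter> S') - \<gamma> / lam1 * ((m * a)\<^sup>2 * card (S \<inter> S')) =
      (a\<^sup>2 * m * card (S \<inter> S')) * (1 - \<gamma> * m / lam1)"
    by (simp add: power_mult_distrib power2_eq_square algebra_simps)
  also have "1 - \<gamma> * m / lam1 = lam0 / lam1" using lam1_pos by (simp add: lam1_eq field_simps)
  finally show ?thesis unfolding cov_inner_def 1 2 using lam0_pos by simp
qed

lemma testing_risk_ge_block_prior:
  fixes a u \<eta> \<delta> :: real and \<Theta> :: "nat set \<Rightarrow> nat \<Rightarrow> real"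
  assumes \<eta>: "0 < \<eta>" "\<eta> < 1" and r: "1 \<le> r" "r\<^sup>2 \<le> n"
    and alt: "\<And>S. S \<subseteq> {..<n} \<Longrightarrow> card S = r \<Longrightarrow> \<Theta> S \<in> sparse_alternatives p s \<epsilon>"
    and inner: "\<And>S S'. S \<subseteq> {..<n} \<Longrightarrow> S' \<subseteq> {..<n} \<Longrightarrow> cov_inner (\<Theta> S) (\<Theta> S') \<le> u * card (S \<inter> S')"
    and u: "u \<le> \<delta> * ln (1 + n / (real r)\<^sup>2)" and \<delta>: "0 \<le> \<delta>" "2 * \<delta> \<le> ln (1 + \<eta>\<^sup>2)"
  shows "1 - \<eta> \<le> testing_risk p s \<gamma> R B \<epsilon>"
proof (rule testing_risk_ge[OF finite_block_choices _ \<eta>(1)])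
  let ?F = "block_choices n r" and ?S = "block_support n r"
  have "r * 1 \<le> r\<^sup>2" using r by (simp add: power2_eq_square)
  hence "r \<le> n" using r by simp
  thus "?F \<noteq> {}" using r by (intro block_choices_nonempty)
  show "\<Theta> (?S f) \<in> sparse_alternatives p s \<epsilon>" if "f \<in> ?F" for f
    using block_support[OF that] by (intro alt)
  have \<eta>2: "\<eta>\<^sup>2 \<le> 1" using \<eta> by (simp add: power_le_one)
  hence "ln (1 + \<eta>\<^sup>2) \<le> \<eta>\<^sup>2" by (intro ln_add_one_self_le_self) simp
  hence \<delta>1: "\<delta> \<le> 1" using \<delta>(2) \<eta>2 by linarith
  have "(\<Sum>f\<in>?F. \<Sum>g\<in>?F. exp (cov_inner (\<Theta> (?S f)) (\<Theta> (?S g)))) \<le>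
      (\<Sum>f\<in>?F. \<Sum>g\<in>?F. exp (u * card (?S f \<inter> ?S g)))"
    using block_support(1) by (intro sum_mono) (simp add: inner)
  also have "\<dots> \<le> exp (2 * \<delta>) * (card ?F)\<^sup>2"
    by (rule block_overlap_moment[OF r \<delta>(1) \<delta>1 u])
  also have "\<dots> \<le> (1 + \<eta>\<^sup>2) * (card ?F)\<^sup>2"
  proof (rule mult_right_mono)
    have "exp (2 * \<delta>) \<le> exp (ln (1 + \<eta>\<^sup>2))" using \<delta>(2) by simp
    also have "\<dots> = 1 + \<eta>\<^sup>2" by (rule exp_ln) (simp add: add_pos_nonneg)
    finally show "exp (2 * \<delta>) \<le> 1 + \<eta>\<^sup>2" .
  qed simp
  finally show "(\<Sum>f\<in>?F. \<Sum>g\<in>?F. exp (cov_inner (\<Theta> (?S f)) (\<Theta> (?S g)))) \<le> (1 + \<eta>\<^sup>2) * (card ?F)\<^sup>2" .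
qed

text \<open>
  The dominating term of the rate decides whether the prior puts equal entries on single coordinates
  or on whole groups. The size \<open>a\<close> of the entries makes the norm exactly \<open>c\<close> times the rate.
\<close>

lemma testing_risk_lower:
  assumes s: "real m \<le> real s" "s \<le> p" and \<eta>: "0 < \<eta>" "\<eta> < 1"
    and c: "0 < c" "16 * c\<^sup>2 \<le> ln (1 + \<eta>\<^sup>2)"
  shows "1 - \<eta> \<le> testing_risk p s \<gamma> R B (c * sqrt (rate_sq p s \<gamma> R))"
proof -
  define t where "t = real s / m"
  define \<psi> where "\<psi> = rate_sq p s \<gamma> R"
  have m: "0 < real m" using m_pos by simp
  have t: "1 \<le> t" using s m by (simp add: t_def)
  have s1: "1 \<le> real s" using s m_pos by linarith
  have rate: "\<psi> = lam0 * seq_rate p s + lam1 * seq_rate R t"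
    unfolding t_def \<psi>_def by (rule rate_sq_eq[OF s(1)])
  have pos: "0 \<le> seq_rate n r" if "1 \<le> r" for n r
    using that by (auto simp: seq_rate_def intro!: mult_nonneg_nonneg ln_ge_zero)
  have \<psi>0: "0 \<le> \<psi>" unfolding rate using pos[OF s1] pos[OF t] lam0_pos lam1_pos by simp
  have norm: "sqrt (c\<^sup>2 * \<psi>) = c * sqrt \<psi>" using c(1) by (simp add: real_sqrt_mult)
  have \<delta>: "0 \<le> 8 * c\<^sup>2" "2 * (8 * c\<^sup>2) \<le> ln (1 + \<eta>\<^sup>2)" using c by auto
  consider "\<psi> \<le> 2 * (lam0 * seq_rate p s)" | "\<psi> \<le> 2 * (lam1 * seq_rate R t)"
    unfolding rate by linarith
  thus ?thesis unfolding \<psi>_def[symmetric]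
  proof cases
    case 1
    obtain r :: nat where r: "1 \<le> r" "real r \<le> s" "r\<^sup>2 \<le> p"
      and le: "seq_rate p s \<le> 4 * real r * ln (1 + p / (real r)\<^sup>2)"
      by (rule seq_rate_le_integer_sparsity[OF p s1]) (rule that; simp)
    define a where "a = sqrt (c\<^sup>2 * \<psi> / r)"
    have a: "0 \<le> a" "a\<^sup>2 * r = c\<^sup>2 * \<psi>" using \<psi>0 r by (auto simp: a_def)
    show "1 - \<eta> \<le> testing_risk p s \<gamma> R B (c * sqrt \<psi>)"
    proof (rule testing_risk_ge_block_prior[OF \<eta> r(1,3) _ _ _ \<delta>])
      fix S assume S: "S \<subseteq> {..<p}" "card S = r"
      let ?\<theta> = "\<lambda>i\<in>{..<p}. a * indicator S i"
      have "(\<Sum>i<p. (?\<theta> i)\<^sup>2) = (\<Sum>i<p. a\<^sup>2 * indicator S i)"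
        by (intro sum.cong) (auto simp: indicator_def power2_eq_square)
      also have "\<dots> = c\<^sup>2 * \<psi>"
        using S a(2) by (subst sum_mult_indicator_subset) auto
      finally have "L2_set ?\<theta> {..<p} = c * sqrt \<psi>" unfolding L2_set_def norm[symmetric] by simp
      moreover have "card {i \<in> {..<p}. ?\<theta> i \<noteq> 0} \<le> card S"
        using S finite_subset[OF S(1)] by (intro card_mono) (auto simp: indicator_def split: if_splits)
      hence "card {i \<in> {..<p}. ?\<theta> i \<noteq> 0} \<le> s" using S(2) r(2) by simp
      ultimately show "?\<theta> \<in> sparse_alternatives p s (c * sqrt \<psi>)"
        unfolding sparse_alternatives_def by simp
    next
      fix S S' assume "S \<subseteq> {..<p}" "S' \<subseteq> {..<p}"
      thus "cov_inner (\<lambda>i\<in>{..<p}. a * indicator S i) (\<lambda>i\<in>{..<p}. a * indicator S' i) \<le>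
          a\<^sup>2 / lam0 * card (S \<inter> S')" by (rule cov_inner_sparse_le[OF a(1)])
    next
      have "a\<^sup>2 * r = c\<^sup>2 * \<psi>" by (rule a)
      also have "\<dots> \<le> c\<^sup>2 * (2 * (lam0 * (4 * r * ln (1 + p / (real r)\<^sup>2))))"
        using 1 le lam0_pos by (intro mult_left_mono) (auto intro: order_trans)
      also have "\<dots> = (8 * c\<^sup>2 * ln (1 + p / (real r)\<^sup>2) * lam0) * r" by simp
      finally have "a\<^sup>2 \<le> 8 * c\<^sup>2 * ln (1 + p / (real r)\<^sup>2) * lam0" using r(1) by simp
      thus "a\<^sup>2 / lam0 \<le> 8 * c\<^sup>2 * ln (1 + p / (real r)\<^sup>2)" using lam0_pos by (simp add: pos_divide_le_eq)
    qed
  next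
    case 2
    obtain r :: nat where r: "1 \<le> r" "real r \<le> t" "r\<^sup>2 \<le> R"
      and le: "seq_rate R t \<le> 4 * real r * ln (1 + R / (real r)\<^sup>2)"
      by (rule seq_rate_le_integer_sparsity[OF R(1) t]) (rule that; simp)
    define a where "a = sqrt (c\<^sup>2 * \<psi> / (m * r))"
    have a: "a\<^sup>2 * (m * r) = c\<^sup>2 * \<psi>" using \<psi>0 r m by (auto simp: a_def)
    show "1 - \<eta> \<le> testing_risk p s \<gamma> R B (c * sqrt \<psi>)"
    proof (rule testing_risk_ge_block_prior[OF \<eta> r(1,3) _ _ _ \<delta>])
      fix S assume S: "S \<subseteq> {..<R}" "card S = r"
      let ?\<theta> = "\<lambda>i\<in>{..<p}. a * indicator S (grp i)"
      have count: "(\<Sum>i<p. indicator S (grp i)) = real (m * r)"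
      proof -
        have "(\<Sum>i<p. indicator S (grp i)) = (\<Sum>k<R. \<Sum>i\<in>B k. indicator S k :: real)"
          unfolding sum_groups by (rule sum.cong[OF refl], rule sum.cong[OF refl]) (simp add: grp_eq)
        also have "\<dots> = (\<Sum>k<R. real m * indicator S k)" by (rule sum.cong[OF refl]) (simp add: card_B)
        also have "\<dots> = real (m * r)"
          using S by (subst sum_mult_indicator_subset) auto
        finally show ?thesis .
      qed
      have "(\<Sum>i<p. (?\<theta> i)\<^sup>2) = (\<Sum>i<p. a\<^sup>2 * indicator S (grp i))"
        by (intro sum.cong) (auto simp: indicator_def power2_eq_square)
      also have "\<dots> = c\<^sup>2 * \<psi>" using a by (simp add: sum_distrib_left[symmetric] count)
      finally have "L2_set ?\<theta> {..<p} = c * sqrt \<psi>" unfolding L2_set_def norm[symmetric] by simp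
      moreover have "real (card {i \<in> {..<p}. ?\<theta> i \<noteq> 0}) = (\<Sum>i<p. if ?\<theta> i \<noteq> 0 then 1 else 0)"
        by (subst sum.inter_filter[symmetric]) auto
      moreover have "\<dots> \<le> (\<Sum>i<p. indicator S (grp i))"
        by (intro sum_mono) (auto simp: indicator_def)
      moreover have "real (m * r) \<le> s" using r(2) m by (simp add: t_def pos_le_divide_eq mult.commute)
      ultimately show "?\<theta> \<in> sparse_alternatives p s (c * sqrt \<psi>)"
        unfolding sparse_alternatives_def count by simp
    next
      fix S S' assume "S \<subseteq> {..<R}" "S' \<subseteq> {..<R}"
      thus "cov_inner (\<lambda>i\<in>{..<p}. a * indicator S (grp i)) (\<lambda>i\<in>{..<p}. a * indicator S' (grp i)) \<le>
          a\<^sup>2 * m / lam1 * card (S \<inter> S')" by (simp only: cov_inner_group_sparse order_refl)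
    next
      have "a\<^sup>2 * m * r = c\<^sup>2 * \<psi>" using a by simp
      also have "\<dots> \<le> c\<^sup>2 * (2 * (lam1 * (4 * r * ln (1 + R / (real r)\<^sup>2))))"
        using 2 le lam1_pos by (intro mult_left_mono) (auto intro: order_trans)
      also have "\<dots> = (8 * c\<^sup>2 * ln (1 + R / (real r)\<^sup>2) * lam1) * r" by simp
      finally have "a\<^sup>2 * m \<le> 8 * c\<^sup>2 * ln (1 + R / (real r)\<^sup>2) * lam1" using r(1) by simp
      thus "a\<^sup>2 * m / lam1 \<le> 8 * c\<^sup>2 * ln (1 + R / (real r)\<^sup>2)" using lam1_pos by (simp add: pos_divide_le_eq)
    qed
  qed
qed

end

section \<open>The minimax separation rate\<close>

theorem theorem6:
  "minimax_separation_rate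
     {(p, s, \<gamma>, R). R \<in> {1..p} \<and> R dvd p \<and> real p / real R \<le> real s \<and> s \<le> p \<and> 0 \<le> \<gamma> \<and> \<gamma> < 1}
     (\<lambda>p s \<gamma> R. sqrt (rate_sq p s \<gamma> R))"
  unfolding minimax_separation_rate_def
proof (intro conjI ballI)
  fix \<eta> :: real assume "\<eta> \<in> {0<..<1}"
  hence \<eta>: "0 < \<eta>" "\<eta> < 1" by auto
  let ?C = "sqrt (192 + 1536000 / \<eta>)"
  have "testing_risk p s \<gamma> R B (C * sqrt (rate_sq p s \<gamma> R)) \<le> \<eta>"
    if "R \<in> {1..p}" "R dvd p" "real p / real R \<le> real s" "0 \<le> \<gamma>" "\<gamma> < 1"
      "equal_groups p R B" "?C < C" for p s \<gamma> R B C
  proof -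
    interpret group_model p R \<gamma> B by standard (use that in auto)
    have "real m \<le> real s" using that by (simp add: m_eq)
    have "0 < ?C" using \<eta> by (simp add: add_pos_pos)
    hence C: "0 < C" using that(7) by linarith
    have "?C\<^sup>2 \<le> C\<^sup>2" using that(7) \<open>0 < ?C\<close> by (intro power_mono) auto
    hence C2: "192 + 1536000 / \<eta> \<le> C\<^sup>2" using \<eta> by simp
    have "0 < 1536000 / \<eta>" using \<eta> by simp
    hence "24 \<le> C\<^sup>2 / 8" "1536000 / \<eta> \<le> C\<^sup>2" using C2 by linarith+
    hence "testing_risk p s \<gamma> R B (C * sqrt (rate_sq p s \<gamma> R)) \<le> 1536000 / C\<^sup>2"
      using \<open>real m \<le> real s\<close> C by (intro testing_risk_upper) auto
    also have "\<dots> \<le> \<eta>" using \<open>1536000 / \<eta> \<le> C\<^sup>2\<close> \<eta> C by (simp add: field_simps)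
    finally show ?thesis .
  qed
  moreover have "0 < ?C" using \<eta> by (simp add: add_pos_pos)
  ultimately show "\<exists>C\<^sub>\<eta>>0. \<forall>(p, s, \<gamma>, R)\<in>{(p, s, \<gamma>, R). R \<in> {1..p} \<and> R dvd p \<and> real p / real R \<le> real s \<and>
      s \<le> p \<and> 0 \<le> \<gamma> \<and> \<gamma> < 1}. \<forall>B. equal_groups p R B \<longrightarrow>
      (\<forall>C>C\<^sub>\<eta>. testing_risk p s \<gamma> R B (C * sqrt (rate_sq p s \<gamma> R)) \<le> \<eta>)"
    by (intro exI[of _ ?C]) blast
next
  fix \<eta> :: real assume "\<eta> \<in> {0<..<1}"
  hence \<eta>: "0 < \<eta>" "\<eta> < 1" by auto
  let ?c = "sqrt (ln (1 + \<eta>\<^sup>2) / 16)"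
  have ln: "0 < ln (1 + \<eta>\<^sup>2)" using \<eta> by (intro ln_gt_zero) simp
  have "1 - \<eta> \<le> testing_risk p s \<gamma> R B (c * sqrt (rate_sq p s \<gamma> R))"
    if "R \<in> {1..p}" "R dvd p" "real p / real R \<le> real s" "s \<le> p" "0 \<le> \<gamma>" "\<gamma> < 1"
      "equal_groups p R B" "0 < c" "c < ?c" for p s \<gamma> R B c
  proof -
    interpret group_model p R \<gamma> B by standard (use that in auto)
    have "c\<^sup>2 \<le> ?c\<^sup>2" using that(8,9) by (intro power_mono) auto
    hence "16 * c\<^sup>2 \<le> ln (1 + \<eta>\<^sup>2)" using ln by simp
    moreover have "real m \<le> real s" using that by (simp add: m_eq)
    ultimately show ?thesis using that \<eta> by (intro testing_risk_lower) auto
  qed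
  moreover have "0 < ?c" using ln by simp
  ultimately show "\<exists>c\<^sub>\<eta>>0. \<forall>(p, s, \<gamma>, R)\<in>{(p, s, \<gamma>, R). R \<in> {1..p} \<and> R dvd p \<and> real p / real R \<le> real s \<and>
      s \<le> p \<and> 0 \<le> \<gamma> \<and> \<gamma> < 1}. \<forall>B. equal_groups p R B \<longrightarrow>
      (\<forall>c. 0 < c \<and> c < c\<^sub>\<eta> \<longrightarrow> 1 - \<eta> \<le> testing_risk p s \<gamma> R B (c * sqrt (rate_sq p s \<gamma> R)))"
    by (intro exI[of _ ?c]) blast
qed

end
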